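(* Let $(\mathbb{X},\mathcal{X})$ and $(\mathbb{Y},\mathcal{Y})$ be measurable spaces, let $k\in\mathbb{N}$, let $D\subset\mathbb{X}^k$ be a symmetric set belonging to the product $\sigma$-field of $\mathbb{X}^k$, and let $g:D\to\mathbb{Y}$ be a symmetric measurable function. Let $\eta$ be a Poisson process on $\mathbb{X}$ with finite intensity measure $\mu$, and let $\xi$ be the point process on $\mathbb{Y}$ given by $$\xi=\frac{1}{k!}\sum_{(x_1,\dots,x_k)\in\eta^k_{\neq}\cap D}\delta_{g(x_1,\dots,x_k)}.$$ Let $\lambda$ denote the intensity measure of $\xi$. Define $$R=\max_{1\le i\le k-1}\int_{\mathbb{X}^i}\bigg(\int_{\mathbb{X}^{k-i}}\mathbf{1}\{(x_1,\dots,x_k)\in D\}\,\mu^{k-i}(d(x_{i+1},\dots,x_k))\bigg)^2\mu^i(d(x_1,\dots,x_i))$$ for $k\ge 2$, and $R=0$ for $k=1$. Let $\gamma$ be a Poisson process on $\mathbb{Y}$ with intensity measure $\lambda$. Then $$d_\pi(\xi,\gamma)\le\frac{2^{k+1}}{k!}R.$$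
   Context: Symmetric means: for any $(x_1,\dots,x_k)\in D$ and any permutation $\sigma$ of $\{1,\dots,k\}$, $(x_{\sigma(1)},\dots,x_{\sigma(k)})\in D$ and $g(x_1,\dots,x_k)=g(x_{\sigma(1)},\dots,x_{\sigma(k)})$. For a measurable space $(\mathbb{S},\mathcal{S})$, $\mathsf{N}_{\mathbb{S}}$ is the collection of all $\sigma$-finite counting measures on $\mathbb{S}$, equipped with the smallest $\sigma$-field making $\nu\mapsto\nu(B)$ measurable for all $B\in\mathcal{S}$. A point process on $\mathbb{S}$ is a random element of $\mathsf{N}_{\mathbb{S}}$; its intensity measure is $B\mapsto\mathbb{E}[\xi(B)]$, $B\in\mathcal{S}$. Any Poisson process can be seen as a proper point process, i.e. written as $\delta_{X_1}+\dots+\delta_{X_\tau}$ with random elements $X_1,X_2,\dots$ and a random variable $\tau\in\mathbb{N}_0\cup\{\infty\}$, $\mathbb{N}_0=\mathbb{N}\cup\{0\}$. For $\zeta=\sum_{i\in I}\delta_{x_i}\in\mathsf{N}_{\mathbb{X}}$ with $I$ at most countable, $\zeta^k_{\neq}$ denotes the collection of all $k$-tuples $(x_{i_1},\dots,x_{i_k})$ of points of $\zeta$ with pairwise distinct indices. Since $\mu$ is finite, $\lambda(\mathbb{Y})<\infty$. $\mathcal{Y}^d_{\mathrm{disj}}=\{(A_1,\dots,A_d)\in\mathcal{Y}^d: A_i\cap A_j=\emptyset,\ i\neq j\}$. For point processes $\xi,\zeta$ on $\mathbb{Y}$ with finite intensity measure, $$d_\pi(\xi,\zeta)=\sup_{(A_1,\dots,A_d)\in\mathcal{Y}^d_{\mathrm{disj}},\,d\in\mathbb{N}}d_W\big((\xi(A_1),\dots,\xi(A_d)),(\zeta(A_1),\dots,\zeta(A_d))\big),$$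 where for integrable random vectors $\mathbf{U},\mathbf{V}$ in $\mathbb{N}_0^d$, $d_W(\mathbf{U},\mathbf{V})=\sup_{h}|\mathbb{E}[h(\mathbf{U})]-\mathbb{E}[h(\mathbf{V})]|$, the supremum being over all $h:\mathbb{N}_0^d\to\mathbb{R}$ with $|h(\mathbf{x})-h(\mathbf{y})|\le\sum_{i=1}^d|x_i-y_i|$ for all $\mathbf{x},\mathbf{y}\in\mathbb{N}_0^d$. (When the intensity measure is finite, these vectors take values in $\mathbb{N}_0^d$ almost surely.) *)

theory Defs
  imports "HOL-Probability.Probability"
begin

definition counting_measures :: "'a measure \<Rightarrow> 'a measure set" where
  "counting_measures S = {\<nu>. sets \<nu> = sets S \<and> sigma_finite_measure \<nu> \<and>
     (\<forall>B\<in>sets S. emeasure \<nu> B \<in> range of_nat \<union> {\<infinity>})}"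

definition counting_measure_algebra :: "'a measure \<Rightarrow> 'a measure measure" where
  "counting_measure_algebra S =
     (SUP B \<in> sets S. vimage_algebra (counting_measures S) (\<lambda>\<nu>. emeasure \<nu> B) borel)"

definition point_process :: "'w measure \<Rightarrow> 'a measure \<Rightarrow> ('w \<Rightarrow> 'a measure) \<Rightarrow> bool" where
  "point_process M S \<xi> \<longleftrightarrow> prob_space M \<and> \<xi> \<in> M \<rightarrow>\<^sub>M counting_measure_algebra S"

definition intensity_measure :: "'w measure \<Rightarrow> 'a measure \<Rightarrow> ('w \<Rightarrow> 'a measure) \<Rightarrow> 'a measure" where
  "intensity_measure M S \<xi> =
     measure_of (space S) (sets S) (\<lambda>B. \<integral>\<^sup>+\<omega>. emeasure (\<xi> \<omega>) B \<partial>M)"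

definition poisson_process ::
  "'w measure \<Rightarrow> 'a measure \<Rightarrow> 'a measure \<Rightarrow> ('w \<Rightarrow> 'a measure) \<Rightarrow> bool" where
  "poisson_process M S \<mu> \<eta> \<longleftrightarrow>
     point_process M S \<eta> \<and> sets \<mu> = sets S \<and>
     (\<forall>B\<in>sets S. emeasure \<mu> B < \<infinity> \<longrightarrow>
        (\<forall>n::nat. measure M {\<omega> \<in> space M. emeasure (\<eta> \<omega>) B = of_nat n} =
           measure \<mu> B ^ n / fact n * exp (- measure \<mu> B))) \<and>
     (\<forall>B\<in>sets S. emeasure \<mu> B = \<infinity> \<longrightarrow> (AE \<omega> in M. emeasure (\<eta> \<omega>) B = \<infinity>)) \<and>
     (\<forall>(m::nat) A. A \<in> {..<m} \<rightarrow> sets S \<longrightarrow> disjoint_family_on A {..<m} \<longrightarrow>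
        prob_space.indep_vars M (\<lambda>_. borel) (\<lambda>i \<omega>. emeasure (\<eta> \<omega>) (A i)) {..<m})"

text \<open>The sum of the Dirac measures at the points \<open>x i\<close>, \<open>i \<in> I\<close>, counted with multiplicity,
  is the image under \<open>x\<close> of the counting measure on \<open>I\<close>.\<close>

definition dirac_sum :: "'i set \<Rightarrow> 'a measure \<Rightarrow> ('i \<Rightarrow> 'a) \<Rightarrow> 'a measure" where
  "dirac_sum I S x = distr (count_space I) S x"

text \<open>The points of a proper point process are \<open>X 0, X 1, \<dots>\<close> up to the (possibly infinite)
  total number \<open>\<tau>\<close>.\<close>

definition index_set :: "enat \<Rightarrow> nat set" where
  "index_set t = {n. enat n < t}"

definition proper_representation ::
  "'w measure \<Rightarrow> 'a measure \<Rightarrow> ('w \<Rightarrow> 'a measure) \<Rightarrow> (nat \<Rightarrow> 'w \<Rightarrow> 'a) \<Rightarrow> ('w \<Rightarrow> enat) \<Rightarrow> bool" where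
  "proper_representation M S \<eta> X \<tau> \<longleftrightarrow>
     (\<forall>n. X n \<in> M \<rightarrow>\<^sub>M S) \<and> \<tau> \<in> M \<rightarrow>\<^sub>M count_space UNIV \<and>
     (AE \<omega> in M. \<eta> \<omega> = dirac_sum (index_set (\<tau> \<omega>)) S (\<lambda>n. X n \<omega>))"

text \<open>Elements of a \<open>k\<close>-fold product are extensional functions on \<open>{..<k}\<close>; if \<open>p\<close> permutes
  \<open>{..<k}\<close>, then \<open>x \<circ> p\<close> is again such a function.\<close>

definition symmetric_set :: "nat \<Rightarrow> (nat \<Rightarrow> 'a) set \<Rightarrow> bool" where
  "symmetric_set k D \<longleftrightarrow> (\<forall>x\<in>D. \<forall>p. p permutes {..<k} \<longrightarrow> x \<circ> p \<in> D)"

definition symmetric_fun :: "nat \<Rightarrow> (nat \<Rightarrow> 'a) set \<Rightarrow> ((nat \<Rightarrow> 'a) \<Rightarrow> 'b) \<Rightarrow> bool" where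
  "symmetric_fun k D g \<longleftrightarrow> (\<forall>x\<in>D. \<forall>p. p permutes {..<k} \<longrightarrow> g (x \<circ> p) = g x)"

text \<open>Tuples of points with pairwise distinct indices are represented by their index tuples, so
  that coinciding points are counted with the right multiplicity.\<close>

definition distinct_tuples_in ::
  "nat \<Rightarrow> 'i set \<Rightarrow> ('i \<Rightarrow> 'a) \<Rightarrow> (nat \<Rightarrow> 'a) set \<Rightarrow> (nat \<Rightarrow> 'i) set" where
  "distinct_tuples_in k I x D =
     {s \<in> {..<k} \<rightarrow>\<^sub>E I. inj_on s {..<k} \<and> (\<lambda>j\<in>{..<k}. x (s j)) \<in> D}"

definition tuple_image_measure ::
  "nat \<Rightarrow> (nat \<Rightarrow> 'a) set \<Rightarrow> ((nat \<Rightarrow> 'a) \<Rightarrow> 'b) \<Rightarrow> 'b measure \<Rightarrow> 'i set \<Rightarrow> ('i \<Rightarrow> 'a) \<Rightarrow> 'b measure" where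
  "tuple_image_measure k D g Y I x =
     scale_measure (1 / fact k)
       (dirac_sum (distinct_tuples_in k I x D) Y (\<lambda>s. g (\<lambda>j\<in>{..<k}. x (s j))))"

definition R_bound :: "nat \<Rightarrow> 'a measure \<Rightarrow> (nat \<Rightarrow> 'a) set \<Rightarrow> ennreal" where
  "R_bound k \<mu> D =
     (if k \<ge> 2 then
        Max ((\<lambda>i. \<integral>\<^sup>+x. (\<integral>\<^sup>+y. indicator D (merge {..<i} {i..<k} (x, y))
                     \<partial>(\<Pi>\<^sub>M j\<in>{i..<k}. \<mu>))\<^sup>2 \<partial>(\<Pi>\<^sub>M j\<in>{..<i}. \<mu>)) ` {1..k - 1})
      else 0)"

definition nat_vectors :: "nat \<Rightarrow> (nat \<Rightarrow> nat) set" where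
  "nat_vectors d = {..<d} \<rightarrow>\<^sub>E UNIV"

definition lipschitz_test_functions :: "nat \<Rightarrow> ((nat \<Rightarrow> nat) \<Rightarrow> real) set" where
  "lipschitz_test_functions d =
     {h. \<forall>x\<in>nat_vectors d. \<forall>y\<in>nat_vectors d.
           \<bar>h x - h y\<bar> \<le> (\<Sum>i<d. \<bar>real (x i) - real (y i)\<bar>)}"

definition wasserstein_dist ::
  "nat \<Rightarrow> 'w measure \<Rightarrow> ('w \<Rightarrow> nat \<Rightarrow> nat) \<Rightarrow> 'v measure \<Rightarrow> ('v \<Rightarrow> nat \<Rightarrow> nat) \<Rightarrow> ennreal" where
  "wasserstein_dist d M U N V =
     (SUP h \<in> lipschitz_test_functions d.
        ennreal \<bar>(\<integral>\<omega>. h (U \<omega>) \<partial>M) - (\<integral>\<omega>. h (V \<omega>) \<partial>N)\<bar>)"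

text \<open>\<open>measure \<nu> B\<close> is a natural number for a counting measure \<open>\<nu>\<close> with \<open>emeasure \<nu> B < \<infinity>\<close>.
  If \<open>emeasure \<nu> B = \<infinity>\<close>, the value is 0; for a point process with finite intensity measure this
  affects only a null set.\<close>

definition count_vector :: "nat \<Rightarrow> (nat \<Rightarrow> 'a set) \<Rightarrow> 'a measure \<Rightarrow> nat \<Rightarrow> nat" where
  "count_vector d A \<nu> = (\<lambda>i\<in>{..<d}. nat \<lfloor>measure \<nu> (A i)\<rfloor>)"

definition disjoint_tuples :: "nat \<Rightarrow> 'a measure \<Rightarrow> (nat \<Rightarrow> 'a set) set" where
  "disjoint_tuples d Y = {A. A \<in> {..<d} \<rightarrow> sets Y \<and> disjoint_family_on A {..<d}}"

definition d_pi ::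
  "'a measure \<Rightarrow> 'w measure \<Rightarrow> ('w \<Rightarrow> 'a measure) \<Rightarrow> 'v measure \<Rightarrow> ('v \<Rightarrow> 'a measure) \<Rightarrow> ennreal" where
  "d_pi Y M \<xi> N \<zeta> =
     (SUP d \<in> {1..}. SUP A \<in> disjoint_tuples d Y.
        wasserstein_dist d M (\<lambda>\<omega>. count_vector d A (\<xi> \<omega>)) N (\<lambda>\<omega>. count_vector d A (\<zeta> \<omega>)))"

end

theory Submission
  imports Defs
begin

text \<open>
  Chen-Stein method, one coordinate at a time. For a function \<open>h\<close> on the natural numbers with
  Lipschitz constant 1, the Stein equation \<open>l * f (n + 1) - n * f n = h n - E h(P)\<close>, with \<open>P\<close>
  Poisson distributed with mean \<open>l\<close>, has a solution with \<open>\<bar>f\<bar> \<le> 1\<close>. Replacing the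
  coordinates of \<open>U = (\<xi>(A\<^sub>1), \<dots>, \<xi>(A\<^sub>d))\<close> successively by independent Poisson variables,
  \<open>E h(U) - E h(\<gamma>(A\<^sub>1), \<dots>, \<gamma>(A\<^sub>d))\<close> becomes a sum of terms
  \<open>l\<^sub>i E f(U + e\<^sub>i) - E U\<^sub>i f(U)\<close>. By the Mecke formula each of them is an integral over
  \<open>z\<close> in \<open>D\<close> with \<open>g z\<close> in \<open>A\<^sub>i\<close> of the difference of \<open>f(U + e\<^sub>i)\<close> and \<open>f\<close> at the counts
  obtained after adding the points of \<open>z\<close> to \<open>\<eta>\<close>. The arguments differ only if some tuple in \<open>D\<close>
  mixes points of \<open>z\<close> with points of \<open>\<eta>\<close>, and then the values differ by at most 2. For a fixed
  set \<open>J\<close> of coordinates taken from \<open>z\<close>, the expected number of such tuples, integrated over \<open>z\<close>,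
  is the \<open>card J\<close>-th integral in \<open>R\<close>; there are fewer than \<open>2\<^sup>k\<close> sets \<open>J\<close>.

  The Mecke formula rests on the law of the points: restricted to \<open>\<tau> = m\<close>, the laws of the
  \<open>fact m\<close> permutations of \<open>(X 0, \<dots>, X (m - 1))\<close> sum to \<open>exp (- \<mu>(\<X>))\<close> times the product measure.
\<close>

section \<open>Stein equation for the Poisson distribution\<close>

text \<open>The constant is 2 (oscillation of the Stein solution) times \<open>2 ^ k\<close>
  (choices of \<open>J\<close>) over \<open>fact k\<close> (the Mecke formula counts ordered
  tuples). Mixed tuples enter through a crude alternative: either the two arguments of
  \<open>f\<close> agree, or there is at least one mixed tuple. A sup bound on \<open>f\<close>
  therefore carries the estimate. The successive replacement acts on the test function, not on the
  vector: after \<open>d\<close> steps the function is a constant that depends only on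
  \<open>h\<close> and the means. Both vectors, living on different probability spaces, are compared
  with this constant, \<open>\<gamma>\<close> with error 0. The bound is uniform in \<open>d\<close>
  because disjoint sets \<open>A i\<close> have disjoint preimages in \<open>D\<close>. The obstacle
  in the Mecke formula is that \<open>X 0, X 1, ...\<close> may enumerate the points in any order.
  Only counts in sets have a known law, so only sums over all permutations are accessible. Functions
  of the process are therefore encoded as families \<open>\<Phi> I x\<close> invariant under
  relabelling, and expectations as series over the number of points.\<close>

definition poisson_weight :: "real \<Rightarrow> nat \<Rightarrow> real" where
  "poisson_weight l n = l ^ n / fact n * exp (- l)"

lemma poisson_weight_nonneg: "0 \<le> l \<Longrightarrow> 0 \<le> poisson_weight l n"
  by (simp add: poisson_weight_def)

lemma poisson_weight_pos: "0 < l \<Longrightarrow> 0 < poisson_weight l n"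
  by (simp add: poisson_weight_def)

lemma poisson_weight_Suc: "real (Suc n) * poisson_weight l (Suc n) = l * poisson_weight l n"
  by (simp add: poisson_weight_def field_simps del: of_nat_Suc)

lemma poisson_weight_sums: "poisson_weight l sums 1"
proof -
  have "(\<lambda>n. l ^ n /\<^sub>R fact n * exp (- l)) sums (exp l * exp (- l))"
    by (intro sums_mult2 exp_converges)
  then show ?thesis
    by (simp add: poisson_weight_def[abs_def] divide_inverse mult.commute exp_minus)
qed

lemma poisson_weight_mean_sums: "(\<lambda>n. poisson_weight l n * real n) sums l"
proof -
  have "(\<lambda>n. l * poisson_weight l n) sums (l * 1)"
    by (intro sums_mult poisson_weight_sums)
  then have "(\<lambda>n. poisson_weight l (Suc n) * real (Suc n)) sums l"
    by (simp only: poisson_weight_Suc[symmetric] mult.commute[of "poisson_weight l _"] mult_1_right)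
  then show ?thesis
    by (subst (asm) sums_Suc_iff) simp
qed

text \<open>The sum telescopes, because \<open>j * poisson_weight l j\<close> equals
  \<open>l * poisson_weight l (j - 1)\<close> for \<open>j > 0\<close>.\<close>

lemma poisson_weight_centred_sum:
  "(\<Sum>j\<le>x. (real j - l) * poisson_weight l j) = - l * poisson_weight l x"
proof (induction x)
  case (Suc x)
  then show ?case using poisson_weight_Suc[of x l] by (simp add: algebra_simps)
qed simp

text \<open>If \<open>u x\<close> is at most the mean, every summand is nonpositive. Otherwise every
  term beyond \<open>x\<close> is nonnegative, and the head is minus this tail, since the full
  centred series is 0.\<close>

lemma poisson_centred_partial_sum_le:
  assumes "0 \<le> l" "mono u" "(\<lambda>j. poisson_weight l j * u j) sums m"
  shows "(\<Sum>j\<le>x. (u j - m) * poisson_weight l j) \<le> 0"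
proof (cases "u x \<le> m")
  case True
  show ?thesis
  proof (intro sum_nonpos mult_nonpos_nonneg poisson_weight_nonneg assms(1))
    fix j assume "j \<in> {..x}"
    then show "u j - m \<le> 0" using monoD[OF assms(2), of j x] True by auto
  qed
next
  case False
  have "(\<lambda>j. poisson_weight l j * u j - m * poisson_weight l j) sums (m - m * 1)"
    by (intro sums_diff sums_mult assms(3) poisson_weight_sums)
  then have s: "(\<lambda>j. (u j - m) * poisson_weight l j) sums 0"
    by (simp add: algebra_simps)
  then have tail: "(\<lambda>j. (u (j + Suc x) - m) * poisson_weight l (j + Suc x)) sums
      (0 - (\<Sum>j<Suc x. (u j - m) * poisson_weight l j))"
    by (rule sums_split_initial_segment)
  have nonneg: "0 \<le> (u (j + Suc x) - m) * poisson_weight l (j + Suc x)" for j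
  proof (intro mult_nonneg_nonneg poisson_weight_nonneg assms(1))
    have "u x \<le> u (j + Suc x)" by (rule monoD[OF assms(2)]) simp
    with False show "0 \<le> u (j + Suc x) - m" by linarith
  qed
  have "0 \<le> 0 - (\<Sum>j<Suc x. (u j - m) * poisson_weight l j)"
    by (rule sums_le[OF nonneg sums_zero tail])
  then show ?thesis by (simp add: lessThan_Suc_atMost)
qed

lemma poisson_weight_lipschitz_summable:
  fixes h :: "nat \<Rightarrow> real"
  assumes "0 \<le> l" "\<And>x y. \<bar>h x - h y\<bar> \<le> \<bar>real x - real y\<bar>"
  shows "summable (\<lambda>j. poisson_weight l j * h j)"
proof (rule summable_comparison_test')
  show "summable (\<lambda>j. poisson_weight l j * real j + \<bar>h 0\<bar> * poisson_weight l j)"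
    by (intro summable_add summable_mult sums_summable[OF poisson_weight_sums]
        sums_summable[OF poisson_weight_mean_sums])
  fix n :: nat
  have "\<bar>h n\<bar> \<le> real n + \<bar>h 0\<bar>" using assms(2)[of n 0] by simp
  then have "poisson_weight l n * \<bar>h n\<bar> \<le> poisson_weight l n * (real n + \<bar>h 0\<bar>)"
    by (intro mult_left_mono poisson_weight_nonneg assms(1))
  then show "norm (poisson_weight l n * h n) \<le> poisson_weight l n * real n + \<bar>h 0\<bar> * poisson_weight l n"
    using poisson_weight_nonneg[OF assms(1), of n] by (simp add: abs_mult algebra_simps)
qed

text \<open>Among functions with Lipschitz constant 1 the centred partial sums are extremal for
  \<open>h j = j\<close> and \<open>h j = - j\<close>, where they telescope.\<close>

lemma poisson_lipschitz_partial_sum_le: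
  fixes h :: "nat \<Rightarrow> real"
  assumes l: "0 \<le> l" and h: "\<And>x y. \<bar>h x - h y\<bar> \<le> \<bar>real x - real y\<bar>"
  defines "m \<equiv> (\<Sum>j. poisson_weight l j * h j)"
  shows "\<bar>\<Sum>j\<le>x. (h j - m) * poisson_weight l j\<bar> \<le> l * poisson_weight l x"
proof -
  have hm: "(\<lambda>j. poisson_weight l j * h j) sums m"
    unfolding m_def by (intro summable_sums poisson_weight_lipschitz_summable l h)
  \<comment> \<open>The Lipschitz bound makes \<open>j + h j\<close> and \<open>j - h j\<close>
    monotone; the sign lemma applied to each gives one half of the absolute value.\<close>
  have mono: "mono (\<lambda>j. real j + h j)" "mono (\<lambda>j. real j - h j)"
    using h by (auto intro!: monoI) (smt (verit) of_nat_mono)+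
  have "(\<lambda>j. poisson_weight l j * (real j + h j)) sums (l + m)"
    using sums_add[OF poisson_weight_mean_sums hm] by (simp add: algebra_simps)
  from poisson_centred_partial_sum_le[OF l mono(1) this]
  have "(\<Sum>j\<le>x. (real j + h j - (l + m)) * poisson_weight l j) \<le> 0" .
  also have "(\<Sum>j\<le>x. (real j + h j - (l + m)) * poisson_weight l j) =
      (\<Sum>j\<le>x. (real j - l) * poisson_weight l j) + (\<Sum>j\<le>x. (h j - m) * poisson_weight l j)"
    by (simp add: sum.distrib[symmetric] algebra_simps)
  finally have 1: "(\<Sum>j\<le>x. (h j - m) * poisson_weight l j) \<le> l * poisson_weight l x"
    by (simp add: poisson_weight_centred_sum)
  have "(\<lambda>j. poisson_weight l j * (real j - h j)) sums (l - m)"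
    using sums_diff[OF poisson_weight_mean_sums hm] by (simp add: algebra_simps)
  from poisson_centred_partial_sum_le[OF l mono(2) this]
  have "(\<Sum>j\<le>x. (real j - h j - (l - m)) * poisson_weight l j) \<le> 0" .
  also have "(\<Sum>j\<le>x. (real j - h j - (l - m)) * poisson_weight l j) =
      (\<Sum>j\<le>x. (real j - l) * poisson_weight l j) - (\<Sum>j\<le>x. (h j - m) * poisson_weight l j)"
    by (simp add: sum_subtractf[symmetric] algebra_simps)
  finally show ?thesis using 1
    unfolding poisson_weight_centred_sum by linarith
qed

lemma stein_solution_exists:
  fixes h :: "nat \<Rightarrow> real"
  assumes l: "0 \<le> l" and h: "\<And>x y. \<bar>h x - h y\<bar> \<le> \<bar>real x - real y\<bar>"
  shows "\<exists>f. (\<forall>n. \<bar>f n\<bar> \<le> 1) \<and>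
    (\<forall>n. l * f (Suc n) - real n * f n = h n - (\<Sum>j. poisson_weight l j * h j))"
proof (cases "l = 0")
  case True
  \<comment> \<open>For \<open>l = 0\<close> all mass sits at 0 and the equation becomes
    \<open>- real n * f n = h n - h 0\<close>. Division by zero gives \<open>f 0 = 0\<close>,
    harmless because both sides vanish at \<open>n = 0\<close>.\<close>
  define f :: "nat \<Rightarrow> real" where "f n = (h 0 - h n) / real n" for n
  have "(\<Sum>j. poisson_weight l j * h j) = (\<Sum>j\<in>{0}. poisson_weight l j * h j)"
    using True by (intro suminf_finite) (auto simp: poisson_weight_def)
  then have m: "(\<Sum>j. poisson_weight l j * h j) = h 0"
    using True by (simp add: poisson_weight_def)
  have "\<bar>f n\<bar> \<le> 1" for n
    using h[of 0 n] by (cases "n = 0") (auto simp: f_def divide_le_eq)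
  moreover have "l * f (Suc n) - real n * f n = h n - h 0" for n
    using True by (cases "n = 0") (auto simp: f_def)
  ultimately show ?thesis unfolding m by (intro exI[of _ f]) auto
next
  case False
  with l have l0: "l > 0" by simp
  define m where "m = (\<Sum>j. poisson_weight l j * h j)"
  define S where "S n = (\<Sum>j\<le>n. (h j - m) * poisson_weight l j)" for n
  \<comment> \<open>Multiplied by \<open>poisson_weight l n\<close>, the left side of the equation
    is a difference of consecutive values of \<open>l * poisson_weight l j * f (Suc j)\<close>, so
    summation forces this value of \<open>f (Suc n)\<close>. The value \<open>f 0\<close> is free,
    since its coefficient is 0.\<close>
  define f :: "nat \<Rightarrow> real" where
    "f n = (case n of 0 \<Rightarrow> 0 | Suc n \<Rightarrow> S n / (l * poisson_weight l n))" for n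
  have p: "poisson_weight l n > 0" for n using l0 by (rule poisson_weight_pos)
  have "\<bar>f n\<bar> \<le> 1" for n
    using poisson_lipschitz_partial_sum_le[OF l h, of "n - 1"] l0 p[of "n - 1"]
    by (cases n) (auto simp: f_def S_def m_def abs_mult)
  moreover have "l * f (Suc n) - real n * f n = h n - m" for n
  proof (cases n)
    case 0
    then show ?thesis using l0 p[of 0] by (simp add: f_def S_def)
  next
    case (Suc k)
    have "l * f (Suc n) = S n / poisson_weight l n" using l0 by (simp add: f_def)
    moreover have "real n * f n = S k / poisson_weight l n"
      using poisson_weight_Suc[of k l] p[of k] p[of "Suc k"] l0 
      by (simp add: f_def Suc field_simps del: of_nat_Suc)
    moreover have "S n = S k + (h n - m) * poisson_weight l n"
      by (simp add: S_def Suc)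
    ultimately have "l * f (Suc n) - real n * f n = (h n - m) * poisson_weight l n / poisson_weight l n"
      by (simp add: diff_divide_distrib[symmetric])
    then show ?thesis using p[of n] by simp
  qed
  ultimately show ?thesis unfolding m_def by (intro exI[of _ f]) auto
qed

section \<open>Coordinatewise replacement by Poisson variables\<close>

definition l1_dist :: "nat set \<Rightarrow> (nat \<Rightarrow> nat) \<Rightarrow> (nat \<Rightarrow> nat) \<Rightarrow> real" where
  "l1_dist J x y = (\<Sum>i\<in>J. \<bar>real (x i) - real (y i)\<bar>)"

text \<open>Coordinate \<open>i\<close> is integrated out against a Poisson law. Acting on the test
  function avoids constructing an independent Poisson variable on the given probability
  space.\<close>

definition poisson_smooth :: "real \<Rightarrow> nat \<Rightarrow> ((nat \<Rightarrow> nat) \<Rightarrow> real) \<Rightarrow> (nat \<Rightarrow> nat) \<Rightarrow> real" where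
  "poisson_smooth l i h x = (\<Sum>n. poisson_weight l n * h (x(i := n)))"

primrec poisson_smooths :: "(nat \<Rightarrow> real) \<Rightarrow> ((nat \<Rightarrow> nat) \<Rightarrow> real) \<Rightarrow> nat \<Rightarrow> (nat \<Rightarrow> nat) \<Rightarrow> real" where
  "poisson_smooths l h 0 = h"
| "poisson_smooths l h (Suc i) = poisson_smooth (l i) i (poisson_smooths l h i)"

text \<open>Restricting the distance to \<open>J\<close> records two facts at once: Lipschitz
  constant 1, and independence of the coordinates outside \<open>J\<close>. For
  \<open>J = {}\<close> the function is constant on \<open>nat_vectors d\<close>.\<close>

definition l1_lipschitz :: "nat \<Rightarrow> nat set \<Rightarrow> ((nat \<Rightarrow> nat) \<Rightarrow> real) \<Rightarrow> bool" where
  "l1_lipschitz d J h \<longleftrightarrow> (\<forall>x\<in>nat_vectors d. \<forall>y\<in>nat_vectors d. \<bar>h x - h y\<bar> \<le> l1_dist J x y)"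

lemma nat_vectors_upd: "x \<in> nat_vectors d \<Longrightarrow> i < d \<Longrightarrow> x(i := n) \<in> nat_vectors d"
  by (auto simp: nat_vectors_def PiE_iff extensional_def)

lemma l1_lipschitz_upd:
  assumes "l1_lipschitz d J h" "finite J" "x \<in> nat_vectors d" "i < d"
  shows "\<bar>h (x(i := m)) - h (x(i := n))\<bar> \<le> \<bar>real m - real n\<bar>"
proof -
  have "\<bar>h (x(i := m)) - h (x(i := n))\<bar> \<le> l1_dist J (x(i := m)) (x(i := n))"
    using assms nat_vectors_upd unfolding l1_lipschitz_def by blast
  also have "\<dots> = (\<Sum>j\<in>J. if j = i then \<bar>real m - real n\<bar> else 0)"
    unfolding l1_dist_def by (intro sum.cong) auto
  also have "\<dots> \<le> \<bar>real m - real n\<bar>"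
    using assms(2) by (simp add: sum.delta)
  finally show ?thesis .
qed

text \<open>Both averages carry the same weights and are compared termwise, with coordinate
  \<open>i\<close> set to the same value \<open>n\<close> on both sides. It then contributes nothing
  to the distance and leaves \<open>J\<close>.\<close>

lemma poisson_smooth_lipschitz:
  assumes h: "l1_lipschitz d J h" and J: "finite J" and i: "i < d" and l: "0 \<le> l"
  shows "l1_lipschitz d (J - {i}) (poisson_smooth l i h)"
  unfolding l1_lipschitz_def
proof (intro ballI)
  fix x y assume x: "x \<in> nat_vectors d" and y: "y \<in> nat_vectors d"
  let ?p = "poisson_weight l"
  have sm: "summable (\<lambda>n. ?p n * h (z(i := n)))" if "z \<in> nat_vectors d" for z
    using l1_lipschitz_upd[OF h J that i] by (intro poisson_weight_lipschitz_summable l)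
  have le: "\<bar>?p n * h (x(i := n)) - ?p n * h (y(i := n))\<bar> \<le> l1_dist (J - {i}) x y * ?p n" for n
  proof -
    have "\<bar>h (x(i := n)) - h (y(i := n))\<bar> \<le> l1_dist J (x(i := n)) (y(i := n))"
      using h x y i nat_vectors_upd unfolding l1_lipschitz_def by blast
    also have "\<dots> = l1_dist (J - {i}) x y"
      unfolding l1_dist_def using J by (intro sum.mono_neutral_cong_right) auto
    finally have "?p n * \<bar>h (x(i := n)) - h (y(i := n))\<bar> \<le> ?p n * l1_dist (J - {i}) x y"
      by (intro mult_left_mono poisson_weight_nonneg l)
    then show ?thesis
      using poisson_weight_nonneg[OF l, of n]
      by (simp add: right_diff_distrib[symmetric] abs_mult mult.commute)
  qed
  have sl: "(\<lambda>n. l1_dist (J - {i}) x y * ?p n) sums (l1_dist (J - {i}) x y * 1)"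
    by (intro sums_mult poisson_weight_sums)
  have "\<bar>poisson_smooth l i h x - poisson_smooth l i h y\<bar> =
      \<bar>\<Sum>n. ?p n * h (x(i := n)) - ?p n * h (y(i := n))\<bar>"
    unfolding poisson_smooth_def by (subst suminf_diff[OF sm[OF x] sm[OF y]]) simp
  also have "\<dots> \<le> (\<Sum>n. l1_dist (J - {i}) x y * ?p n)"
    using norm_suminf_le[OF le[folded real_norm_def] sums_summable[OF sl]] by simp
  also have "\<dots> = l1_dist (J - {i}) x y" using sums_unique[OF sl] by simp
  finally show "\<bar>poisson_smooth l i h x - poisson_smooth l i h y\<bar> \<le> l1_dist (J - {i}) x y" .
qed

lemma poisson_smooths_lipschitz:
  assumes h: "l1_lipschitz d {..<d} h" and l: "\<And>i. i < d \<Longrightarrow> 0 \<le> l i" and "i \<le> d"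
  shows "l1_lipschitz d {i..<d} (poisson_smooths l h i)"
  using assms(3)
proof (induction i)
  case 0
  then show ?case using h by (simp add: atLeast0LessThan)
next
  case (Suc i)
  then have "l1_lipschitz d ({i..<d} - {i}) (poisson_smooth (l i) i (poisson_smooths l h i))"
    by (intro poisson_smooth_lipschitz l) auto
  moreover have "{i..<d} - {i} = {Suc i..<d}" by auto
  ultimately show ?case by simp
qed

lemma multivariate_stein_solution_exists:
  assumes h: "l1_lipschitz d J h" and J: "finite J" and i: "i < d" and l: "0 \<le> l"
  shows "\<exists>f. (\<forall>x. \<bar>f x\<bar> \<le> 1) \<and> (\<forall>x\<in>nat_vectors d.
    l * f (x(i := Suc (x i))) - real (x i) * f x = h x - poisson_smooth l i h x)"
proof -
  define u where "u x n = h (x(i := n))" for x n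
  have "\<exists>f. (\<forall>n. \<bar>f n\<bar> \<le> 1) \<and> (x \<in> nat_vectors d \<longrightarrow> (\<forall>n. l * f (Suc n) - real n * f n =
      u x n - (\<Sum>j. poisson_weight l j * u x j)))" for x
  proof (cases "x \<in> nat_vectors d")
    case True
    then show ?thesis
      using stein_solution_exists[OF l, of "u x"] l1_lipschitz_upd[OF h J _ i] unfolding u_def by blast
  qed (auto intro: exI[of _ "\<lambda>_. 0"])
  then obtain F where F: "\<bar>F x n\<bar> \<le> 1"
    "x \<in> nat_vectors d \<Longrightarrow> l * F x (Suc n) - real n * F x n =
      u x n - (\<Sum>j. poisson_weight l j * u x j)" for x n
    by metis
  \<comment> \<open>Solutions chosen for different \<open>x\<close> are unrelated. Taking the one of
    \<open>x(i := 0)\<close> makes \<open>f\<close> use the same one-dimensional solution at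
    \<open>x\<close> and at \<open>x(i := Suc (x i))\<close>.\<close>
  define f where "f x = F (x(i := 0)) (x i)" for x
  have "l * f (x(i := Suc (x i))) - real (x i) * f x = h x - poisson_smooth l i h x"
    if "x \<in> nat_vectors d" for x
    using F(2)[OF nat_vectors_upd[OF that i], of 0 "x i"]
    by (simp add: f_def u_def poisson_smooth_def)
  then show ?thesis using F(1) by (intro exI[of _ f]) (simp add: f_def)
qed

text \<open>\<open>up\<close> and \<open>lo\<close> are an approximate Stein identity with error
  \<open>e\<close>. They concern \<open>ennreal\<close> test functions, so that they can be verified
  with nonnegative integrals alone; the bound 2 arises because a solution with values in
  \<open>[-1, 1]\<close> is shifted to \<open>[0, 2]\<close>.\<close>

lemma (in prob_space) stein_step:
  fixes Z :: "'a \<Rightarrow> nat \<Rightarrow> nat"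
  assumes Z [measurable]: "Z \<in> measurable M (count_space UNIV)"
    and Zv: "\<And>w. w \<in> space M \<Longrightarrow> Z w \<in> nat_vectors d"
    and l: "\<And>i. i < d \<Longrightarrow> 0 \<le> l i" and e: "0 \<le> e"
    and mean: "\<And>i. i < d \<Longrightarrow> (\<integral>\<^sup>+w. ennreal (real (Z w i)) \<partial>M) = ennreal (l i)"
    and i: "i < d"
    and up: "\<And>G. (\<And>v. G v \<le> 2) \<Longrightarrow> (\<integral>\<^sup>+w. ennreal (real (Z w i)) * G (Z w) \<partial>M)
       \<le> ennreal (l i) * (\<integral>\<^sup>+w. G ((Z w)(i := Suc (Z w i))) \<partial>M) + ennreal e"
    and lo: "\<And>G. (\<And>v. G v \<le> 2) \<Longrightarrow> ennreal (l i) * (\<integral>\<^sup>+w. G ((Z w)(i := Suc (Z w i))) \<partial>M)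
       \<le> (\<integral>\<^sup>+w. ennreal (real (Z w i)) * G (Z w) \<partial>M) + ennreal e"
    and h: "l1_lipschitz d J h" and J: "J \<subseteq> {..<d}"
    and h': "l1_lipschitz d J' (poisson_smooth (l i) i h)" and J': "J' \<subseteq> {..<d}"
  shows "\<bar>(\<integral>w. h (Z w) \<partial>M) - (\<integral>w. poisson_smooth (l i) i h (Z w) \<partial>M)\<bar> \<le> e"
proof -
  have meas [measurable]: "(\<lambda>w. f (Z w)) \<in> borel_measurable M" for f :: "_ \<Rightarrow> real"
    by (rule measurable_compose[OF Z]) simp
  have measE [measurable]: "(\<lambda>w. f (Z w)) \<in> borel_measurable M" for f :: "_ \<Rightarrow> ennreal"
    by (rule measurable_compose[OF Z]) simp
  have Zint: "integrable M (\<lambda>w. real (Z w j))" if "j < d" for j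
    using mean[OF that] by (intro integrableI_nonneg) auto
  have lipint: "integrable M (\<lambda>w. h (Z w))" if h: "l1_lipschitz d J h" "J \<subseteq> {..<d}" for J h
  proof (rule Bochner_Integration.integrable_bound)
    let ?z = "\<lambda>j\<in>{..<d}. 0 :: nat"
    have fin: "finite J" using h(2) finite_subset by blast
    show "integrable M (\<lambda>w. \<bar>h ?z\<bar> + (\<Sum>j\<in>J. real (Z w j)))"
      using h(2) by (intro Bochner_Integration.integrable_add Bochner_Integration.integrable_sum Zint) auto
    show "AE w in M. norm (h (Z w)) \<le> norm (\<bar>h ?z\<bar> + (\<Sum>j\<in>J. real (Z w j)))"
    proof (rule AE_I2)
      fix w assume w: "w \<in> space M"
      have "?z \<in> nat_vectors d" by (simp add: nat_vectors_def)
      then have "\<bar>h (Z w) - h ?z\<bar> \<le> l1_dist J (Z w) ?z"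
        using h(1) Zv[OF w] unfolding l1_lipschitz_def by blast
      also have "\<dots> = (\<Sum>j\<in>J. real (Z w j))"
        unfolding l1_dist_def using h(2) by (intro sum.cong) auto
      finally show "norm (h (Z w)) \<le> norm (\<bar>h ?z\<bar> + (\<Sum>j\<in>J. real (Z w j)))"
        by (simp add: sum_nonneg)
    qed
  qed auto
  obtain f where f: "\<bar>f x\<bar> \<le> 1" "x \<in> nat_vectors d \<Longrightarrow>
      l i * f (x(i := Suc (x i))) - real (x i) * f x = h x - poisson_smooth (l i) i h x" for x
    using multivariate_stein_solution_exists[OF h finite_subset[OF J] i l[OF i]] by auto
  define G where "G x = f x + 1" for x
  have G: "0 \<le> G x" "G x \<le> 2" for x using f(1)[of x] by (auto simp: G_def abs_le_iff)
  have GE: "ennreal (G x) \<le> 2" for x using G[of x] by (metis ennreal_leI ennreal_numeral)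
  let ?e = "\<lambda>w. (Z w)(i := Suc (Z w i))"
  have i1: "integrable M (\<lambda>w. G (?e w))"
    using G by (intro integrable_const_bound[of _ 2]) auto
  have i2: "integrable M (\<lambda>w. real (Z w i) * G (Z w))"
  proof (rule Bochner_Integration.integrable_bound)
    show "integrable M (\<lambda>w. 2 * real (Z w i))" using Zint[OF i] by simp
    show "AE w in M. norm (real (Z w i) * G (Z w)) \<le> norm (2 * real (Z w i))"
      using G by (auto simp: abs_mult mult.commute intro!: AE_I2 mult_right_mono)
  qed auto
  have EZ: "(\<integral>w. real (Z w i) \<partial>M) = l i"
    using mean[OF i] l[OF i] by (intro integral_eq_nn_integral[THEN trans]) auto
  have n1: "(\<integral>\<^sup>+w. ennreal (G (?e w)) \<partial>M) = ennreal (\<integral>w. G (?e w) \<partial>M)"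
    using i1 G by (intro nn_integral_eq_integral) auto
  have n2: "(\<integral>\<^sup>+w. ennreal (real (Z w i)) * ennreal (G (Z w)) \<partial>M) = ennreal (\<integral>w. real (Z w i) * G (Z w) \<partial>M)"
    using i2 G by (subst nn_integral_eq_integral[symmetric]) (auto simp: ennreal_mult)
  have p1: "0 \<le> (\<integral>w. G (?e w) \<partial>M)" and p2: "0 \<le> (\<integral>w. real (Z w i) * G (Z w) \<partial>M)"
    using G by (auto intro!: Bochner_Integration.integral_nonneg)
  have "ennreal (\<integral>w. real (Z w i) * G (Z w) \<partial>M) \<le> ennreal (l i * (\<integral>w. G (?e w) \<partial>M) + e)"
    using up[of "\<lambda>v. ennreal (G v)", OF GE] p1 l[OF i] e
    unfolding n1 n2 by (simp add: ennreal_mult ennreal_plus)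
  then have b1: "(\<integral>w. real (Z w i) * G (Z w) \<partial>M) \<le> l i * (\<integral>w. G (?e w) \<partial>M) + e"
    using p1 l[OF i] e by (subst (asm) ennreal_le_iff) auto
  have "ennreal (l i * (\<integral>w. G (?e w) \<partial>M)) \<le> ennreal ((\<integral>w. real (Z w i) * G (Z w) \<partial>M) + e)"
    using lo[of "\<lambda>v. ennreal (G v)", OF GE] p1 p2 l[OF i] e
    unfolding n1 n2 by (simp add: ennreal_mult ennreal_plus)
  then have b2: "l i * (\<integral>w. G (?e w) \<partial>M) \<le> (\<integral>w. real (Z w i) * G (Z w) \<partial>M) + e"
    using p2 e by (subst (asm) ennreal_le_iff) auto
  have "(\<integral>w. h (Z w) \<partial>M) - (\<integral>w. poisson_smooth (l i) i h (Z w) \<partial>M) =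
      (\<integral>w. h (Z w) - poisson_smooth (l i) i h (Z w) \<partial>M)"
    by (intro Bochner_Integration.integral_diff[symmetric] lipint[OF h J] lipint[OF h' J'])
  \<comment> \<open>The shift by 1 adds \<open>l i - real (Z w i)\<close> to the Stein expression.
    The last summand compensates this, and its integral is 0 by \<open>mean\<close>.\<close>
  also have "\<dots> = (\<integral>w. l i * G (?e w) - real (Z w i) * G (Z w) + (real (Z w i) - l i) \<partial>M)"
    by (intro Bochner_Integration.integral_cong refl, subst f(2)[OF Zv, symmetric])
      (auto simp: G_def algebra_simps)
  also have "\<dots> = l i * (\<integral>w. G (?e w) \<partial>M) - (\<integral>w. real (Z w i) * G (Z w) \<partial>M)"
    using i1 i2 Zint[OF i] EZ by (simp add: prob_space)
  finally show ?thesis using b1 b2 by linarith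
qed

text \<open>Telescoping over the coordinates. The number subtracted depends only on \<open>h\<close>
  and the means \<open>l\<close>, so it can serve as a common reference for vectors on different
  probability spaces.\<close>

lemma (in prob_space) stein_bound:
  fixes Z :: "'a \<Rightarrow> nat \<Rightarrow> nat"
  assumes Z: "Z \<in> measurable M (count_space UNIV)"
    and Zv: "\<And>w. w \<in> space M \<Longrightarrow> Z w \<in> nat_vectors d"
    and l: "\<And>i. i < d \<Longrightarrow> 0 \<le> l i" and e: "\<And>i. i < d \<Longrightarrow> 0 \<le> e i"
    and mean: "\<And>i. i < d \<Longrightarrow> (\<integral>\<^sup>+w. ennreal (real (Z w i)) \<partial>M) = ennreal (l i)"
    and up: "\<And>i G. i < d \<Longrightarrow> (\<And>v. G v \<le> 2) \<Longrightarrow> (\<integral>\<^sup>+w. ennreal (real (Z w i)) * G (Z w) \<partial>M)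
       \<le> ennreal (l i) * (\<integral>\<^sup>+w. G ((Z w)(i := Suc (Z w i))) \<partial>M) + ennreal (e i)"
    and lo: "\<And>i G. i < d \<Longrightarrow> (\<And>v. G v \<le> 2) \<Longrightarrow> ennreal (l i) * (\<integral>\<^sup>+w. G ((Z w)(i := Suc (Z w i))) \<partial>M)
       \<le> (\<integral>\<^sup>+w. ennreal (real (Z w i)) * G (Z w) \<partial>M) + ennreal (e i)"
    and h: "h \<in> lipschitz_test_functions d"
  shows "\<bar>(\<integral>w. h (Z w) \<partial>M) - poisson_smooths l h d (\<lambda>i\<in>{..<d}. 0)\<bar> \<le> (\<Sum>i<d. e i)"
proof -
  have h0: "l1_lipschitz d {..<d} h"
    using h by (auto simp: lipschitz_test_functions_def l1_lipschitz_def l1_dist_def)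
  have L: "l1_lipschitz d {n..<d} (poisson_smooths l h n)" if "n \<le> d" for n
    by (rule poisson_smooths_lipschitz[OF h0 l that])
  have "\<bar>(\<integral>w. h (Z w) \<partial>M) - (\<integral>w. poisson_smooths l h n (Z w) \<partial>M)\<bar> \<le> (\<Sum>i<n. e i)" if "n \<le> d" for n
    using that
  proof (induction n)
    case (Suc n)
    have "\<bar>(\<integral>w. poisson_smooths l h n (Z w) \<partial>M) - (\<integral>w. poisson_smooths l h (Suc n) (Z w) \<partial>M)\<bar> \<le> e n"
      unfolding poisson_smooths.simps(2)
    proof (rule stein_step[where d = d and J = "{n..<d}" and J' = "{Suc n..<d}"])
      show "l1_lipschitz d {Suc n..<d} (poisson_smooth (l n) n (poisson_smooths l h n))"
        using L[of "Suc n"] Suc.prems by simp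
    qed (use Z Zv l mean up lo L[of n] Suc.prems e in auto)
    with Suc show ?case by simp
  qed simp
  from this[of d] have "\<bar>(\<integral>w. h (Z w) \<partial>M) - (\<integral>w. poisson_smooths l h d (Z w) \<partial>M)\<bar> \<le> (\<Sum>i<d. e i)"
    by simp
  \<comment> \<open>After \<open>d\<close> replacements the set of remaining coordinates is empty,
    so the function is constant; the zero vector is just a point at which to evaluate it.\<close>
  moreover have "(\<integral>w. poisson_smooths l h d (Z w) \<partial>M) =
      (\<integral>w. poisson_smooths l h d (\<lambda>i\<in>{..<d}. 0) \<partial>M)"
  proof (intro Bochner_Integration.integral_cong refl)
    fix w assume w: "w \<in> space M"
    have "(\<lambda>i\<in>{..<d}. 0) \<in> nat_vectors d" by (simp add: nat_vectors_def)
    then have "\<bar>poisson_smooths l h d (Z w) - poisson_smooths l h d (\<lambda>i\<in>{..<d}. 0)\<bar> \<le> l1_dist {d..<d} (Z w) (\<lambda>i\<in>{..<d}. 0)"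
      using L[of d] Zv[OF w] unfolding l1_lipschitz_def by blast
    then show "poisson_smooths l h d (Z w) = poisson_smooths l h d (\<lambda>i\<in>{..<d}. 0)"
      by (simp add: l1_dist_def)
  qed
  ultimately show ?thesis by (simp add: prob_space)
qed

section \<open>Symmetrized law of the points of a Poisson process\<close>

definition injections :: "'l set \<Rightarrow> 'i set \<Rightarrow> ('l \<Rightarrow> 'i) set" where
  "injections L I = {s \<in> L \<rightarrow>\<^sub>E I. inj_on s L}"

lemma finite_injections [intro, simp]: "finite L \<Longrightarrow> finite I \<Longrightarrow> finite (injections L I)"
  unfolding injections_def by (rule finite_subset[OF _ finite_PiE[of L "\<lambda>_. I"]]) auto

text \<open>Position \<open>j\<close> must receive an index of colour \<open>a j\<close>, so the
  colours are filled independently. With \<open>N\<close> indices and \<open>n\<close> positions of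
  a colour there are \<open>fact N / fact (N - n)\<close> choices; the denominators are multiplied
  out to stay in \<open>nat\<close>.\<close>

lemma card_colour_matching_injections:
  assumes fin: "finite L" "finite I" "finite B" and aB: "a ` L \<subseteq> B"
    and le: "\<And>b. b \<in> B \<Longrightarrow> card {j \<in> L. a j = b} \<le> card {i \<in> I. col i = b}"
  shows "card {s \<in> injections L I. \<forall>j\<in>L. col (s j) = a j} *
      (\<Prod>b\<in>B. fact (card {i \<in> I. col i = b} - card {j \<in> L. a j = b})) =
      (\<Prod>b\<in>B. fact (card {i \<in> I. col i = b}))"
  using fin(1) aB le
proof (induction L rule: finite_induct)
  case empty
  have "{s \<in> injections {} I. \<forall>j\<in>{}. col (s j) = a j} = {\<lambda>_. undefined}"
    by (auto simp: injections_def)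
  then show ?case by simp
next
  case (insert l L)
  let ?S = "\<lambda>L. {s \<in> injections L I. \<forall>j\<in>L. col (s j) = a j}"
  let ?N = "\<lambda>b. card {i \<in> I. col i = b}" and ?n = "\<lambda>L b. card {j \<in> L. a j = b}"
  have n: "?n (insert l L) b = (if b = a l then Suc (?n L b) else ?n L b)" for b
  proof -
    have "{j \<in> insert l L. a j = b} = (if b = a l then insert l {j \<in> L. a j = b} else {j \<in> L. a j = b})"
      by auto
    then show ?thesis using insert.hyps by (simp)
  qed
  have al: "a l \<in> B" using insert.prems by auto
  have IH: "card (?S L) * (\<Prod>b\<in>B. fact (?N b - ?n L b)) = (\<Prod>b\<in>B. fact (?N b))"
  proof (rule insert.IH)
    show "a ` L \<subseteq> B" using insert.prems by auto
    fix b assume "b \<in> B"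
    from insert.prems(2)[OF this] show "?n L b \<le> ?N b"
      unfolding n by (simp split: if_splits)
  qed
  let ?T = "\<lambda>s. {i \<in> I. col i = a l} - s ` L"
  have "bij_betw (\<lambda>(s, i). s(l := i)) (Sigma (?S L) ?T) (?S (insert l L))"
    unfolding bij_betw_def
  proof
    show "inj_on (\<lambda>(s, i). s(l := i)) (Sigma (?S L) ?T)"
    proof (rule inj_onI, clarsimp)
      fix s i s' i' assume s: "s \<in> injections L I" "s' \<in> injections L I" and eq: "s(l := i) = s'(l := i')"
      from eq have "i = i'" by (metis fun_upd_same)
      moreover have "s j = s' j" for j
        using fun_cong[OF eq, of j] s insert.hyps
        by (cases "j = l") (auto simp: injections_def PiE_iff extensional_def)
      ultimately show "s = s' \<and> i = i'" by auto
    qed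
    show "(\<lambda>(s, i). s(l := i)) ` Sigma (?S L) ?T = ?S (insert l L)"
    proof (rule set_eqI, rule iffI)
      fix t assume "t \<in> (\<lambda>(s, i). s(l := i)) ` Sigma (?S L) ?T"
      then obtain s i where t: "t = s(l := i)" "s \<in> ?S L" "i \<in> ?T s" by auto
      have "inj_on (s(l := i)) L \<longleftrightarrow> inj_on s L"
        using insert.hyps by (intro inj_on_cong) auto
      moreover have "s(l := i) ` L = s ` L" using insert.hyps by (intro image_cong) auto
      moreover have "L - {l} = L" using insert.hyps by auto
      ultimately show "t \<in> ?S (insert l L)"
        using t insert.hyps by (auto simp: injections_def PiE_iff extensional_def)
    next
      fix t assume t: "t \<in> ?S (insert l L)"
      define s where "s = restrict t L"
      have ts: "t = s(l := t l)"
        using t by (auto simp: s_def injections_def PiE_iff extensional_def fun_eq_iff)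
      have "inj_on t L" using t by (auto simp: injections_def)
      then have "s \<in> ?S L"
        using t by (auto simp: s_def injections_def)
      moreover have "t l \<in> ?T s"
        using t insert.hyps by (auto simp: s_def injections_def)
      ultimately show "t \<in> (\<lambda>(s, i). s(l := i)) ` Sigma (?S L) ?T"
        using ts by (intro image_eqI[of _ _ "(s, t l)"]) auto
    qed
  qed
  then have "card (?S (insert l L)) = card (Sigma (?S L) ?T)"
    by (rule bij_betw_same_card[symmetric])
  also have "\<dots> = (\<Sum>s\<in>?S L. card (?T s))"
    using insert.hyps fin by (intro card_SigmaI) auto
  also have "\<dots> = (\<Sum>s\<in>?S L. ?N (a l) - ?n L (a l))"
  proof (rule sum.cong[OF refl])
    fix s assume s: "s \<in> ?S L"
    have "?T s = {i \<in> I. col i = a l} - s ` {j \<in> L. a j = a l}"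
      using s by auto
    moreover have "s ` {j \<in> L. a j = a l} \<subseteq> {i \<in> I. col i = a l}"
      using s by (auto simp: injections_def)
    moreover have "card (s ` {j \<in> L. a j = a l}) = ?n L (a l)"
      using s by (intro card_image) (auto simp: injections_def inj_on_def)
    ultimately show "card (?T s) = ?N (a l) - ?n L (a l)"
      using fin insert.hyps by (simp add: card_Diff_subset)
  qed
  finally have card: "card (?S (insert l L)) = card (?S L) * (?N (a l) - ?n L (a l))"
    by simp
  have pos: "?N (a l) - ?n L (a l) = Suc (?N (a l) - ?n (insert l L) (a l))"
    using insert.prems(2)[OF al] unfolding n by simp
  have rest: "(\<Prod>b\<in>B - {a l}. fact (?N b - ?n L b) :: nat) =
      (\<Prod>b\<in>B - {a l}. fact (?N b - ?n (insert l L) b))"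
    unfolding n by (intro prod.cong) auto
  have "(\<Prod>b\<in>B. fact (?N b - ?n L b) :: nat) =
      fact (?N (a l) - ?n L (a l)) * (\<Prod>b\<in>B - {a l}. fact (?N b - ?n L b))"
    using fin al by (intro prod.remove) auto
  also have "\<dots> = (?N (a l) - ?n L (a l)) * (fact (?N (a l) - ?n (insert l L) (a l)) *
      (\<Prod>b\<in>B - {a l}. fact (?N b - ?n (insert l L) b)))"
    unfolding rest by (simp only: pos fact_Suc of_nat_id mult.assoc)
  also have "fact (?N (a l) - ?n (insert l L) (a l)) *
      (\<Prod>b\<in>B - {a l}. fact (?N b - ?n (insert l L) b)) = (\<Prod>b\<in>B. fact (?N b - ?n (insert l L) b) :: nat)"
    using fin al by (intro prod.remove[symmetric]) auto
  finally show ?case using IH unfolding card by (simp add: algebra_simps)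
qed

lemma card_injections:
  assumes "finite L" "finite I" "card L \<le> card I"
  shows "card (injections L I) * fact (card I - card L) = fact (card I)"
  using card_colour_matching_injections
    [of L I "{0::nat}" "\<lambda>_. 0" "\<lambda>_. 0"] assms by (simp add: image_subset_iff)

lemma injections_empty:
  assumes "finite I" "card I < card L"
  shows "injections L I = {}"
  using card_inj_on_le[of _ L I] assms by (fastforce simp: injections_def)

lemma injections_self_image:
  assumes "finite L" "s \<in> injections L L"
  shows "s ` L = L"
  using assms by (intro card_subset_eq) (auto simp: injections_def card_image)

text \<open>An injection of a finite set into itself is onto, so a colour matching one would map the
  positions of colour \<open>b\<close> bijectively to the indices of colour
  \<open>b\<close>.\<close>

lemma no_colour_matching_bijection:
  assumes "finite L" "card {j \<in> L. a j = b} \<noteq> card {i \<in> L. col i = b}"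
  shows "{s \<in> injections L L. \<forall>j\<in>L. col (s j) = a j} = {}"
proof -
  have False if s: "s \<in> injections L L" "\<forall>j\<in>L. col (s j) = a j" for s
  proof -
    have "s ` {j \<in> L. a j = b} = {i \<in> L. col i = b}"
      using s injections_self_image[OF assms(1) s(1)] by (auto 0 3)
    moreover have "card (s ` {j \<in> L. a j = b}) = card {j \<in> L. a j = b}"
      using s by (intro card_image) (auto simp: injections_def inj_on_def)
    ultimately show False using assms(2) by simp
  qed
  then show ?thesis by auto
qed

section \<open>From the joint law of counts to the law of the points\<close>

lemma (in prob_space) poisson_process_prob_counts:
  fixes C :: "nat \<Rightarrow> 's set"
  assumes poisson: "poisson_process M S \<mu> \<eta>" and C: "\<And>b. b < r \<Longrightarrow> C b \<in> sets S"
    and fin: "\<And>b. b < r \<Longrightarrow> emeasure \<mu> (C b) < \<infinity>" and disj: "disjoint_family_on C {..<r}" and r: "0 < r"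
  shows "prob {\<omega> \<in> space M. \<forall>b<r. emeasure (\<eta> \<omega>) (C b) = of_nat (n b)} =
    (\<Prod>b<r. measure \<mu> (C b) ^ n b / fact (n b) * exp (- measure \<mu> (C b)))"
proof -
  let ?E = "\<lambda>b \<omega>. emeasure (\<eta> \<omega>) (C b)"
  have "C \<in> {..<r} \<rightarrow> sets S" using C by auto
  then have "indep_vars (\<lambda>_. borel) ?E {..<r}"
    using poisson disj unfolding poisson_process_def by blast
  then have "prob (\<Inter>b\<in>{..<r}. ?E b -` {of_nat (n b)} \<inter> space M) =
      (\<Prod>b\<in>{..<r}. prob (?E b -` {of_nat (n b)} \<inter> space M))"
    using r by (intro indep_varsD_finite[where M' = "\<lambda>_. borel"]) auto
  also have "(\<Inter>b\<in>{..<r}. ?E b -` {of_nat (n b)} \<inter> space M) =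
      {\<omega> \<in> space M. \<forall>b<r. emeasure (\<eta> \<omega>) (C b) = of_nat (n b)}"
    using r by auto
  also have "(\<Prod>b\<in>{..<r}. prob (?E b -` {of_nat (n b)} \<inter> space M)) =
      (\<Prod>b<r. measure \<mu> (C b) ^ n b / fact (n b) * exp (- measure \<mu> (C b)))"
  proof (rule prod.cong[OF refl])
    fix b assume "b \<in> {..<r}"
    then have b: "C b \<in> sets S" "emeasure \<mu> (C b) < \<infinity>" using C fin by auto
    then have "prob {\<omega> \<in> space M. emeasure (\<eta> \<omega>) (C b) = of_nat (n b)} =
        measure \<mu> (C b) ^ n b / fact (n b) * exp (- measure \<mu> (C b))"
      using poisson b unfolding poisson_process_def by blast
    moreover have "{\<omega> \<in> space M. emeasure (\<eta> \<omega>) (C b) = of_nat (n b)} =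
        ?E b -` {of_nat (n b)} \<inter> space M"
      by auto
    ultimately show "prob (?E b -` {of_nat (n b)} \<inter> space M) =
        measure \<mu> (C b) ^ n b / fact (n b) * exp (- measure \<mu> (C b))"
      by simp
  qed
  finally show ?thesis .
qed

text \<open>\<open>X\<close> and \<open>\<tau>\<close> may be any measurable enumeration of the
  points; all distributional information comes from the counts of \<open>\<eta>\<close>.\<close>

locale proper_poisson_process = finite_measure \<mu> + P: prob_space M
  for M :: "'w measure" and S :: "'a measure" and \<mu> :: "'a measure"
    and \<eta> :: "'w \<Rightarrow> 'a measure" and X :: "nat \<Rightarrow> 'w \<Rightarrow> 'a" and \<tau> :: "'w \<Rightarrow> enat" +
  assumes poisson: "poisson_process M S \<mu> \<eta>" and proper: "proper_representation M S \<eta> X \<tau>"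
begin

lemma sets_mu: "sets \<mu> = sets S"
  using poisson by (simp add: poisson_process_def)

lemma space_mu: "space \<mu> = space S"
  using sets_mu by (rule sets_eq_imp_space_eq)

lemma X_measurable [measurable]: "X n \<in> measurable M \<mu>"
  using proper sets_mu by (simp add: proper_representation_def cong: measurable_cong_sets)

lemma tau_measurable [measurable]: "\<tau> \<in> measurable M (count_space UNIV)"
  using proper by (simp add: proper_representation_def)

lemma X_space: "\<omega> \<in> space M \<Longrightarrow> X n \<omega> \<in> space S"
  using measurable_space[OF X_measurable] space_mu by auto

lemma AE_emeasure_eta:
  "AE \<omega> in M. \<forall>C\<in>sets S. emeasure (\<eta> \<omega>) C =
    emeasure (count_space (index_set (\<tau> \<omega>))) {n \<in> index_set (\<tau> \<omega>). X n \<omega> \<in> C}"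
proof -
  have "AE \<omega> in M. \<eta> \<omega> = dirac_sum (index_set (\<tau> \<omega>)) S (\<lambda>n. X n \<omega>)"
    using proper by (simp add: proper_representation_def)
  with AE_space show ?thesis
  proof eventually_elim
    case (elim \<omega>)
    show ?case
    proof
      fix C assume C: "C \<in> sets S"
      have "(\<lambda>n. X n \<omega>) \<in> measurable (count_space (index_set (\<tau> \<omega>))) S"
        using X_space[OF elim(1)] by simp
      then have "emeasure (\<eta> \<omega>) C = emeasure (count_space (index_set (\<tau> \<omega>)))
          ((\<lambda>n. X n \<omega>) -` C \<inter> index_set (\<tau> \<omega>))"
        unfolding elim(2) dirac_sum_def using C by (simp add: emeasure_distr)
      also have "(\<lambda>n. X n \<omega>) -` C \<inter> index_set (\<tau> \<omega>) = {n \<in> index_set (\<tau> \<omega>). X n \<omega> \<in> C}"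
        by auto
      finally show "emeasure (\<eta> \<omega>) C =
        emeasure (count_space (index_set (\<tau> \<omega>))) {n \<in> index_set (\<tau> \<omega>). X n \<omega> \<in> C}" .
    qed
  qed
qed

lemma eta_measurable [measurable]:
  assumes "C \<in> sets S"
  shows "(\<lambda>\<omega>. emeasure (\<eta> \<omega>) C) \<in> borel_measurable M"
proof -
  have "P.indep_vars (\<lambda>_. borel) (\<lambda>i \<omega>. emeasure (\<eta> \<omega>) ((\<lambda>_. C) i)) {..<1::nat}"
    using poisson assms unfolding poisson_process_def by (auto simp: disjoint_family_on_def)
  then show ?thesis by (auto simp: P.indep_vars_def)
qed

lemma prob_counts:
  fixes C :: "nat \<Rightarrow> 'a set"
  assumes C: "\<And>b. b < r \<Longrightarrow> C b \<in> sets S" and disj: "disjoint_family_on C {..<r}" and r: "0 < r"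
  shows "P.prob {\<omega> \<in> space M. \<forall>b<r. emeasure (\<eta> \<omega>) (C b) = of_nat (n b)} =
    (\<Prod>b<r. measure \<mu> (C b) ^ n b / fact (n b) * exp (- measure \<mu> (C b)))"
proof -
  have fin: "emeasure \<mu> (C b) < \<infinity>" if "b < r" for b by (simp add: less_top[symmetric])
  show ?thesis by (rule P.poisson_process_prob_counts[OF poisson C fin disj r])
qed

text \<open>Translates a statement on points into one on counts, whose law is known. If each cell
  holds exactly \<open>n b\<close> points, the positions of colour \<open>b\<close> can be filled in
  \<open>fact (n b)\<close> ways; for any other counts no permutation fits.\<close>

lemma matching_count_eq:
  fixes C :: "nat \<Rightarrow> 'a set"
  assumes C: "\<And>b. b < r \<Longrightarrow> C b \<in> sets S" and disj: "disjoint_family_on C {..<r}"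
    and cover: "(\<Union>b<r. C b) = space S" and a: "a \<in> {..<m} \<rightarrow> {..<r}"
    and w: "\<omega> \<in> space M" and eta: "\<forall>C\<in>sets S. emeasure (\<eta> \<omega>) C =
      emeasure (count_space (index_set (\<tau> \<omega>))) {n \<in> index_set (\<tau> \<omega>). X n \<omega> \<in> C}"
  defines "n \<equiv> \<lambda>b. card {j \<in> {..<m}. a j = b}"
  shows "(if \<tau> \<omega> = enat m then card {s \<in> injections {..<m} {..<m}. \<forall>j\<in>{..<m}. X (s j) \<omega> \<in> C (a j)} else 0) =
    (if \<forall>b<r. emeasure (\<eta> \<omega>) (C b) = of_nat (n b) then (\<Prod>b<r. fact (n b)) else 0)"
proof -
  have "\<exists>b<r. X i \<omega> \<in> C b" for i
    using X_space[OF w, of i] cover by auto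
  then obtain col where col: "col i < r" "X i \<omega> \<in> C (col i)" for i by metis
  have iff: "X i \<omega> \<in> C b \<longleftrightarrow> col i = b" if "b < r" for i b
    using col[of i] that disj by (auto simp: disjoint_family_on_def)
  have "(\<Sum>b<r. n b) = (\<Sum>b<r. \<Sum>j\<in>{j \<in> {..<m}. a j = b}. 1)"
    unfolding n_def card_eq_sum ..
  also have "\<dots> = (\<Sum>j<m. 1)"
    using a by (intro sum.group) auto
  finally have sum_n: "(\<Sum>b<r. n b) = m" by simp
  have em: "emeasure (\<eta> \<omega>) (C b) = of_nat (card {i \<in> {..<m}. col i = b})"
    if "b < r" "\<tau> \<omega> = enat m" for b
  proof -
    have ix: "index_set (\<tau> \<omega>) = {..<m}" using that(2) by (auto simp: index_set_def)
    have set_eq: "{i \<in> {..<m}. X i \<omega> \<in> C b} = {i \<in> {..<m}. col i = b}" using iff[OF that(1)] by auto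
    have "emeasure (\<eta> \<omega>) (C b) = emeasure (count_space {..<m}) {i \<in> {..<m}. X i \<omega> \<in> C b}"
      using eta C[OF that(1)] unfolding ix by blast
    also have "\<dots> = of_nat (card {i \<in> {..<m}. col i = b})"
      unfolding set_eq by (subst emeasure_count_space) auto
    finally show ?thesis .
  qed
  show ?thesis
  proof (cases "\<tau> \<omega> = enat m")
    case True
    have set_eq: "{s \<in> injections {..<m} {..<m}. \<forall>j\<in>{..<m}. X (s j) \<omega> \<in> C (a j)} =
        {s \<in> injections {..<m} {..<m}. \<forall>j\<in>{..<m}. col (s j) = a j}"
      using a iff by (intro Collect_cong conj_cong refl ball_cong) (auto simp: Pi_iff)
    show ?thesis
    proof (cases "\<forall>b<r. emeasure (\<eta> \<omega>) (C b) = of_nat (n b)")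
      case eq: True
      have n_eq: "card {i \<in> {..<m}. col i = b} = n b" if "b < r" for b
        using eq em[OF that True] that by simp
      have "card {s \<in> injections {..<m} {..<m}. \<forall>j\<in>{..<m}. col (s j) = a j} *
          (\<Prod>b\<in>{..<r}. fact (card {i \<in> {..<m}. col i = b} - n b)) =
          (\<Prod>b\<in>{..<r}. fact (card {i \<in> {..<m}. col i = b}))"
        unfolding n_def
        by (rule card_colour_matching_injections) (use a n_eq in \<open>auto simp: n_def\<close>)
      also have "(\<Prod>b\<in>{..<r}. fact (card {i \<in> {..<m}. col i = b} - n b) :: nat) = 1"
        using n_eq by (intro prod.neutral) auto
      also have "(\<Prod>b\<in>{..<r}. fact (card {i \<in> {..<m}. col i = b}) :: nat) = (\<Prod>b<r. fact (n b))"
        using n_eq by (intro prod.cong) auto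
      finally show ?thesis
        using True eq by (simp add: set_eq)
    next
      case False
      then obtain b where b: "b < r" "card {i \<in> {..<m}. col i = b} \<noteq> n b"
        using em True by auto
      then have empty: "{s \<in> injections {..<m} {..<m}. \<forall>j\<in>{..<m}. col (s j) = a j} = {}"
        by (intro no_colour_matching_bijection[of _ _ b]) (auto simp: n_def)
      show ?thesis using False unfolding set_eq empty by simp
    qed
  next
    case False
    \<comment> \<open>The cells cover the space, so matching counts add up to \<open>m\<close>
      points in total, which would force \<open>\<tau> \<omega> = enat m\<close>.\<close>
    have "\<not> (\<forall>b<r. emeasure (\<eta> \<omega>) (C b) = of_nat (n b))"
    proof
      assume eq: "\<forall>b<r. emeasure (\<eta> \<omega>) (C b) = of_nat (n b)"
      let ?I = "index_set (\<tau> \<omega>)"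
      have "emeasure (count_space ?I) ?I =
          (\<Sum>b<r. emeasure (count_space ?I) {n \<in> ?I. X n \<omega> \<in> C b})"
      proof (subst sum_emeasure)
        show "disjoint_family_on (\<lambda>b. {n \<in> ?I. X n \<omega> \<in> C b}) {..<r}"
          using disj by (fastforce simp: disjoint_family_on_def)
        have "(\<Union>b<r. {n \<in> ?I. X n \<omega> \<in> C b}) = ?I" using col by auto
        then show "emeasure (count_space ?I) ?I =
            emeasure (count_space ?I) (\<Union>b<r. {n \<in> ?I. X n \<omega> \<in> C b})" by simp
      qed auto
      also have "\<dots> = (\<Sum>b<r. of_nat (n b))"
        using eta C eq by (intro sum.cong) (auto)
      also have "\<dots> = of_nat m" using sum_n by (simp flip: of_nat_sum)
      finally have fm: "emeasure (count_space ?I) ?I = of_nat m" .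
      then have fin: "finite ?I" by (cases "finite ?I") (auto simp: emeasure_count_space)
      with fm have "card ?I = m" by (simp add: emeasure_count_space)
      moreover have "\<tau> \<omega> = enat (card ?I)"
        using fin by (cases "\<tau> \<omega>") (auto simp: index_set_def lessThan_def[symmetric])
      ultimately show False using False by simp
    qed
    then show ?thesis using False by simp
  qed
qed

text \<open>The factors \<open>fact (n b)\<close> cancel the factorials of the Poisson
  probabilities, and the exponents add up to the total mass because the cells form a
  partition.\<close>

lemma nn_integral_matching_count:
  fixes C :: "nat \<Rightarrow> 'a set"
  assumes C: "\<And>b. b < r \<Longrightarrow> C b \<in> sets S" and disj: "disjoint_family_on C {..<r}"
    and cover: "(\<Union>b<r. C b) = space S" and a: "a \<in> {..<m} \<rightarrow> {..<r}"
  shows "(\<integral>\<^sup>+\<omega>. (if \<tau> \<omega> = enat m then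
      of_nat (card {s \<in> injections {..<m} {..<m}. \<forall>j\<in>{..<m}. X (s j) \<omega> \<in> C (a j)}) else 0) \<partial>M) =
    ennreal (exp (- measure \<mu> (space \<mu>))) * (\<Prod>j<m. emeasure \<mu> (C (a j)))"
proof -
  define n where "n b = card {j \<in> {..<m}. a j = b}" for b
  let ?E = "{\<omega> \<in> space M. \<forall>b<r. emeasure (\<eta> \<omega>) (C b) = of_nat (n b)}"
  have r: "0 < r"
    using P.not_empty X_space[of _ 0] cover by (cases "r = 0") auto
  have "{\<omega> \<in> space M. \<forall>b\<in>{..<r}. emeasure (\<eta> \<omega>) (C b) = of_nat (n b)} \<in> sets M"
  proof (rule sets.sets_Collect_finite_All)
    fix b assume "b \<in> {..<r}"
    then have "(\<lambda>\<omega>. emeasure (\<eta> \<omega>) (C b)) \<in> borel_measurable M" using C by simp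
    from measurable_sets[OF this, of "{of_nat (n b)}"]
    show "{\<omega> \<in> space M. emeasure (\<eta> \<omega>) (C b) = of_nat (n b)} \<in> sets M"
      by (simp add: vimage_def Int_def conj_commute)
  qed simp
  then have E: "?E \<in> sets M" by (simp only: Ball_def lessThan_iff)
  have "(\<integral>\<^sup>+\<omega>. (if \<tau> \<omega> = enat m then
      of_nat (card {s \<in> injections {..<m} {..<m}. \<forall>j\<in>{..<m}. X (s j) \<omega> \<in> C (a j)}) else 0) \<partial>M) =
      (\<integral>\<^sup>+\<omega>. of_nat (\<Prod>b<r. fact (n b)) * indicator ?E \<omega> \<partial>M)"
  proof (rule nn_integral_cong_AE)
    show "AE \<omega> in M. (if \<tau> \<omega> = enat m then
      of_nat (card {s \<in> injections {..<m} {..<m}. \<forall>j\<in>{..<m}. X (s j) \<omega> \<in> C (a j)}) else 0) =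
      (of_nat (\<Prod>b<r. fact (n b)) * indicator ?E \<omega> :: ennreal)"
      using AE_emeasure_eta AE_space
    proof eventually_elim
      case (elim \<omega>)
      have "(if \<tau> \<omega> = enat m then
          of_nat (card {s \<in> injections {..<m} {..<m}. \<forall>j\<in>{..<m}. X (s j) \<omega> \<in> C (a j)}) else 0) =
          (of_nat (if \<tau> \<omega> = enat m then
            card {s \<in> injections {..<m} {..<m}. \<forall>j\<in>{..<m}. X (s j) \<omega> \<in> C (a j)} else 0) :: ennreal)"
        by (cases "\<tau> \<omega> = enat m") simp_all
      also have "\<dots> = of_nat (if \<forall>b<r. emeasure (\<eta> \<omega>) (C b) = of_nat (n b) then (\<Prod>b<r. fact (n b)) else 0)"
        using matching_count_eq[OF C disj cover a elim(2,1)]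
        by (intro arg_cong[where f = of_nat]) (simp only: n_def)
      also have "\<dots> = of_nat (\<Prod>b<r. fact (n b)) * indicator ?E \<omega>"
        using elim(2) by (simp add: indicator_def del: of_nat_prod)
      finally show ?case .
    qed
  qed
  also have "\<dots> = of_nat (\<Prod>b<r. fact (n b)) * emeasure M ?E"
    by (rule nn_integral_cmult_indicator[OF E])
  also have "\<dots> = ennreal (real (\<Prod>b<r. fact (n b)) * P.prob ?E)"
    unfolding P.emeasure_eq_measure ennreal_of_nat_eq_real_of_nat
    by (intro ennreal_mult[symmetric] of_nat_0_le_iff measure_nonneg)
  also have "P.prob ?E = (\<Prod>b<r. measure \<mu> (C b) ^ n b / fact (n b) * exp (- measure \<mu> (C b)))"
    using C disj r by (intro prob_counts)
  also have "real (\<Prod>b<r. fact (n b)) * \<dots> =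
      (\<Prod>b<r. exp (- measure \<mu> (C b)) * measure \<mu> (C b) ^ n b)"
    unfolding of_nat_prod prod.distrib[symmetric] by (intro prod.cong) auto
  also have "\<dots> = exp (- (\<Sum>b<r. measure \<mu> (C b))) * (\<Prod>b<r. measure \<mu> (C b) ^ n b)"
    by (simp add: prod.distrib exp_sum sum_negf[symmetric])
  also have "(\<Sum>b<r. measure \<mu> (C b)) = measure \<mu> (space \<mu>)"
    unfolding space_mu cover[symmetric] using C disj sets_mu
    by (intro finite_measure_finite_Union[symmetric]) auto
  also have "(\<Prod>b<r. measure \<mu> (C b) ^ n b) = (\<Prod>b<r. \<Prod>j\<in>{j \<in> {..<m}. a j = b}. measure \<mu> (C (a j)))"
    unfolding n_def by (intro prod.cong) auto
  also have "\<dots> = (\<Prod>j<m. measure \<mu> (C (a j)))"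
    using a by (intro prod.group) auto
  also have "ennreal (exp (- measure \<mu> (space \<mu>)) * (\<Prod>j<m. measure \<mu> (C (a j)))) =
      ennreal (exp (- measure \<mu> (space \<mu>))) * (\<Prod>j<m. emeasure \<mu> (C (a j)))"
    by (subst ennreal_mult) (auto simp: prod_nonneg emeasure_eq_measure prod_ennreal)
  finally show ?thesis .
qed


lemma borel_measurable_rectangle_count:
  assumes B: "\<And>j. j < m \<Longrightarrow> B j \<in> sets S"
  shows "(\<lambda>\<omega>. of_nat (card {s \<in> injections {..<m} {..<m}. \<forall>j\<in>{..<m}. X (s j) \<omega> \<in> B j}) :: ennreal)
    \<in> borel_measurable M"
proof -
  have [measurable]: "B j \<in> sets \<mu>" if "j < m" for j using B that sets_mu by simp
  have "(\<lambda>\<omega>. \<Sum>s\<in>injections {..<m} {..<m}. \<Prod>j<m. indicator (B j) (X (s j) \<omega>) :: ennreal) \<in> borel_measurable M"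
    by (intro borel_measurable_sum borel_measurable_prod) simp
  also have "(\<lambda>\<omega>. \<Sum>s\<in>injections {..<m} {..<m}. \<Prod>j<m. indicator (B j) (X (s j) \<omega>) :: ennreal) =
      (\<lambda>\<omega>. of_nat (card {s \<in> injections {..<m} {..<m}. \<forall>j\<in>{..<m}. X (s j) \<omega> \<in> B j}))"
  proof
    fix \<omega>
    have "(\<Prod>j<m. indicator (B j) (X (s j) \<omega>) :: ennreal) =
        (if \<forall>j\<in>{..<m}. X (s j) \<omega> \<in> B j then 1 else 0)" for s
      by (auto simp: indicator_def intro!: prod.neutral)
    then have "(\<Sum>s\<in>injections {..<m} {..<m}. \<Prod>j<m. indicator (B j) (X (s j) \<omega>) :: ennreal) =
        (\<Sum>s\<in>{s \<in> injections {..<m} {..<m}. \<forall>j\<in>{..<m}. X (s j) \<omega> \<in> B j}. 1)"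
      by (subst sum.inter_filter) auto
    then show "(\<Sum>s\<in>injections {..<m} {..<m}. \<Prod>j<m. indicator (B j) (X (s j) \<omega>) :: ennreal) =
        of_nat (card {s \<in> injections {..<m} {..<m}. \<forall>j\<in>{..<m}. X (s j) \<omega> \<in> B j})"
      by simp
  qed
  finally show ?thesis .
qed

lemma nn_integral_rectangle_count:
  assumes B: "\<And>j. j < m \<Longrightarrow> B j \<in> sets S"
  shows "(\<integral>\<^sup>+\<omega>. (if \<tau> \<omega> = enat m then
      of_nat (card {s \<in> injections {..<m} {..<m}. \<forall>j\<in>{..<m}. X (s j) \<omega> \<in> B j}) else 0) \<partial>M) =
    ennreal (exp (- measure \<mu> (space \<mu>))) * (\<Prod>j<m. emeasure \<mu> (B j))"
proof -
  define r :: nat where "r = card (Pow {..<m})"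
  obtain e where e: "bij_betw e {..<r} (Pow {..<m})"
    unfolding r_def using ex_bij_betw_nat_finite[of "Pow {..<m}"] by (auto simp: atLeast0LessThan)
  \<comment> \<open>The \<open>C b\<close> are the atoms of the algebra generated by the
    \<open>B j\<close>, and \<open>e b\<close> lists the \<open>B j\<close> containing the atom. An
    element of \<open>A\<close> picks an atom inside \<open>B j\<close> for every \<open>j\<close>,
    so the rectangle of the \<open>B j\<close> splits into disjoint rectangles with atoms as
    sides.\<close>
  define C where "C b = {x \<in> space S. \<forall>j\<in>{..<m}. x \<in> B j \<longleftrightarrow> j \<in> e b}" for b
  define A where "A = (\<Pi>\<^sub>E j\<in>{..<m}. {b \<in> {..<r}. j \<in> e b})"
  have C: "C b \<in> sets S" for b
    unfolding C_def
  proof (rule sets.sets_Collect_finite_All)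
    fix j assume "j \<in> {..<m}"
    then have "B j \<in> sets S" using B by auto
    then have "B j \<inter> space S \<in> sets S" "space S - B j \<in> sets S" by auto
    moreover have "{x \<in> space S. x \<in> B j \<longleftrightarrow> j \<in> e b} = (if j \<in> e b then B j \<inter> space S else space S - B j)"
      by auto
    ultimately show "{x \<in> space S. x \<in> B j \<longleftrightarrow> j \<in> e b} \<in> sets S" by simp
  qed simp
  have sub: "e b \<subseteq> {..<m}" if "b < r" for b
    using bij_betwE[OF e] that by auto
  have disj: "disjoint_family_on C {..<r}"
    unfolding disjoint_family_on_def
  proof (intro ballI impI, rule ccontr)
    fix b b' assume b: "b \<in> {..<r}" "b' \<in> {..<r}" "b \<noteq> b'" and "C b \<inter> C b' \<noteq> {}"
    then obtain x where "x \<in> C b" "x \<in> C b'" by auto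
    then have "e b = e b'"
      using sub[of b] sub[of b'] b unfolding C_def by blast
    then show False using e b by (auto simp: bij_betw_def inj_on_def)
  qed
  have ex: "\<exists>b<r. x \<in> C b \<and> e b = {j \<in> {..<m}. x \<in> B j}" if "x \<in> space S" for x
  proof -
    have "{j \<in> {..<m}. x \<in> B j} \<in> e ` {..<r}" using e by (auto simp: bij_betw_def)
    then obtain b where "b < r" "e b = {j \<in> {..<m}. x \<in> B j}" by auto
    then show ?thesis using that by (auto simp: C_def)
  qed
  have cover: "(\<Union>b<r. C b) = space S"
    using ex by (force simp: C_def)
  have BC: "emeasure \<mu> (B j) = (\<Sum>b\<in>{b \<in> {..<r}. j \<in> e b}. emeasure \<mu> (C b))" if j: "j \<in> {..<m}" for j
  proof -
    have "B j \<subseteq> space S" using B j sets.sets_into_space by blast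
    have "B j = (\<Union>b\<in>{b \<in> {..<r}. j \<in> e b}. C b)"
    proof (intro equalityI subsetI)
      fix x assume x: "x \<in> B j"
      then obtain b where "b < r" "x \<in> C b" "e b = {j \<in> {..<m}. x \<in> B j}"
        using \<open>B j \<subseteq> space S\<close> ex by blast
      then show "x \<in> (\<Union>b\<in>{b \<in> {..<r}. j \<in> e b}. C b)" using x j by auto
    qed (use j in \<open>auto simp: C_def\<close>)
    also have "emeasure \<mu> \<dots> = (\<Sum>b\<in>{b \<in> {..<r}. j \<in> e b}. emeasure \<mu> (C b))"
      using C disj sets_mu by (intro sum_emeasure[symmetric] disjoint_family_on_mono[OF _ disj]) auto
    finally show ?thesis .
  qed
  have finA: "finite A" unfolding A_def by (intro finite_PiE) auto
  have Ar: "a \<in> {..<m} \<rightarrow> {..<r}" if "a \<in> A" for a using that by (auto simp: A_def)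
  have count: "card {s \<in> injections {..<m} {..<m}. \<forall>j\<in>{..<m}. X (s j) \<omega> \<in> B j} =
      (\<Sum>a\<in>A. card {s \<in> injections {..<m} {..<m}. \<forall>j\<in>{..<m}. X (s j) \<omega> \<in> C (a j)})"
    if w: "\<omega> \<in> space M" for \<omega>
  proof -
    have "{s \<in> injections {..<m} {..<m}. \<forall>j\<in>{..<m}. X (s j) \<omega> \<in> B j} =
        (\<Union>a\<in>A. {s \<in> injections {..<m} {..<m}. \<forall>j\<in>{..<m}. X (s j) \<omega> \<in> C (a j)})" (is "?L = ?R")
    proof
      show "?R \<subseteq> ?L" by (fastforce simp: A_def C_def)
      show "?L \<subseteq> ?R"
      proof
        fix s assume s: "s \<in> ?L"
        have "\<forall>j. \<exists>b<r. X (s j) \<omega> \<in> C b \<and> e b = {j' \<in> {..<m}. X (s j) \<omega> \<in> B j'}"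
          using ex X_space[OF w] by blast
        then obtain a where a: "\<And>j. a j < r \<and> X (s j) \<omega> \<in> C (a j) \<and> e (a j) = {j' \<in> {..<m}. X (s j) \<omega> \<in> B j'}"
          by metis
        have "restrict a {..<m} \<in> A" using a s by (auto simp: A_def)
        then show "s \<in> ?R"
        proof (rule UN_I)
          show "s \<in> {s \<in> injections {..<m} {..<m}. \<forall>j\<in>{..<m}. X (s j) \<omega> \<in> C (restrict a {..<m} j)}"
            using a s by simp
        qed
      qed
    qed
    also have "card \<dots> = (\<Sum>a\<in>A. card {s \<in> injections {..<m} {..<m}. \<forall>j\<in>{..<m}. X (s j) \<omega> \<in> C (a j)})"
    proof (intro card_UN_disjoint finA ballI impI)
      fix a a' assume a: "a \<in> A" "a' \<in> A" "a \<noteq> a'"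
      have "\<exists>j<m. a j \<noteq> a' j"
        using a(3) PiE_ext[OF a(1,2)[unfolded A_def]] by blast
      then obtain j where j: "j < m" "a j \<noteq> a' j" by blast
      then have "C (a j) \<inter> C (a' j) = {}"
        using a disj Ar[OF a(1)] Ar[OF a(2)] unfolding disjoint_family_on_def by (auto simp: Pi_iff)
      then show "{s \<in> injections {..<m} {..<m}. \<forall>j\<in>{..<m}. X (s j) \<omega> \<in> C (a j)} \<inter>
          {s \<in> injections {..<m} {..<m}. \<forall>j\<in>{..<m}. X (s j) \<omega> \<in> C (a' j)} = {}"
        using j by fastforce
    qed auto
    finally show ?thesis .
  qed
  have meas: "(\<lambda>\<omega>. if \<tau> \<omega> = enat m then
      of_nat (card {s \<in> injections {..<m} {..<m}. \<forall>j\<in>{..<m}. X (s j) \<omega> \<in> C (a j)}) else 0 :: ennreal)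
      \<in> borel_measurable M" for a
  proof -
    have "(\<lambda>\<omega>. of_nat (card {s \<in> injections {..<m} {..<m}. \<forall>j\<in>{..<m}. X (s j) \<omega> \<in> C (a j)}) :: ennreal)
        \<in> borel_measurable M"
      by (rule borel_measurable_rectangle_count) (rule C)
    then show ?thesis by measurable
  qed
  have "(\<integral>\<^sup>+\<omega>. (if \<tau> \<omega> = enat m then
      of_nat (card {s \<in> injections {..<m} {..<m}. \<forall>j\<in>{..<m}. X (s j) \<omega> \<in> B j}) else 0) \<partial>M) =
    (\<integral>\<^sup>+\<omega>. (\<Sum>a\<in>A. if \<tau> \<omega> = enat m then
      of_nat (card {s \<in> injections {..<m} {..<m}. \<forall>j\<in>{..<m}. X (s j) \<omega> \<in> C (a j)}) else 0) \<partial>M)"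
    by (intro nn_integral_cong) (simp add: count)
  also have "\<dots> = (\<Sum>a\<in>A. ennreal (exp (- measure \<mu> (space \<mu>))) * (\<Prod>j<m. emeasure \<mu> (C (a j))))"
    by (subst nn_integral_sum[OF meas])
      (intro sum.cong refl nn_integral_matching_count[OF C disj cover] Ar)
  also have "\<dots> = ennreal (exp (- measure \<mu> (space \<mu>))) * (\<Sum>a\<in>A. \<Prod>j<m. emeasure \<mu> (C (a j)))"
    by (simp add: sum_distrib_left)
  also have "(\<Sum>a\<in>A. \<Prod>j<m. emeasure \<mu> (C (a j))) = (\<Prod>j<m. \<Sum>b\<in>{b \<in> {..<r}. j \<in> e b}. emeasure \<mu> (C b))"
    unfolding A_def by (intro prod_sum_PiE[symmetric]) auto
  also have "\<dots> = (\<Prod>j<m. emeasure \<mu> (B j))"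
    by (intro prod.cong refl BC[symmetric]) auto
  finally show ?thesis .
qed

end

lemma ennreal_suminf_single:
  fixes f :: "nat \<Rightarrow> ennreal"
  shows "(\<Sum>n. if n = m then f n else 0) = f m"
  using sums_single[of m f] by (simp add: sums_iff)

context proper_poisson_process
begin

abbreviation "tuples m \<equiv> \<Pi>\<^sub>M j\<in>{..<m}. \<mu>"

lemma product_sigma_finite: "product_sigma_finite (\<lambda>_. \<mu>)"
  by (simp add: product_sigma_finite_def sigma_finite_measure_axioms)

text \<open>Rectangles determine a product measure, so the formula for rectangle counts extends to
  every measurable \<open>F\<close>.\<close>

lemma nn_integral_tuples:
  assumes F [measurable]: "F \<in> borel_measurable (tuples m)"
  shows "(\<integral>\<^sup>+\<omega>. (if \<tau> \<omega> = enat m then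
      \<Sum>s\<in>injections {..<m} {..<m}. F (\<lambda>j\<in>{..<m}. X (s j) \<omega>) else 0) \<partial>M) =
    ennreal (exp (- measure \<mu> (space \<mu>))) * (\<integral>\<^sup>+x. F x \<partial>tuples m)"
proof -
  interpret product_sigma_finite "\<lambda>_. \<mu>" by (rule product_sigma_finite)
  define Inj where "Inj = (injections {..<m} {..<m} :: (nat \<Rightarrow> nat) set)"
  have fin [simp]: "finite Inj" by (simp add: Inj_def)
  let ?N = "count_space Inj \<Otimes>\<^sub>M M"
  interpret N: pair_sigma_finite "count_space Inj" M
    by (intro pair_sigma_finite.intro P.sigma_finite_measure_axioms
        sigma_finite_measure_count_space_countable countable_finite fin)
  define T where "T = (\<lambda>(s, \<omega>). \<lambda>j\<in>{..<m}. X (s j) \<omega>)"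
  define u where "u \<omega> = (if \<tau> \<omega> = enat m then ennreal (exp (measure \<mu> (space \<mu>))) else 0)" for \<omega>
  have [measurable]: "u \<in> borel_measurable M" unfolding u_def by measurable
  have T [measurable]: "T \<in> measurable ?N (tuples m)"
    by (rule measurable_pair_measure_countable1) (auto simp: T_def countable_finite)
  \<comment> \<open>Writing the sum over permutations as an integral over counting measure turns the
    symmetrized law into a single image measure. The weight \<open>u\<close> restricts to
    \<open>\<tau> \<omega> = enat m\<close> and contains
    \<open>exp (measure \<mu> (space \<mu>))\<close>, which normalizes \<open>Q\<close> to the
    product measure.\<close>
  define Q where "Q = distr (density ?N (\<lambda>(s, \<omega>). u \<omega>)) (tuples m) T"
  have Q: "(\<integral>\<^sup>+x. G x \<partial>Q) = (\<integral>\<^sup>+\<omega>. u \<omega> * (\<Sum>s\<in>Inj. G (\<lambda>j\<in>{..<m}. X (s j) \<omega>)) \<partial>M)"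
    if [measurable]: "G \<in> borel_measurable (tuples m)" for G
  proof -
    have "(\<integral>\<^sup>+x. G x \<partial>Q) = (\<integral>\<^sup>+z. u (snd z) * G (T z) \<partial>?N)"
      unfolding Q_def by (simp add: nn_integral_distr nn_integral_density split_def)
    also have "\<dots> = (\<integral>\<^sup>+\<omega>. \<integral>\<^sup>+s. u \<omega> * G (T (s, \<omega>)) \<partial>count_space Inj \<partial>M)"
      by (subst N.nn_integral_snd[symmetric]) auto
    also have "\<dots> = (\<integral>\<^sup>+\<omega>. u \<omega> * (\<Sum>s\<in>Inj. G (\<lambda>j\<in>{..<m}. X (s j) \<omega>)) \<partial>M)"
      by (intro nn_integral_cong) (simp add: nn_integral_count_space_finite sum_distrib_left T_def)
    finally show ?thesis .
  qed
  have "Q = tuples m"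
  proof (rule PiM_eqI)
    fix B assume B: "\<And>i. i \<in> {..<m} \<Longrightarrow> B i \<in> sets \<mu>"
    then have PB: "Pi\<^sub>E {..<m} B \<in> sets (tuples m)" by (intro sets_PiM_I_finite) auto
    then have "emeasure Q (Pi\<^sub>E {..<m} B) = (\<integral>\<^sup>+x. indicator (Pi\<^sub>E {..<m} B) x \<partial>Q)"
      by (simp add: Q_def)
    also have "\<dots> = (\<integral>\<^sup>+\<omega>. u \<omega> * (\<Sum>s\<in>Inj. indicator (Pi\<^sub>E {..<m} B) (\<lambda>j\<in>{..<m}. X (s j) \<omega>)) \<partial>M)"
      using PB by (intro Q) simp
    also have "\<dots> = (\<integral>\<^sup>+\<omega>. ennreal (exp (measure \<mu> (space \<mu>))) * (if \<tau> \<omega> = enat m then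
      of_nat (card {s \<in> injections {..<m} {..<m}. \<forall>j\<in>{..<m}. X (s j) \<omega> \<in> B j}) else 0) \<partial>M)"
    proof (intro nn_integral_cong)
      fix \<omega>
      have "(\<Sum>s\<in>Inj. indicator (Pi\<^sub>E {..<m} B) (\<lambda>j\<in>{..<m}. X (s j) \<omega>) :: ennreal) =
          (\<Sum>s\<in>Inj. if \<forall>j\<in>{..<m}. X (s j) \<omega> \<in> B j then 1 else 0)"
        by (intro sum.cong) (auto simp: indicator_def PiE_iff)
      also have "\<dots> = (\<Sum>s\<in>{s \<in> Inj. \<forall>j\<in>{..<m}. X (s j) \<omega> \<in> B j}. 1)"
        by (rule sum.inter_filter[symmetric]) simp
      finally show "u \<omega> * (\<Sum>s\<in>Inj. indicator (Pi\<^sub>E {..<m} B) (\<lambda>j\<in>{..<m}. X (s j) \<omega>)) =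
          ennreal (exp (measure \<mu> (space \<mu>))) * (if \<tau> \<omega> = enat m then
          of_nat (card {s \<in> injections {..<m} {..<m}. \<forall>j\<in>{..<m}. X (s j) \<omega> \<in> B j}) else 0)"
        unfolding u_def Inj_def by simp
    qed
    also have "\<dots> = ennreal (exp (measure \<mu> (space \<mu>))) *
        (ennreal (exp (- measure \<mu> (space \<mu>))) * (\<Prod>j<m. emeasure \<mu> (B j)))"
    proof (subst nn_integral_cmult)
      have "(\<lambda>\<omega>. of_nat (card {s \<in> injections {..<m} {..<m}. \<forall>j\<in>{..<m}. X (s j) \<omega> \<in> B j}) :: ennreal)
          \<in> borel_measurable M"
        using B sets_mu by (intro borel_measurable_rectangle_count) simp
      then show "(\<lambda>\<omega>. if \<tau> \<omega> = enat m then of_nat (card {s \<in> injections {..<m} {..<m}.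
          \<forall>j\<in>{..<m}. X (s j) \<omega> \<in> B j}) else 0 :: ennreal) \<in> borel_measurable M"
        by measurable
    qed (use B sets_mu in \<open>simp add: nn_integral_rectangle_count\<close>)
    also have "\<dots> = (\<Prod>j<m. emeasure \<mu> (B j))"
      by (simp add: mult.assoc[symmetric] ennreal_mult[symmetric] exp_minus)
    finally show "emeasure Q (Pi\<^sub>E {..<m} B) = (\<Prod>i\<in>{..<m}. emeasure \<mu> (B i))" .
  qed (simp_all add: Q_def)
  then have "(\<integral>\<^sup>+x. F x \<partial>tuples m) = (\<integral>\<^sup>+\<omega>. u \<omega> * (\<Sum>s\<in>Inj. F (\<lambda>j\<in>{..<m}. X (s j) \<omega>)) \<partial>M)"
    using Q[OF F] by simp
  then have "ennreal (exp (- measure \<mu> (space \<mu>))) * (\<integral>\<^sup>+x. F x \<partial>tuples m) =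
      (\<integral>\<^sup>+\<omega>. ennreal (exp (- measure \<mu> (space \<mu>))) * (u \<omega> * (\<Sum>s\<in>Inj. F (\<lambda>j\<in>{..<m}. X (s j) \<omega>))) \<partial>M)"
    by (simp add: nn_integral_cmult)
  also have "\<dots> = (\<integral>\<^sup>+\<omega>. (if \<tau> \<omega> = enat m then
      \<Sum>s\<in>injections {..<m} {..<m}. F (\<lambda>j\<in>{..<m}. X (s j) \<omega>) else 0) \<partial>M)"
    by (intro nn_integral_cong)
      (simp add: u_def Inj_def mult.assoc[symmetric] ennreal_mult[symmetric] exp_minus)
  finally show ?thesis ..
qed

text \<open>For invariant \<open>F\<close> the \<open>fact m\<close> summands of the symmetrized law
  coincide, hence the division by \<open>fact m\<close>.\<close>

lemma nn_integral_symmetric: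
  assumes F [measurable]: "F \<in> borel_measurable (tuples m)"
    and sym: "\<And>x s. x \<in> space (tuples m) \<Longrightarrow> s \<in> injections {..<m} {..<m} \<Longrightarrow> F (\<lambda>j\<in>{..<m}. x (s j)) = F x"
  shows "(\<integral>\<^sup>+\<omega>. (if \<tau> \<omega> = enat m then F (\<lambda>j\<in>{..<m}. X j \<omega>) else 0) \<partial>M) =
    ennreal (exp (- measure \<mu> (space \<mu>)) / fact m) * (\<integral>\<^sup>+x. F x \<partial>tuples m)"
proof -
  have card: "card (injections {..<m} {..<m} :: (nat \<Rightarrow> nat) set) = fact m"
    using card_injections[of "{..<m}" "{..<m}"] by simp
  have "(\<Sum>s\<in>injections {..<m} {..<m}. F (\<lambda>j\<in>{..<m}. X (s j) \<omega>)) =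
      ennreal (fact m) * F (\<lambda>j\<in>{..<m}. X j \<omega>)" if w: "\<omega> \<in> space M" for \<omega>
  proof -
    have "(\<lambda>j\<in>{..<m}. X j \<omega>) \<in> space (tuples m)"
      using X_space[OF w] by (simp add: space_PiM space_mu)
    note sym = sym[OF this]
    have "F (\<lambda>j\<in>{..<m}. X (s j) \<omega>) = F (\<lambda>j\<in>{..<m}. X j \<omega>)"
      if s: "s \<in> injections {..<m} {..<m}" for s
    proof -
      have "(\<lambda>j\<in>{..<m}. (\<lambda>j\<in>{..<m}. X j \<omega>) (s j)) = (\<lambda>j\<in>{..<m}. X (s j) \<omega>)"
        using s by (intro restrict_ext) (auto simp: injections_def)
      from sym[OF s, unfolded this] show ?thesis .
    qed
    then have "(\<Sum>s\<in>injections {..<m} {..<m}. F (\<lambda>j\<in>{..<m}. X (s j) \<omega>)) =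
        of_nat (fact m) * F (\<lambda>j\<in>{..<m}. X j \<omega>)"
      by (simp add: card)
    then show ?thesis by (simp add: ennreal_of_nat_eq_real_of_nat)
  qed
  then have "(\<integral>\<^sup>+\<omega>. (if \<tau> \<omega> = enat m then
      \<Sum>s\<in>injections {..<m} {..<m}. F (\<lambda>j\<in>{..<m}. X (s j) \<omega>) else 0) \<partial>M) =
      (\<integral>\<^sup>+\<omega>. ennreal (fact m) * (if \<tau> \<omega> = enat m then F (\<lambda>j\<in>{..<m}. X j \<omega>) else 0) \<partial>M)"
    by (intro nn_integral_cong) auto
  also have "\<dots> = ennreal (fact m) * (\<integral>\<^sup>+\<omega>. (if \<tau> \<omega> = enat m then F (\<lambda>j\<in>{..<m}. X j \<omega>) else 0) \<partial>M)"
    by (intro nn_integral_cmult) measurable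
  finally have eq: "ennreal (fact m) * (\<integral>\<^sup>+\<omega>. (if \<tau> \<omega> = enat m then F (\<lambda>j\<in>{..<m}. X j \<omega>) else 0) \<partial>M) =
      ennreal (exp (- measure \<mu> (space \<mu>))) * (\<integral>\<^sup>+x. F x \<partial>tuples m)"
    by (simp add: nn_integral_tuples)
  have "ennreal (1 / fact m) * ennreal (fact m) = 1"
    by (simp add: ennreal_mult[symmetric])
  then have "(\<integral>\<^sup>+\<omega>. (if \<tau> \<omega> = enat m then F (\<lambda>j\<in>{..<m}. X j \<omega>) else 0) \<partial>M) =
      ennreal (1 / fact m) * (ennreal (fact m) * (\<integral>\<^sup>+\<omega>. (if \<tau> \<omega> = enat m then F (\<lambda>j\<in>{..<m}. X j \<omega>) else 0) \<partial>M))"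
    by (simp add: mult.assoc[symmetric])
  then show ?thesis
    unfolding eq by (simp add: mult.assoc[symmetric] ennreal_mult[symmetric])
qed

end

section \<open>Multivariate Mecke formula\<close>

lemma nn_integral_PiM_reindex:
  assumes \<mu>: "finite_measure \<mu>" and I: "finite I" and p: "bij_betw p I J"
    and F: "F \<in> borel_measurable (\<Pi>\<^sub>M i\<in>I. \<mu>)"
  shows "(\<integral>\<^sup>+x. F (\<lambda>i\<in>I. x (p i)) \<partial>(\<Pi>\<^sub>M j\<in>J. \<mu>)) = (\<integral>\<^sup>+x. F x \<partial>(\<Pi>\<^sub>M i\<in>I. \<mu>))"
proof -
  interpret finite_measure \<mu> by fact
  interpret product_sigma_finite "\<lambda>_. \<mu>"
    by (simp add: product_sigma_finite_def sigma_finite_measure_axioms)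
  have J: "finite J" using p I bij_betw_finite by blast
  let ?T = "\<lambda>x. \<lambda>i\<in>I. x (p i)"
  have pI: "p i \<in> J" if "i \<in> I" for i using p that by (auto simp: bij_betw_def)
  have T [measurable]: "?T \<in> measurable (\<Pi>\<^sub>M j\<in>J. \<mu>) (\<Pi>\<^sub>M i\<in>I. \<mu>)"
    using pI by (intro measurable_restrict measurable_component_singleton)
  have "distr (\<Pi>\<^sub>M j\<in>J. \<mu>) (\<Pi>\<^sub>M i\<in>I. \<mu>) ?T = (\<Pi>\<^sub>M i\<in>I. \<mu>)"
  proof (rule PiM_eqI)
    fix A assume A: "\<And>i. i \<in> I \<Longrightarrow> A i \<in> sets \<mu>"
    let ?B = "\<lambda>j. A (inv_into I p j)"
    have inv: "inv_into I p (p i) = i" if "i \<in> I" for i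
      using p that by (auto simp: bij_betw_def)
    have invI: "inv_into I p j \<in> I" if "j \<in> J" for j
      using p that by (auto simp: bij_betw_def inv_into_into)
    have pinv: "p (inv_into I p j) = j" if "j \<in> J" for j
      using p that by (auto simp: bij_betw_def f_inv_into_f)
    have AS: "A i \<subseteq> space \<mu>" if "i \<in> I" for i using A[OF that] by (rule sets.sets_into_space)
    have "?T -` Pi\<^sub>E I A \<inter> space (\<Pi>\<^sub>M j\<in>J. \<mu>) = Pi\<^sub>E J ?B"
    proof (intro equalityI subsetI)
      fix x assume x: "x \<in> ?T -` Pi\<^sub>E I A \<inter> space (\<Pi>\<^sub>M j\<in>J. \<mu>)"
      have "x j \<in> ?B j" if "j \<in> J" for j
        using x invI[OF that] pinv[OF that] by (auto simp: PiE_iff)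
      then show "x \<in> Pi\<^sub>E J ?B" using x by (auto simp: space_PiM PiE_iff)
    next
      fix x assume x: "x \<in> Pi\<^sub>E J ?B"
      then have "x (p i) \<in> A i" if "i \<in> I" for i
        using pI[OF that] inv[OF that] by (force simp: PiE_iff)
      moreover have "x j \<in> space \<mu>" if "j \<in> J" for j
        using x AS[OF invI[OF that]] that by (auto simp: PiE_iff)
      ultimately show "x \<in> ?T -` Pi\<^sub>E I A \<inter> space (\<Pi>\<^sub>M j\<in>J. \<mu>)"
        using x by (auto simp: space_PiM PiE_iff)
    qed
    then have "emeasure (distr (\<Pi>\<^sub>M j\<in>J. \<mu>) (\<Pi>\<^sub>M i\<in>I. \<mu>) ?T) (Pi\<^sub>E I A) =
        emeasure (\<Pi>\<^sub>M j\<in>J. \<mu>) (Pi\<^sub>E J ?B)"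
      using A I by (subst emeasure_distr[OF T]) (auto intro: sets_PiM_I_finite)
    also have "\<dots> = (\<Prod>j\<in>J. emeasure \<mu> (?B j))"
      using A invI J by (intro emeasure_PiM) auto
    also have "\<dots> = (\<Prod>i\<in>I. emeasure \<mu> (A i))"
      by (subst prod.reindex_bij_betw[OF p, symmetric]) (simp add: inv)
    finally show "emeasure (distr (\<Pi>\<^sub>M j\<in>J. \<mu>) (\<Pi>\<^sub>M i\<in>I. \<mu>) ?T) (Pi\<^sub>E I A) = (\<Prod>i\<in>I. emeasure \<mu> (A i))" .
  qed (use I in simp_all)
  then show ?thesis using nn_integral_distr[OF T, of F] F by simp
qed

text \<open>Encodes functions of a finite point configuration. Invariance under bijections of index
  sets leaves only the points with their multiplicities; allowing any finite index set makes it
  possible to join two families with disjoint indices.\<close>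

definition configuration_functional :: "'a measure \<Rightarrow> (nat set \<Rightarrow> (nat \<Rightarrow> 'a) \<Rightarrow> ennreal) \<Rightarrow> bool" where
  "configuration_functional \<mu> \<Phi> \<longleftrightarrow>
    (\<forall>I. finite I \<longrightarrow> \<Phi> I \<in> borel_measurable (\<Pi>\<^sub>M i\<in>I. \<mu>)) \<and>
    (\<forall>I J p x. finite I \<longrightarrow> bij_betw p I J \<longrightarrow> x \<in> space (\<Pi>\<^sub>M j\<in>J. \<mu>) \<longrightarrow>
      \<Phi> I (\<lambda>i\<in>I. x (p i)) = \<Phi> J x)"

text \<open>The expectation under the Poisson law, split by the number \<open>n\<close> of points.
  Indexing these from \<open>k\<close> on leaves the indices below \<open>k\<close> to the points
  that the Mecke formula adds.\<close>

definition poisson_expectation :: "nat \<Rightarrow> 'a measure \<Rightarrow> (nat set \<Rightarrow> (nat \<Rightarrow> 'a) \<Rightarrow> ennreal) \<Rightarrow> ennreal" where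
  "poisson_expectation k \<mu> \<Phi> = (\<Sum>n. ennreal (exp (- measure \<mu> (space \<mu>)) / fact n) *
    (\<integral>\<^sup>+y. \<Phi> {k..<k + n} y \<partial>(\<Pi>\<^sub>M j\<in>{k..<k + n}. \<mu>)))"

lemma configuration_functionalD:
  assumes "configuration_functional \<mu> \<Phi>" "finite I"
  shows "\<Phi> I \<in> borel_measurable (\<Pi>\<^sub>M i\<in>I. \<mu>)"
    and "bij_betw p I J \<Longrightarrow> x \<in> space (\<Pi>\<^sub>M j\<in>J. \<mu>) \<Longrightarrow> \<Phi> I (\<lambda>i\<in>I. x (p i)) = \<Phi> J x"
  using assms by (auto simp: configuration_functional_def)

lemma poisson_expectation_shift:
  assumes \<mu>: "finite_measure \<mu>" and \<Phi>: "configuration_functional \<mu> \<Phi>"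
  shows "poisson_expectation k \<mu> \<Phi> = poisson_expectation 0 \<mu> \<Phi>"
proof -
  have "(\<integral>\<^sup>+y. \<Phi> {k..<k + n} y \<partial>(\<Pi>\<^sub>M j\<in>{k..<k + n}. \<mu>)) = (\<integral>\<^sup>+y. \<Phi> {0..<0 + n} y \<partial>(\<Pi>\<^sub>M j\<in>{0..<0 + n}. \<mu>))" for n
  proof -
    have p: "bij_betw ((+) k) {0..<0 + n} {k..<k + n}"
      by (auto simp: bij_betw_def image_add_atLeastLessThan)
    have "(\<integral>\<^sup>+y. \<Phi> {k..<k + n} y \<partial>(\<Pi>\<^sub>M j\<in>{k..<k + n}. \<mu>)) =
        (\<integral>\<^sup>+y. \<Phi> {0..<0 + n} (\<lambda>i\<in>{0..<0 + n}. y (k + i)) \<partial>(\<Pi>\<^sub>M j\<in>{k..<k + n}. \<mu>))"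
      by (intro nn_integral_cong configuration_functionalD(2)[OF \<Phi> _ p, symmetric]) auto
    also have "\<dots> = (\<integral>\<^sup>+y. \<Phi> {0..<0 + n} y \<partial>(\<Pi>\<^sub>M j\<in>{0..<0 + n}. \<mu>))"
      by (intro nn_integral_PiM_reindex[OF \<mu> _ p] configuration_functionalD(1)[OF \<Phi>]) auto
    finally show ?thesis .
  qed
  then show ?thesis unfolding poisson_expectation_def by simp
qed

lemma poisson_expectation_mono:
  assumes "\<And>n y. y \<in> space (\<Pi>\<^sub>M j\<in>{k..<k + n}. \<mu>) \<Longrightarrow> \<Phi> {k..<k + n} y \<le> \<Psi> {k..<k + n} y"
  shows "poisson_expectation k \<mu> \<Phi> \<le> poisson_expectation k \<mu> \<Psi>"
  unfolding poisson_expectation_def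
  by (intro suminf_le summableI mult_left_mono nn_integral_mono assms) auto

lemma poisson_expectation_add:
  assumes "\<And>n. \<Phi> {k..<k + n} \<in> borel_measurable (\<Pi>\<^sub>M j\<in>{k..<k + n}. \<mu>)"
    "\<And>n. \<Psi> {k..<k + n} \<in> borel_measurable (\<Pi>\<^sub>M j\<in>{k..<k + n}. \<mu>)"
  shows "poisson_expectation k \<mu> (\<lambda>I y. \<Phi> I y + \<Psi> I y) = poisson_expectation k \<mu> \<Phi> + poisson_expectation k \<mu> \<Psi>"
  unfolding poisson_expectation_def
  by (subst suminf_add) (simp_all add: nn_integral_add assms distrib_left)

lemma poisson_expectation_sum:
  assumes "finite A" "\<And>a n. a \<in> A \<Longrightarrow> \<Phi> a {k..<k + n} \<in> borel_measurable (\<Pi>\<^sub>M j\<in>{k..<k + n}. \<mu>)"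
  shows "poisson_expectation k \<mu> (\<lambda>I y. \<Sum>a\<in>A. \<Phi> a I y) = (\<Sum>a\<in>A. poisson_expectation k \<mu> (\<Phi> a))"
  using assms
proof (induction A rule: finite_induct)
  case empty
  then show ?case by (simp add: poisson_expectation_def)
next
  case (insert a A)
  then show ?case
    by (simp, subst poisson_expectation_add) (auto intro!: borel_measurable_sum)
qed

lemma poisson_expectation_cmult:
  assumes "\<And>n. \<Phi> {k..<k + n} \<in> borel_measurable (\<Pi>\<^sub>M j\<in>{k..<k + n}. \<mu>)"
  shows "poisson_expectation k \<mu> (\<lambda>I y. c * \<Phi> I y) = c * poisson_expectation k \<mu> \<Phi>"
  unfolding poisson_expectation_def
  by (simp only: nn_integral_cmult[OF assms] mult.left_commute[of _ c] ennreal_suminf_cmult)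

lemma poisson_expectation_1:
  assumes "finite_measure \<mu>"
  shows "poisson_expectation k \<mu> (\<lambda>_ _. 1) = 1"
proof -
  interpret finite_measure \<mu> by fact
  interpret product_sigma_finite "\<lambda>_. \<mu>"
    by (simp add: product_sigma_finite_def sigma_finite_measure_axioms)
  have "emeasure (\<Pi>\<^sub>M j\<in>{k..<k + n}. \<mu>) (space (\<Pi>\<^sub>M j\<in>{k..<k + n}. \<mu>)) = ennreal (measure \<mu> (space \<mu>) ^ n)" for n
    unfolding space_PiM by (subst emeasure_PiM) (auto simp: emeasure_eq_measure ennreal_power)
  then have "poisson_expectation k \<mu> (\<lambda>_ _. 1) = (\<Sum>n. ennreal (poisson_weight (measure \<mu> (space \<mu>)) n))"
    by (simp add: poisson_expectation_def poisson_weight_def ennreal_mult[symmetric] ac_simps)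
  also have "\<dots> = ennreal 1"
    using poisson_weight_sums[of "measure \<mu> (space \<mu>)"]
    by (intro suminf_ennreal_eq) (auto simp: poisson_weight_nonneg)
  finally show ?thesis by simp
qed

lemma borel_measurable_poisson_expectation_merge:
  assumes \<mu>: "finite_measure \<mu>" and \<Phi>: "configuration_functional \<mu> \<Phi>" and L: "finite L"
  shows "(\<lambda>z. poisson_expectation k \<mu> (\<lambda>I y. \<Phi> (L \<union> I) (merge L I (z, y)))) \<in> borel_measurable (\<Pi>\<^sub>M j\<in>L. \<mu>)"
proof -
  interpret finite_measure \<mu> by fact
  interpret product_sigma_finite "\<lambda>_. \<mu>"
    by (simp add: product_sigma_finite_def sigma_finite_measure_axioms)
  have [measurable]: "\<Phi> (L \<union> {k..<k + n}) \<in> borel_measurable (\<Pi>\<^sub>M j\<in>L \<union> {k..<k + n}. \<mu>)" for n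
    using L by (intro configuration_functionalD(1)[OF \<Phi>]) auto
  have [measurable]: "(\<lambda>z. \<integral>\<^sup>+y. \<Phi> (L \<union> {k..<k + n}) (merge L {k..<k + n} (z, y)) \<partial>(\<Pi>\<^sub>M j\<in>{k..<k + n}. \<mu>))
      \<in> borel_measurable (\<Pi>\<^sub>M j\<in>L. \<mu>)" for n
  proof -
    interpret K: sigma_finite_measure "\<Pi>\<^sub>M j\<in>{k..<k + n}. \<mu>" by (rule sigma_finite) simp
    show ?thesis by measurable
  qed
  show ?thesis unfolding poisson_expectation_def by measurable
qed

text \<open>Relabelling the points by \<open>p\<close> only permutes the summands: \<open>t\<close>
  corresponds to \<open>p\<close> after \<open>t\<close>.\<close>

lemma configuration_functional_sum_injections:
  assumes L: "finite L" and F: "F \<in> borel_measurable (\<Pi>\<^sub>M j\<in>L. \<mu>)"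
  shows "configuration_functional \<mu> (\<lambda>I x. \<Sum>t\<in>injections L I. F (\<lambda>j\<in>L. x (t j)))"
  unfolding configuration_functional_def
proof (intro conjI allI impI)
  fix I :: "nat set" assume I: "finite I"
  show "(\<lambda>x. \<Sum>t\<in>injections L I. F (\<lambda>j\<in>L. x (t j))) \<in> borel_measurable (\<Pi>\<^sub>M i\<in>I. \<mu>)"
  proof (intro borel_measurable_sum measurable_compose[OF _ F])
    fix t assume "t \<in> injections L I"
    then show "(\<lambda>x. \<lambda>j\<in>L. x (t j)) \<in> measurable (\<Pi>\<^sub>M i\<in>I. \<mu>) (\<Pi>\<^sub>M j\<in>L. \<mu>)"
      by (intro measurable_restrict measurable_component_singleton) (auto simp: injections_def)
  qed
next
  fix I J :: "nat set" and p x assume I: "finite I" and p: "bij_betw p I J"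
  have pI: "p i \<in> J" if "i \<in> I" for i using p that by (auto simp: bij_betw_def)
  have inj: "inj_on p I" using p by (simp add: bij_betw_def)
  have "bij_betw (\<lambda>t. \<lambda>j\<in>L. p (t j)) (injections L I) (injections L J)"
    unfolding bij_betw_def
  proof
    show "inj_on (\<lambda>t. \<lambda>j\<in>L. p (t j)) (injections L I)"
    proof (rule inj_onI)
      fix s t assume st: "s \<in> injections L I" "t \<in> injections L I" "(\<lambda>j\<in>L. p (s j)) = (\<lambda>j\<in>L. p (t j))"
      have "s j = t j" if j: "j \<in> L" for j
      proof -
        have "p (s j) = p (t j)" using fun_cong[OF st(3), of j] j by simp
        then show ?thesis using inj st(1,2) j by (auto simp: injections_def PiE_iff dest: inj_onD)
      qed
      then show "s = t" using st(1,2) by (auto simp: injections_def intro: PiE_ext)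
    qed
    show "(\<lambda>t. \<lambda>j\<in>L. p (t j)) ` injections L I = injections L J"
    proof (intro equalityI subsetI)
      fix s assume "s \<in> (\<lambda>t. \<lambda>j\<in>L. p (t j)) ` injections L I"
      then obtain t where t: "t \<in> injections L I" "s = (\<lambda>j\<in>L. p (t j))" by auto
      have "inj_on s L"
        using t inj unfolding injections_def inj_on_def by (auto simp: PiE_iff)
      then show "s \<in> injections L J" using t pI by (auto simp: injections_def PiE_iff)
    next
      fix s assume s: "s \<in> injections L J"
      define t where "t = (\<lambda>j\<in>L. inv_into I p (s j))"
      have sJ: "s j \<in> p ` I" if "j \<in> L" for j
        using s p that by (auto simp: injections_def bij_betw_def PiE_iff)
      have "t \<in> injections L I"
        using s sJ by (auto simp: t_def injections_def inv_into_into inj_on_def dest: inv_into_injective)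
      moreover have "s = (\<lambda>j\<in>L. p (t j))"
      proof
        fix j show "s j = (\<lambda>j\<in>L. p (t j)) j"
          using s sJ by (cases "j \<in> L") (auto simp: t_def f_inv_into_f injections_def PiE_iff extensional_def)
      qed
      ultimately show "s \<in> (\<lambda>t. \<lambda>j\<in>L. p (t j)) ` injections L I" by blast
    qed
  qed
  from sum.reindex_bij_betw[OF this, symmetric]
  have "(\<Sum>t\<in>injections L J. F (\<lambda>j\<in>L. x (t j))) = (\<Sum>t\<in>injections L I. F (\<lambda>j\<in>L. x ((\<lambda>j\<in>L. p (t j)) j)))" .
  also have "\<dots> = (\<Sum>t\<in>injections L I. F (\<lambda>j\<in>L. (\<lambda>i\<in>I. x (p i)) (t j)))"
    by (intro sum.cong refl arg_cong[where f = F] restrict_ext) (auto simp: injections_def)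
  finally show "(\<Sum>t\<in>injections L I. F (\<lambda>j\<in>L. (\<lambda>i\<in>I. x (p i)) (t j))) = (\<Sum>t\<in>injections L J. F (\<lambda>j\<in>L. x (t j)))"
    by (rule sym)
qed

text \<open>By symmetry all \<open>fact m / fact n\<close> injections of \<open>L\<close> into
  \<open>m = card L + n\<close> indices contribute equally. Their number turns the weight
  \<open>1 / fact m\<close> into \<open>1 / fact n\<close>, the weight of \<open>n\<close> further
  points in the series on the right.\<close>

lemma poisson_mecke:
  assumes \<mu>: "finite_measure \<mu>" and \<Phi>: "configuration_functional \<mu> \<Phi>"
    and L: "L \<subseteq> {..<k}" and F [measurable]: "F \<in> borel_measurable (\<Pi>\<^sub>M j\<in>L. \<mu>)"
  shows "poisson_expectation 0 \<mu> (\<lambda>I x. (\<Sum>t\<in>injections L I. F (\<lambda>j\<in>L. x (t j))) * \<Phi> I x) =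
    (\<integral>\<^sup>+z. F z * poisson_expectation k \<mu> (\<lambda>I y. \<Phi> (L \<union> I) (merge L I (z, y))) \<partial>(\<Pi>\<^sub>M j\<in>L. \<mu>))"
proof -
  interpret finite_measure \<mu> by fact
  interpret product_sigma_finite "\<lambda>_. \<mu>"
    by (simp add: product_sigma_finite_def sigma_finite_measure_axioms)
  have fin: "finite L" using L finite_subset by blast
  define l where "l = card L"
  define w :: "nat \<Rightarrow> real" where "w n = exp (- measure \<mu> (space \<mu>)) / fact n" for n
  have w_nonneg: "0 \<le> w n" for n by (simp add: w_def)
  define J where "J n z = (\<integral>\<^sup>+y. \<Phi> (L \<union> {k..<k + n}) (merge L {k..<k + n} (z, y)) \<partial>(\<Pi>\<^sub>M j\<in>{k..<k + n}. \<mu>))" for n z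
  have dis: "L \<inter> {k..<k + n} = {}" for n using L by auto
  have M\<Phi> [measurable]: "\<Phi> (L \<union> {k..<k + n}) \<in> borel_measurable (\<Pi>\<^sub>M j\<in>L \<union> {k..<k + n}. \<mu>)" for n
    using fin by (intro configuration_functionalD(1)[OF \<Phi>]) auto
  have MJ [measurable]: "J n \<in> borel_measurable (\<Pi>\<^sub>M j\<in>L. \<mu>)" for n
  proof -
    interpret K: sigma_finite_measure "\<Pi>\<^sub>M j\<in>{k..<k + n}. \<mu>" by (rule sigma_finite) simp
    show ?thesis unfolding J_def by measurable
  qed
  define G where "G m = ennreal (w m) * (\<integral>\<^sup>+x. (\<Sum>t\<in>injections L {..<m}. F (\<lambda>j\<in>L. x (t j))) * \<Phi> {..<m} x \<partial>(\<Pi>\<^sub>M j\<in>{..<m}. \<mu>))" for m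
  have small: "G m = 0" if "m \<notin> range ((+) l)" for m
  proof -
    have "m < l" using that by (metis le_iff_add not_less rangeI)
    then have "injections L {..<m} = {}" by (intro injections_empty) (auto simp: l_def)
    then show ?thesis by (simp add: G_def)
  qed
  have G: "G (l + n) = ennreal (w n) * (\<integral>\<^sup>+z. F z * J n z \<partial>(\<Pi>\<^sub>M j\<in>L. \<mu>))" for n
  proof -
    let ?m = "l + n" and ?K = "{k..<k + n}"
    have one: "(\<integral>\<^sup>+x. F (\<lambda>j\<in>L. x (t j)) * \<Phi> {..<?m} x \<partial>(\<Pi>\<^sub>M j\<in>{..<?m}. \<mu>)) = (\<integral>\<^sup>+z. F z * J n z \<partial>(\<Pi>\<^sub>M j\<in>L. \<mu>))"
      if t: "t \<in> injections L {..<?m}" for t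
    proof -
      have tL: "inj_on t L" "t ` L \<subseteq> {..<?m}" using t by (auto simp: injections_def)
      have "card ({..<?m} - t ` L) = n"
        using tL fin by (simp add: card_Diff_subset card_image l_def)
      then obtain q where q: "bij_betw q ?K ({..<?m} - t ` L)"
        using finite_same_card_bij[of ?K "{..<?m} - t ` L"] by auto
      \<comment> \<open>The relabelling sends \<open>L\<close> to the indices chosen by
        \<open>t\<close> and \<open>?K\<close> to all others, so the chosen points become the
        variable \<open>z\<close> and the others become \<open>y\<close>.\<close>
      define p where "p j = (if j \<in> L then t j else q j)" for j
      have "bij_betw p (L \<union> ?K) (t ` L \<union> ({..<?m} - t ` L))"
      proof (rule bij_betw_combine)
        show "bij_betw p L (t ` L)"
          using tL by (simp add: bij_betw_def p_def inj_on_def)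
        have "q j = p j" if "j \<in> ?K" for j using dis[of n] that by (auto simp: p_def)
        then show "bij_betw p ?K ({..<?m} - t ` L)" using q bij_betw_cong[of ?K q p] by blast
      qed auto
      moreover have "t ` L \<union> ({..<?m} - t ` L) = {..<?m}" using tL by auto
      ultimately have p: "bij_betw p (L \<union> ?K) {..<?m}" by simp
      let ?F = "\<lambda>x. F (restrict x L) * \<Phi> (L \<union> ?K) x"
      have F' [measurable]: "?F \<in> borel_measurable (\<Pi>\<^sub>M j\<in>L \<union> ?K. \<mu>)"
        by (intro borel_measurable_times_ennreal measurable_compose[OF measurable_restrict_subset F]) auto
      have "(\<integral>\<^sup>+x. F (\<lambda>j\<in>L. x (t j)) * \<Phi> {..<?m} x \<partial>(\<Pi>\<^sub>M j\<in>{..<?m}. \<mu>)) =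
          (\<integral>\<^sup>+x. ?F (\<lambda>i\<in>L \<union> ?K. x (p i)) \<partial>(\<Pi>\<^sub>M j\<in>{..<?m}. \<mu>))"
      proof (intro nn_integral_cong)
        fix x assume x: "x \<in> space (\<Pi>\<^sub>M j\<in>{..<?m}. \<mu>)"
        have "restrict (\<lambda>i\<in>L \<union> ?K. x (p i)) L = (\<lambda>j\<in>L. x (t j))"
          by (auto simp: p_def fun_eq_iff)
        then show "F (\<lambda>j\<in>L. x (t j)) * \<Phi> {..<?m} x = ?F (\<lambda>i\<in>L \<union> ?K. x (p i))"
          using configuration_functionalD(2)[OF \<Phi> _ p x] fin by simp
      qed
      also have "\<dots> = (\<integral>\<^sup>+x. ?F x \<partial>(\<Pi>\<^sub>M j\<in>L \<union> ?K. \<mu>))"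
        using fin by (intro nn_integral_PiM_reindex[OF \<mu> _ p F']) auto
      also have "\<dots> = (\<integral>\<^sup>+z. \<integral>\<^sup>+y. ?F (merge L ?K (z, y)) \<partial>(\<Pi>\<^sub>M j\<in>?K. \<mu>) \<partial>(\<Pi>\<^sub>M j\<in>L. \<mu>))"
        using fin by (intro product_nn_integral_fold dis F') auto
      also have "\<dots> = (\<integral>\<^sup>+z. F z * J n z \<partial>(\<Pi>\<^sub>M j\<in>L. \<mu>))"
      proof (intro nn_integral_cong)
        fix z assume z: "z \<in> space (\<Pi>\<^sub>M j\<in>L. \<mu>)"
        have "restrict (merge L ?K (z, y)) L = z" for y
          using z by (auto simp: merge_def space_PiM PiE_iff extensional_def fun_eq_iff)
        then have "(\<integral>\<^sup>+y. ?F (merge L ?K (z, y)) \<partial>(\<Pi>\<^sub>M j\<in>?K. \<mu>)) =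
            (\<integral>\<^sup>+y. F z * \<Phi> (L \<union> ?K) (merge L ?K (z, y)) \<partial>(\<Pi>\<^sub>M j\<in>?K. \<mu>))"
          by simp
        also have "\<dots> = F z * J n z"
          unfolding J_def
        proof (rule nn_integral_cmult)
          have "(\<lambda>y. merge L ?K (z, y)) \<in> measurable (\<Pi>\<^sub>M j\<in>?K. \<mu>) (\<Pi>\<^sub>M j\<in>L \<union> ?K. \<mu>)"
            using z by (intro measurable_compose[OF measurable_Pair1' measurable_merge])
          then show "(\<lambda>y. \<Phi> (L \<union> ?K) (merge L ?K (z, y))) \<in> borel_measurable (\<Pi>\<^sub>M j\<in>?K. \<mu>)"
            by (rule measurable_compose) (rule M\<Phi>)
        qed
        finally show "(\<integral>\<^sup>+y. ?F (merge L ?K (z, y)) \<partial>(\<Pi>\<^sub>M j\<in>?K. \<mu>)) = F z * J n z" .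
      qed
      finally show ?thesis .
    qed
    have meas: "(\<lambda>x. F (\<lambda>j\<in>L. x (t j)) * \<Phi> {..<?m} x) \<in> borel_measurable (\<Pi>\<^sub>M j\<in>{..<?m}. \<mu>)"
      if t: "t \<in> injections L {..<?m}" for t
    proof (intro borel_measurable_times_ennreal configuration_functionalD(1)[OF \<Phi>] measurable_compose[OF _ F])
      show "(\<lambda>x. \<lambda>j\<in>L. x (t j)) \<in> measurable (\<Pi>\<^sub>M j\<in>{..<?m}. \<mu>) (\<Pi>\<^sub>M j\<in>L. \<mu>)"
        using t by (intro measurable_restrict measurable_component_singleton) (auto simp: injections_def)
    qed simp
    have "G ?m = ennreal (w ?m) * (\<Sum>t\<in>injections L {..<?m}. \<integral>\<^sup>+z. F z * J n z \<partial>(\<Pi>\<^sub>M j\<in>L. \<mu>))"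
      unfolding G_def sum_distrib_right by (subst nn_integral_sum[OF meas]) (auto simp: one)
    also have "\<dots> = ennreal (w ?m * real (card (injections L {..<?m}))) * (\<integral>\<^sup>+z. F z * J n z \<partial>(\<Pi>\<^sub>M j\<in>L. \<mu>))"
      by (subst ennreal_mult) (simp_all add: w_nonneg mult.assoc ennreal_of_nat_eq_real_of_nat)
    also have "w ?m * real (card (injections L {..<?m})) = w n"
    proof -
      have "card (injections L {..<?m}) * fact n = fact ?m"
        using card_injections[of L "{..<?m}"] fin by (simp add: l_def)
      then have "real (card (injections L {..<?m})) * fact n = fact ?m"
        by (metis of_nat_fact of_nat_mult)
      then show ?thesis by (simp add: w_def field_simps)
    qed
    finally show ?thesis .
  qed
  have "poisson_expectation 0 \<mu> (\<lambda>I x. (\<Sum>t\<in>injections L I. F (\<lambda>j\<in>L. x (t j))) * \<Phi> I x) = (\<Sum>m. G m)"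
    by (simp add: poisson_expectation_def G_def w_def atLeast0LessThan)
  \<comment> \<open>With fewer than \<open>l\<close> points there is no injection of
    \<open>L\<close>, so the omitted terms are 0.\<close>
  also have "\<dots> = (\<Sum>n. G (l + n))"
    by (rule suminf_mono_reindex[symmetric]) (auto simp: strict_mono_def small)
  also have "\<dots> = (\<Sum>n. \<integral>\<^sup>+z. F z * (ennreal (w n) * J n z) \<partial>(\<Pi>\<^sub>M j\<in>L. \<mu>))"
    unfolding G by (subst nn_integral_cmult[symmetric]) (simp_all add: mult.left_commute)
  also have "\<dots> = (\<integral>\<^sup>+z. (\<Sum>n. F z * (ennreal (w n) * J n z)) \<partial>(\<Pi>\<^sub>M j\<in>L. \<mu>))"
    by (rule nn_integral_suminf[symmetric]) measurable
  also have "\<dots> = (\<integral>\<^sup>+z. F z * poisson_expectation k \<mu> (\<lambda>I y. \<Phi> (L \<union> I) (merge L I (z, y))) \<partial>(\<Pi>\<^sub>M j\<in>L. \<mu>))"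
    unfolding poisson_expectation_def J_def w_def by simp
  finally show ?thesis .
qed

section \<open>Expectations over the process as Poisson series\<close>

context proper_poisson_process
begin

text \<open>The series is 0 where \<open>\<tau>\<close> is infinite, which makes the formula
  available before \<open>\<tau>\<close> is known to be finite. The case of the constant 1 then
  yields that finiteness.\<close>

lemma nn_integral_suminf_configuration_functional:
  assumes \<Phi>: "configuration_functional \<mu> \<Phi>"
  shows "(\<integral>\<^sup>+\<omega>. (\<Sum>n. if \<tau> \<omega> = enat n then \<Phi> {..<n} (\<lambda>j\<in>{..<n}. X j \<omega>) else 0) \<partial>M) = poisson_expectation 0 \<mu> \<Phi>"
proof -
  have [measurable]: "\<Phi> {..<n} \<in> borel_measurable (tuples n)" for n
    by (rule configuration_functionalD(1)[OF \<Phi>]) simp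
  have "(\<integral>\<^sup>+\<omega>. (\<Sum>n. if \<tau> \<omega> = enat n then \<Phi> {..<n} (\<lambda>j\<in>{..<n}. X j \<omega>) else 0) \<partial>M) =
      (\<Sum>n. \<integral>\<^sup>+\<omega>. (if \<tau> \<omega> = enat n then \<Phi> {..<n} (\<lambda>j\<in>{..<n}. X j \<omega>) else 0) \<partial>M)"
    by (rule nn_integral_suminf) measurable
  also have "\<dots> = (\<Sum>n. ennreal (exp (- measure \<mu> (space \<mu>)) / fact n) * (\<integral>\<^sup>+x. \<Phi> {..<n} x \<partial>tuples n))"
  proof (intro arg_cong[where f = suminf] ext nn_integral_symmetric)
    fix n x and s :: "nat \<Rightarrow> nat"
    assume x: "x \<in> space (tuples n)" and s: "s \<in> injections {..<n} {..<n}"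
    have "bij_betw s {..<n} {..<n}"
      using s injections_self_image[OF _ s] by (auto simp: bij_betw_def injections_def)
    from configuration_functionalD(2)[OF \<Phi> _ this x]
    show "\<Phi> {..<n} (\<lambda>j\<in>{..<n}. x (s j)) = \<Phi> {..<n} x" by simp
  qed simp
  finally show ?thesis by (simp add: poisson_expectation_def atLeast0LessThan)
qed

lemma AE_tau_finite: "AE \<omega> in M. \<tau> \<omega> \<noteq> \<infinity>"
proof -
  have "configuration_functional \<mu> (\<lambda>_ _. 1)" by (simp add: configuration_functional_def)
  from nn_integral_suminf_configuration_functional[OF this] have "(\<integral>\<^sup>+\<omega>. (\<Sum>n. if \<tau> \<omega> = enat n then 1 else 0) \<partial>M) = 1"
    by (simp add: poisson_expectation_1 finite_measure_axioms)
  also have "(\<lambda>\<omega>. (\<Sum>n. if \<tau> \<omega> = enat n then 1 else 0 :: ennreal)) = indicator {\<omega>. \<tau> \<omega> \<noteq> \<infinity>}"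
  proof
    fix \<omega>
    show "(\<Sum>n. if \<tau> \<omega> = enat n then 1 else 0 :: ennreal) = indicator {\<omega>. \<tau> \<omega> \<noteq> \<infinity>} \<omega>"
    proof (cases "\<tau> \<omega>")
      case (enat m)
      then have "(\<Sum>n. if \<tau> \<omega> = enat n then 1 else 0 :: ennreal) = (\<Sum>n. if n = m then 1 else 0)"
        by (intro arg_cong[where f = suminf]) auto
      then show ?thesis using enat ennreal_suminf_single[of m "\<lambda>_. 1"] by simp
    qed simp
  qed
  also have "(\<integral>\<^sup>+\<omega>. indicator {\<omega>. \<tau> \<omega> \<noteq> \<infinity>} \<omega> \<partial>M) = (\<integral>\<^sup>+\<omega>. indicator {\<omega> \<in> space M. \<tau> \<omega> \<noteq> \<infinity>} \<omega> \<partial>M)"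
    by (intro nn_integral_cong) (auto simp: indicator_def)
  also have "\<dots> = emeasure M {\<omega> \<in> space M. \<tau> \<omega> \<noteq> \<infinity>}"
    by (intro nn_integral_indicator) measurable
  finally have "P.prob {\<omega> \<in> space M. \<tau> \<omega> \<noteq> \<infinity>} = 1"
    by (simp add: P.emeasure_eq_measure)
  then show "AE \<omega> in M. \<tau> \<omega> \<noteq> \<infinity>"
    by (subst (asm) P.prob_Collect_eq_1) auto
qed

lemma nn_integral_configuration_functional:
  assumes \<Phi>: "configuration_functional \<mu> \<Phi>"
  shows "(\<integral>\<^sup>+\<omega>. \<Phi> (index_set (\<tau> \<omega>)) (\<lambda>i\<in>index_set (\<tau> \<omega>). X i \<omega>) \<partial>M) = poisson_expectation 0 \<mu> \<Phi>"
proof -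
  have "(\<integral>\<^sup>+\<omega>. \<Phi> (index_set (\<tau> \<omega>)) (\<lambda>i\<in>index_set (\<tau> \<omega>). X i \<omega>) \<partial>M) =
      (\<integral>\<^sup>+\<omega>. (\<Sum>n. if \<tau> \<omega> = enat n then \<Phi> {..<n} (\<lambda>j\<in>{..<n}. X j \<omega>) else 0) \<partial>M)"
  proof (rule nn_integral_cong_AE)
    show "AE \<omega> in M. \<Phi> (index_set (\<tau> \<omega>)) (\<lambda>i\<in>index_set (\<tau> \<omega>). X i \<omega>) =
        (\<Sum>n. if \<tau> \<omega> = enat n then \<Phi> {..<n} (\<lambda>j\<in>{..<n}. X j \<omega>) else 0)"
      using AE_tau_finite
    proof eventually_elim
      case (elim \<omega>)
      then obtain m where m: "\<tau> \<omega> = enat m" by auto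
      have "(\<Sum>n. if \<tau> \<omega> = enat n then \<Phi> {..<n} (\<lambda>j\<in>{..<n}. X j \<omega>) else 0) =
          (\<Sum>n. if n = m then \<Phi> {..<n} (\<lambda>j\<in>{..<n}. X j \<omega>) else 0)"
        by (intro arg_cong[where f = suminf]) (auto simp: m)
      then show ?case
        by (simp add: ennreal_suminf_single m index_set_def lessThan_def)
    qed
  qed
  also have "\<dots> = poisson_expectation 0 \<mu> \<Phi>" by (rule nn_integral_suminf_configuration_functional[OF \<Phi>])
  finally show ?thesis .
qed

end

section \<open>Poisson count vectors\<close>

lemma countable_nat_vectors: "countable (nat_vectors d)"
  unfolding nat_vectors_def by (intro countable_PiE) auto

lemma measurable_nat_vector:
  assumes "\<And>i. i < d \<Longrightarrow> f i \<in> measurable M (count_space (UNIV :: nat set))"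
  shows "(\<lambda>w. \<lambda>i\<in>{..<d}. f i w) \<in> measurable M (count_space (nat_vectors d))"
    and "(\<lambda>w. \<lambda>i\<in>{..<d}. f i w) \<in> measurable M (count_space UNIV)"
proof -
  have "(\<lambda>w. \<lambda>i\<in>{..<d}. f i w) \<in> measurable M (\<Pi>\<^sub>M i\<in>{..<d}. count_space (UNIV :: nat set))"
    using assms by (intro measurable_restrict) auto
  also have "(\<Pi>\<^sub>M i\<in>{..<d}. count_space (UNIV :: nat set)) = count_space (nat_vectors d)"
    unfolding nat_vectors_def by (intro count_space_PiM_finite) auto
  finally show 1: "(\<lambda>w. \<lambda>i\<in>{..<d}. f i w) \<in> measurable M (count_space (nat_vectors d))" .
  show "(\<lambda>w. \<lambda>i\<in>{..<d}. f i w) \<in> measurable M (count_space UNIV)"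
    by (rule measurable_compose[OF 1]) simp
qed

lemma count_vector_in_nat_vectors: "count_vector d A \<nu> \<in> nat_vectors d"
  by (simp add: count_vector_def nat_vectors_def)

lemma measurable_count_vector:
  assumes "\<And>i. i < d \<Longrightarrow> (\<lambda>w. emeasure (\<xi> w) (A i)) \<in> borel_measurable M"
  shows "(\<lambda>w. count_vector d A (\<xi> w)) \<in> measurable M (count_space (nat_vectors d))"
    and "(\<lambda>w. count_vector d A (\<xi> w)) \<in> measurable M (count_space UNIV)"
proof -
  have m: "(\<lambda>w. nat \<lfloor>measure (\<xi> w) (A i)\<rfloor>) \<in> measurable M (count_space UNIV)" if "i < d" for i
    using assms[OF that] unfolding measure_def by measurable
  show "(\<lambda>w. count_vector d A (\<xi> w)) \<in> measurable M (count_space (nat_vectors d))"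
    "(\<lambda>w. count_vector d A (\<xi> w)) \<in> measurable M (count_space UNIV)"
    unfolding count_vector_def by (rule measurable_nat_vector[OF m]; assumption)+
qed

text \<open>The Poisson weights already sum to 1, which leaves no mass for an infinite
  count.\<close>

lemma (in prob_space) poisson_process_counts_nat:
  assumes poisson: "poisson_process M S \<mu> \<eta>" and C: "C \<in> sets S" and fin: "emeasure \<mu> C < \<infinity>"
    and meas [measurable]: "(\<lambda>\<omega>. emeasure (\<eta> \<omega>) C) \<in> borel_measurable M"
  shows "AE \<omega> in M. \<exists>n. emeasure (\<eta> \<omega>) C = of_nat n"
proof -
  define E where "E n = {\<omega> \<in> space M. emeasure (\<eta> \<omega>) C = of_nat n}" for n :: nat
  have E [measurable]: "E n \<in> sets M" for n unfolding E_def by measurable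
  have sums: "(\<lambda>n. prob (E n)) sums prob (\<Union>n. E n)"
  proof (rule finite_measure_UNION)
    show "disjoint_family E" by (auto simp: disjoint_family_on_def E_def)
  qed auto
  have "prob (E n) = poisson_weight (measure \<mu> C) n" for n
    using poisson C fin unfolding poisson_process_def E_def poisson_weight_def by blast
  with sums have "poisson_weight (measure \<mu> C) sums prob (\<Union>n. E n)" by simp
  then have "prob (\<Union>n. E n) = 1" by (rule sums_unique2[OF _ poisson_weight_sums])
  then have "AE \<omega> in M. \<omega> \<in> (\<Union>n. E n)"
    by (intro AE_prob_1)
  then show ?thesis by eventually_elim (auto simp: E_def)
qed

text \<open>The Stein identity without error. The law of the count vector has product weights
  \<open>w\<close>, and raising coordinate \<open>i\<close> by one satisfies \<open>w (v(i := Suc (v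
  i))) * Suc (v i) = measure \<mu> (A i) * w v\<close>.\<close>

lemma (in prob_space) poisson_count_vector_identity:
  assumes poisson: "poisson_process M S \<mu> \<eta>" and A: "A \<in> disjoint_tuples d S"
    and fin: "\<And>i. i < d \<Longrightarrow> emeasure \<mu> (A i) < \<infinity>" and i: "i < d"
  defines "Z \<equiv> \<lambda>\<omega>. count_vector d A (\<eta> \<omega>)"
  shows "(\<integral>\<^sup>+\<omega>. ennreal (real (Z \<omega> i)) * G (Z \<omega>) \<partial>M) =
    ennreal (measure \<mu> (A i)) * (\<integral>\<^sup>+\<omega>. G ((Z \<omega>)(i := Suc (Z \<omega> i))) \<partial>M)"
proof -
  have A_sets: "A j \<in> sets S" if "j < d" for j using A that by (auto simp: disjoint_tuples_def)
  have disj: "disjoint_family_on A {..<d}" using A by (simp add: disjoint_tuples_def)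
  have "A \<in> {..<d} \<rightarrow> sets S" using A_sets by auto
  then have indep: "indep_vars (\<lambda>_. borel) (\<lambda>j \<omega>. emeasure (\<eta> \<omega>) (A j)) {..<d}"
    using poisson disj unfolding poisson_process_def by blast
  have meas: "(\<lambda>\<omega>. emeasure (\<eta> \<omega>) (A j)) \<in> borel_measurable M" if "j < d" for j
    using indep that by (auto simp: indep_vars_def)
  have Z: "Z \<in> measurable M (count_space (nat_vectors d))"
    unfolding Z_def by (rule measurable_count_vector(1)[OF meas])
  define w where "w v = (\<Prod>j<d. poisson_weight (measure \<mu> (A j)) (v j))" for v
  have w_nonneg: "0 \<le> w v" for v unfolding w_def by (intro prod_nonneg poisson_weight_nonneg ballI) simp
  have AE_nat: "AE \<omega> in M. \<forall>j\<in>{..<d}. \<exists>n. emeasure (\<eta> \<omega>) (A j) = of_nat n"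
    using poisson_process_counts_nat[OF poisson A_sets fin meas] by (intro AE_finite_allI) auto
  have distr: "distr M (count_space (nat_vectors d)) Z = density (count_space (nat_vectors d)) (\<lambda>v. ennreal (w v))"
  proof (rule measure_eqI_countable[of _ "nat_vectors d"])
    fix v assume v: "v \<in> nat_vectors d"
    have "emeasure (distr M (count_space (nat_vectors d)) Z) {v} = emeasure M (Z -` {v} \<inter> space M)"
      using v by (intro emeasure_distr Z) auto
    also have "\<dots> = emeasure M {\<omega> \<in> space M. \<forall>j<d. emeasure (\<eta> \<omega>) (A j) = of_nat (v j)}"
    proof (rule emeasure_eq_AE)
      show "AE \<omega> in M. \<omega> \<in> Z -` {v} \<inter> space M \<longleftrightarrow> \<omega> \<in> {\<omega> \<in> space M. \<forall>j<d. emeasure (\<eta> \<omega>) (A j) = of_nat (v j)}"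
        using AE_nat
      proof eventually_elim
        case (elim \<omega>)
        \<comment> \<open>At an infinite count \<open>measure\<close> is 0, so rounding recovers the
          count only where it is finite; \<open>AE_nat\<close> supplies this.\<close>
        have "nat \<lfloor>measure (\<eta> \<omega>) (A j)\<rfloor> = v j \<longleftrightarrow> emeasure (\<eta> \<omega>) (A j) = of_nat (v j)" if j: "j < d" for j
        proof -
          obtain n where "emeasure (\<eta> \<omega>) (A j) = of_nat n" using elim j by blast
          then show ?thesis by (simp add: measure_def ennreal_of_nat_eq_real_of_nat)
        qed
        moreover have "Z \<omega> = v \<longleftrightarrow> (\<forall>j<d. nat \<lfloor>measure (\<eta> \<omega>) (A j)\<rfloor> = v j)"
          using v unfolding Z_def count_vector_def nat_vectors_def
          by (auto simp: fun_eq_iff restrict_def PiE_iff extensional_def)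
        ultimately show ?case by auto
      qed
      show "Z -` {v} \<inter> space M \<in> sets M" using v by (intro measurable_sets[OF Z]) auto
      have "{\<omega> \<in> space M. \<forall>j\<in>{..<d}. emeasure (\<eta> \<omega>) (A j) = of_nat (v j)} \<in> sets M"
      proof (rule sets.sets_Collect_finite_All)
        fix j assume "j \<in> {..<d}"
        then have "(\<lambda>\<omega>. emeasure (\<eta> \<omega>) (A j)) \<in> borel_measurable M" using meas by simp
        from measurable_sets[OF this, of "{of_nat (v j)}"]
        show "{\<omega> \<in> space M. emeasure (\<eta> \<omega>) (A j) = of_nat (v j)} \<in> sets M"
          by (simp add: vimage_def Int_def conj_commute)
      qed simp
      then show "{\<omega> \<in> space M. \<forall>j<d. emeasure (\<eta> \<omega>) (A j) = of_nat (v j)} \<in> sets M"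
        by (simp only: Ball_def lessThan_iff)
    qed
    also have "\<dots> = ennreal (w v)"
      unfolding emeasure_eq_measure w_def poisson_weight_def
      using poisson_process_prob_counts[OF poisson A_sets fin disj, of v] i by simp
    also have "\<dots> = emeasure (density (count_space (nat_vectors d)) (\<lambda>v. ennreal (w v))) {v}"
      using v by (simp add: emeasure_density nn_integral_count_space_indicator[symmetric] nn_integral_indicator_singleton')
    finally show "emeasure (distr M (count_space (nat_vectors d)) Z) {v} =
        emeasure (density (count_space (nat_vectors d)) (\<lambda>v. ennreal (w v))) {v}" .
  qed (simp_all add: countable_nat_vectors)
  have expect: "(\<integral>\<^sup>+\<omega>. F (Z \<omega>) \<partial>M) = (\<integral>\<^sup>+v. ennreal (w v) * F v \<partial>count_space (nat_vectors d))" for F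
  proof -
    have "(\<integral>\<^sup>+\<omega>. F (Z \<omega>) \<partial>M) = (\<integral>\<^sup>+v. F v \<partial>distr M (count_space (nat_vectors d)) Z)"
      by (rule nn_integral_distr[symmetric, OF Z]) simp
    also have "\<dots> = (\<integral>\<^sup>+v. ennreal (w v) * F v \<partial>count_space (nat_vectors d))"
      unfolding distr by (rule nn_integral_density) auto
    finally show ?thesis .
  qed
  let ?s = "\<lambda>v. v(i := Suc (v i))"
  let ?H = "\<lambda>v. ennreal (w v) * (ennreal (real (v i)) * G v)"
  \<comment> \<open>Vectors with \<open>v i = 0\<close> drop out because of the factor
    \<open>v i\<close>; the remaining ones are exactly the images of the shift
    \<open>?s\<close>.\<close>
  let ?B = "{v \<in> nat_vectors d. v i \<noteq> 0}"
  have bij: "bij_betw ?s (nat_vectors d) ?B"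
  proof (rule bij_betw_byWitness[where f' = "\<lambda>v. v(i := v i - 1)"])
  qed (use i in \<open>auto simp: nat_vectors_upd fun_eq_iff\<close>)
  have "(\<integral>\<^sup>+\<omega>. ennreal (real (Z \<omega> i)) * G (Z \<omega>) \<partial>M) = (\<integral>\<^sup>+v. ?H v \<partial>count_space (nat_vectors d))"
    by (rule expect)
  also have "\<dots> = (\<integral>\<^sup>+v. ?H v \<partial>count_space ?B)"
    by (rule nn_integral_count_space_eq) auto
  also have "\<dots> = (\<integral>\<^sup>+v. ?H (?s v) \<partial>count_space (nat_vectors d))"
    by (rule nn_integral_bij_count_space[OF bij, symmetric])
  also have "\<dots> = (\<integral>\<^sup>+v. ennreal (measure \<mu> (A i)) * (ennreal (w v) * G (?s v)) \<partial>count_space (nat_vectors d))"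
  proof (rule nn_integral_cong)
    fix v
    have split: "w v = poisson_weight (measure \<mu> (A i)) (v i) * (\<Prod>j\<in>{..<d} - {i}. poisson_weight (measure \<mu> (A j)) (v j))" for v
      unfolding w_def using i by (intro prod.remove) auto
    have "(\<Prod>j\<in>{..<d} - {i}. poisson_weight (measure \<mu> (A j)) (?s v j)) =
        (\<Prod>j\<in>{..<d} - {i}. poisson_weight (measure \<mu> (A j)) (v j))"
      by (intro prod.cong) auto
    then have "w (?s v) * real (Suc (v i)) = measure \<mu> (A i) * w v"
      using poisson_weight_Suc[of "v i" "measure \<mu> (A i)"] unfolding split[of v] split[of "?s v"]
      by (simp add: ac_simps)
    then have "ennreal (w (?s v)) * ennreal (real (Suc (v i))) = ennreal (measure \<mu> (A i)) * ennreal (w v)"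
      using w_nonneg by (simp add: ennreal_mult[symmetric] del: of_nat_Suc)
    then show "?H (?s v) = ennreal (measure \<mu> (A i)) * (ennreal (w v) * G (?s v))"
      by (simp add: mult.assoc[symmetric] del: of_nat_Suc)
  qed
  also have "\<dots> = ennreal (measure \<mu> (A i)) * (\<integral>\<^sup>+v. ennreal (w v) * G (?s v) \<partial>count_space (nat_vectors d))"
    by (rule nn_integral_cmult) simp
  also have "\<dots> = ennreal (measure \<mu> (A i)) * (\<integral>\<^sup>+\<omega>. G (?s (Z \<omega>)) \<partial>M)"
    unfolding expect[of "\<lambda>v. G (?s v)"] ..
  finally show ?thesis .
qed

section \<open>Counting tuples in a union of configurations\<close>

lemma distinct_tuples_in_eq:
  "distinct_tuples_in k I x D = {s \<in> injections {..<k} I. (\<lambda>j\<in>{..<k}. x (s j)) \<in> D}"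
  by (auto simp: distinct_tuples_in_def injections_def)

lemma finite_distinct_tuples_in [simp]: "finite I \<Longrightarrow> finite (distinct_tuples_in k I x D)"
  by (simp add: distinct_tuples_in_eq)

lemma card_distinct_tuples_in:
  assumes "finite I"
  shows "(of_nat (card (distinct_tuples_in k I x D)) :: ennreal) =
    (\<Sum>s\<in>injections {..<k} I. indicator D (\<lambda>j\<in>{..<k}. x (s j)))"
proof -
  have "(\<Sum>s\<in>injections {..<k} I. indicator D (\<lambda>j\<in>{..<k}. x (s j)) :: ennreal) =
      (\<Sum>s\<in>injections {..<k} I. if (\<lambda>j\<in>{..<k}. x (s j)) \<in> D then 1 else 0)"
    by (intro sum.cong) (auto simp: indicator_def)
  also have "\<dots> = (\<Sum>s\<in>distinct_tuples_in k I x D. 1)"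
    unfolding distinct_tuples_in_eq using assms by (intro sum.inter_filter[symmetric]) simp
  finally show ?thesis by simp
qed

lemma configuration_functional_tuple_count:
  fixes k :: nat
  assumes "D \<in> sets (\<Pi>\<^sub>M j\<in>{..<k}. \<mu>)"
  shows "configuration_functional \<mu> (\<lambda>I x. \<Sum>s\<in>injections {..<k} I. indicator D (\<lambda>j\<in>{..<k}. x (s j)))"
  using assms by (intro configuration_functional_sum_injections) auto

lemma configuration_functional_count_vector:
  fixes d k :: nat
  assumes D: "\<And>i. i < d \<Longrightarrow> D i \<in> sets (\<Pi>\<^sub>M j\<in>{..<k}. \<mu>)"
  shows "configuration_functional \<mu> (\<lambda>I x. G (\<lambda>i\<in>{..<d}. card (distinct_tuples_in k I x (D i)) div fact k))"
  unfolding configuration_functional_def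
proof (intro conjI allI impI)
  fix I :: "nat set" assume I: "finite I"
  have "(\<lambda>x. \<lambda>i\<in>{..<d}. card (distinct_tuples_in k I x (D i)) div fact k) \<in> measurable (\<Pi>\<^sub>M i\<in>I. \<mu>) (count_space UNIV)"
  proof (rule measurable_nat_vector(2))
    fix i assume i: "i < d"
    have m: "(\<lambda>x. of_nat (card (distinct_tuples_in k I x (D i))) :: ennreal) \<in> borel_measurable (\<Pi>\<^sub>M i\<in>I. \<mu>)"
      unfolding card_distinct_tuples_in[OF I]
      by (rule configuration_functionalD(1)[OF configuration_functional_tuple_count[OF D[OF i]] I])
    then have "(\<lambda>x. nat \<lfloor>enn2real (of_nat (card (distinct_tuples_in k I x (D i))))\<rfloor> div fact k)
        \<in> measurable (\<Pi>\<^sub>M i\<in>I. \<mu>) (count_space UNIV)"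
      by measurable
    then show "(\<lambda>x. card (distinct_tuples_in k I x (D i)) div fact k) \<in> measurable (\<Pi>\<^sub>M i\<in>I. \<mu>) (count_space UNIV)"
      by simp
  qed
  then show "(\<lambda>x. G (\<lambda>i\<in>{..<d}. card (distinct_tuples_in k I x (D i)) div fact k)) \<in> borel_measurable (\<Pi>\<^sub>M i\<in>I. \<mu>)"
    by (rule measurable_compose) simp
next
  fix I J :: "nat set" and p x
  assume I: "finite I" and p: "bij_betw p I J" and x: "x \<in> space (\<Pi>\<^sub>M j\<in>J. \<mu>)"
  have J: "finite J" using p I bij_betw_finite by blast
  have "card (distinct_tuples_in k I (\<lambda>i\<in>I. x (p i)) (D i)) = card (distinct_tuples_in k J x (D i))" if "i < d" for i
  proof -
    have "(of_nat (card (distinct_tuples_in k I (\<lambda>i\<in>I. x (p i)) (D i))) :: ennreal) =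
        of_nat (card (distinct_tuples_in k J x (D i)))"
      unfolding card_distinct_tuples_in[OF I] card_distinct_tuples_in[OF J]
      by (rule configuration_functionalD(2)[OF configuration_functional_tuple_count[OF D[OF that]] I p x])
    then show ?thesis by simp
  qed
  then have "(\<lambda>i\<in>{..<d}. card (distinct_tuples_in k I (\<lambda>i\<in>I. x (p i)) (D i)) div fact k) =
      (\<lambda>i\<in>{..<d}. card (distinct_tuples_in k J x (D i)) div fact k)"
    by (intro restrict_ext) simp
  then show "G (\<lambda>i\<in>{..<d}. card (distinct_tuples_in k I (\<lambda>i\<in>I. x (p i)) (D i)) div fact k) =
      G (\<lambda>i\<in>{..<d}. card (distinct_tuples_in k J x (D i)) div fact k)" by simp
qed

section \<open>Tuples mixing added points with points of the configuration\<close>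

definition proper_parts :: "nat \<Rightarrow> nat set set" where
  "proper_parts k = {J. J \<subseteq> {..<k} \<and> J \<noteq> {} \<and> J \<noteq> {..<k}}"

lemma finite_proper_parts [simp]: "finite (proper_parts k)"
  by (rule finite_subset[of _ "Pow {..<k}"]) (auto simp: proper_parts_def)

lemma card_proper_parts_le: "card (proper_parts k) \<le> 2 ^ k"
proof -
  have "card (proper_parts k) \<le> card (Pow {..<k})"
    by (intro card_mono) (auto simp: proper_parts_def)
  then show ?thesis by (simp add: card_Pow)
qed

text \<open>For \<open>J = {..<i}\<close> with \<open>i \<le> k\<close> this is the inner integral
  in \<open>R_bound\<close>. It reads only the coordinates of \<open>z\<close> in \<open>J\<close>,
  so it can be used on the product over \<open>J\<close> as well as on the full one.\<close>

definition section_mass :: "nat \<Rightarrow> 'a measure \<Rightarrow> (nat \<Rightarrow> 'a) set \<Rightarrow> nat set \<Rightarrow> (nat \<Rightarrow> 'a) \<Rightarrow> ennreal" where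
  "section_mass k \<mu> D J z =
    (\<integral>\<^sup>+u. indicator D (merge J ({..<k} - J) (z, u)) \<partial>(\<Pi>\<^sub>M j\<in>{..<k} - J. \<mu>))"

text \<open>Only tuples that carry \<open>z j\<close> at position \<open>j\<close>, for
  \<open>j\<close> in \<open>J\<close>, are counted. Symmetry of \<open>D\<close> allows every mixed
  tuple to be permuted into this form, so it is enough to range over the sets
  \<open>J\<close>.\<close>

definition mixed_count :: "nat \<Rightarrow> (nat \<Rightarrow> 'a) set \<Rightarrow> nat set \<Rightarrow> (nat \<Rightarrow> 'a) \<Rightarrow> nat set \<Rightarrow> (nat \<Rightarrow> 'a) \<Rightarrow> ennreal" where
  "mixed_count k D J z I y = (\<Sum>t\<in>injections ({..<k} - J) I.
    indicator D (merge J ({..<k} - J) (z, \<lambda>j\<in>{..<k} - J. y (t j))))"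

lemma merge_restrict_fst: "merge J K (restrict z J, u) = merge J K (z, u)"
  by (auto simp: merge_def fun_eq_iff)

lemma merge_merge_fst: "merge J K (merge J L (a, b), u) = merge J K (a, u)"
  by (auto simp: merge_def fun_eq_iff)

lemma permutation_extending_injection:
  fixes k :: nat
  assumes t: "inj_on t L" "t ` L \<subseteq> {..<k}" and L: "L \<subseteq> {..<k}"
  shows "\<exists>p. p permutes {..<k} \<and> (\<forall>j\<in>L. p j = t j)"
proof -
  have fin: "finite L" by (rule finite_subset[OF L]) simp
  have "card ({..<k} - L) = card ({..<k} - t ` L)"
    using t L fin by (simp add: card_Diff_subset card_image)
  then obtain q where q: "bij_betw q ({..<k} - L) ({..<k} - t ` L)"
    using finite_same_card_bij[of "{..<k} - L" "{..<k} - t ` L"] by auto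
  define p where "p j = (if j \<in> L then t j else if j < k then q j else j)" for j
  have "bij_betw p (L \<union> ({..<k} - L)) (t ` L \<union> ({..<k} - t ` L))"
  proof (rule bij_betw_combine)
    show "bij_betw p L (t ` L)" using t by (simp add: bij_betw_def p_def inj_on_def)
    have "q j = p j" if "j \<in> {..<k} - L" for j using that by (auto simp: p_def)
    then show "bij_betw p ({..<k} - L) ({..<k} - t ` L)" using q bij_betw_cong[of "{..<k} - L" q p] by blast
  qed auto
  moreover have "L \<union> ({..<k} - L) = {..<k}" "t ` L \<union> ({..<k} - t ` L) = {..<k}" using t L by auto
  ultimately have "bij_betw p {..<k} {..<k}" by simp
  then have "p permutes {..<k}"
    using L by (intro bij_imp_permutes) (auto simp: p_def)
  then show ?thesis by (intro exI[of _ p]) (simp add: p_def)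
qed

lemma symmetric_set_comp_iff:
  assumes "symmetric_set k D" "p permutes {..<k}"
  shows "x \<circ> p \<in> D \<longleftrightarrow> x \<in> D"
proof
  assume "x \<circ> p \<in> D"
  then have "(x \<circ> p) \<circ> inv p \<in> D"
    using assms permutes_inv unfolding symmetric_set_def by blast
  then show "x \<in> D" using permutes_inv_o(1)[OF assms(2)] by (simp add: o_assoc[symmetric])
qed (use assms in \<open>auto simp: symmetric_set_def\<close>)

lemma injection_self_permutes:
  fixes k :: nat
  assumes "s \<in> injections {..<k} {..<k}"
  shows "(\<lambda>j. if j < k then s j else j) permutes {..<k}"
proof (rule bij_imp_permutes)
  have "bij_betw s {..<k} {..<k}"
    using assms injections_self_image[OF _ assms] by (auto simp: bij_betw_def injections_def)
  then show "bij_betw (\<lambda>j. if j < k then s j else j) {..<k} {..<k}"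
    by (subst bij_betw_cong[of _ _ s]) auto
qed auto

text \<open>The entries of the mixed tuple are permuted until every coordinate taken from
  \<open>z\<close> stands at its own position; symmetry keeps the tuple in \<open>D\<close>.\<close>

lemma mixed_tuple_exists:
  assumes D: "symmetric_set k D" and I: "I \<inter> {..<k} = {}" and z: "z \<in> extensional {..<k}"
    and s: "s \<in> distinct_tuples_in k ({..<k} \<union> I) (merge {..<k} I (z, y)) D"
    and mixed: "\<not> s ` {..<k} \<subseteq> I" "\<not> s ` {..<k} \<subseteq> {..<k}"
  shows "\<exists>J\<in>proper_parts k. \<exists>t\<in>injections ({..<k} - J) I.
    merge J ({..<k} - J) (z, \<lambda>j\<in>{..<k} - J. y (t j)) \<in> D"
proof -
  let ?w = "merge {..<k} I (z, y)"
  have sI: "s j \<in> {..<k} \<union> I" if "j < k" for j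
    using s that by (auto simp: distinct_tuples_in_def PiE_iff)
  have inj: "inj_on s {..<k}" using s by (simp add: distinct_tuples_in_def)
  define L where "L = {j \<in> {..<k}. s j < k}"
  define J where "J = s ` L"
  have L: "L \<subseteq> {..<k}" by (auto simp: L_def)
  have injL: "inj_on s L" using inj L by (rule inj_on_subset)
  have J: "J \<subseteq> {..<k}" by (auto simp: J_def L_def)
  have "J \<noteq> {}" using mixed(1) sI by (auto simp: J_def L_def)
  moreover have "J \<noteq> {..<k}"
  proof
    assume "J = {..<k}"
    then have "card L = k" using card_image[OF injL] by (simp add: J_def)
    then have "L = {..<k}" using L by (intro card_subset_eq) auto
    then show False using mixed(2) by (auto simp: L_def)
  qed
  ultimately have JP: "J \<in> proper_parts k" using J by (auto simp: proper_parts_def)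
  \<comment> \<open>\<open>L\<close> holds the positions that \<open>s\<close> fills from
    \<open>z\<close>, and \<open>J\<close> the coordinates of \<open>z\<close> used there. Extending
    the inverse of \<open>s\<close> on \<open>J\<close> to a permutation \<open>p\<close> gives
    \<open>s (p j) = j\<close> on \<open>J\<close>.\<close>
  have "inj_on (inv_into L s) J" unfolding J_def by (rule inj_on_inv_into) simp
  moreover have "inv_into L s ` J \<subseteq> {..<k}" using L by (auto simp: J_def inv_into_into subset_iff injL)
  ultimately obtain p where p: "p permutes {..<k}" "\<forall>j\<in>J. p j = inv_into L s j"
    using permutation_extending_injection[OF _ _ J] by blast
  have pJ: "s (p j) = j" if "j \<in> J" for j
  proof -
    have "p j = inv_into L s j" using p(2) that by blast
    then show ?thesis using f_inv_into_f[of j s L] that by (simp add: J_def)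
  qed
  have pk: "p j < k" if "j < k" for j using permutes_in_image[OF p(1), of j] that by simp
  have pnJ: "s (p j) \<in> I" if "j \<in> {..<k} - J" for j
  proof (rule ccontr)
    assume "s (p j) \<notin> I"
    then have "s (p j) < k" using sI[OF pk] that by auto
    then have "p j \<in> L" using pk that by (auto simp: L_def)
    then have "s (p j) \<in> J" by (simp add: J_def)
    then have "s (p (s (p j))) = s (p j)" by (rule pJ)
    moreover have "s (p j) < k" by fact
    ultimately have "p (s (p j)) = p j" using inj pk that by (auto dest: inj_onD)
    then have "s (p j) = j" using permutes_inj[OF p(1)] by (auto dest: injD)
    then show False using \<open>s (p j) \<in> J\<close> that by simp
  qed
  define t where "t = (\<lambda>j\<in>{..<k} - J. s (p j))"
  have "inj_on (s \<circ> p) {..<k}"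
    using permutes_image[OF p(1)] permutes_inj_on[OF p(1)] inj by (intro comp_inj_on) auto
  then have "inj_on (\<lambda>j. s (p j)) ({..<k} - J)"
    by (auto simp: inj_on_def)
  then have "t \<in> injections ({..<k} - J) I"
    using pnJ by (auto simp: t_def injections_def)
  moreover have "merge J ({..<k} - J) (z, \<lambda>j\<in>{..<k} - J. y (t j)) = (\<lambda>j\<in>{..<k}. ?w (s j)) \<circ> p"
  proof
    fix j
    consider "j \<in> J" | "j \<in> {..<k} - J" | "j \<notin> {..<k}" using J by auto
    then show "merge J ({..<k} - J) (z, \<lambda>j\<in>{..<k} - J. y (t j)) j = ((\<lambda>j\<in>{..<k}. ?w (s j)) \<circ> p) j"
    proof cases
      case 1
      then have "j < k" using J by auto
      then show ?thesis using 1 pJ[OF 1] pk[of j] by (auto simp: merge_def)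
    next
      case 2
      then have "s (p j) \<notin> {..<k}" using pnJ[OF 2] I by auto
      then show ?thesis using 2 pnJ[OF 2] pk[of j] by (auto simp: merge_def t_def)
    next
      case 3
      then have "p j = j" using p(1) by (auto simp: permutes_def)
      then show ?thesis using 3 J by (auto simp: merge_def)
    qed
  qed
  moreover have "(\<lambda>j\<in>{..<k}. ?w (s j)) \<circ> p \<in> D"
    using s p(1) D by (auto simp: distinct_tuples_in_def symmetric_set_def)
  ultimately show ?thesis using JP by (intro bexI[of _ J] bexI[of _ t]) simp_all
qed

text \<open>Without mixed tuples each tuple comes from \<open>y\<close> alone or is a permutation of
  \<open>z\<close>; by symmetry either all \<open>fact k\<close> permutations of \<open>z\<close>
  lie in \<open>D'\<close> or none does.\<close>

lemma card_distinct_tuples_in_merge: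
  assumes D': "symmetric_set k D'" and I: "I \<inter> {..<k} = {}" "finite I" and k: "0 < k"
    and z: "z \<in> extensional {..<k}"
    and no_mixed: "\<And>J t. J \<in> proper_parts k \<Longrightarrow> t \<in> injections ({..<k} - J) I \<Longrightarrow>
      merge J ({..<k} - J) (z, \<lambda>j\<in>{..<k} - J. y (t j)) \<notin> D'"
  shows "card (distinct_tuples_in k ({..<k} \<union> I) (merge {..<k} I (z, y)) D') =
    card (distinct_tuples_in k I y D') + (if z \<in> D' then fact k else 0)"
proof -
  let ?w = "merge {..<k} I (z, y)"
  let ?T = "{s \<in> injections {..<k} {..<k}. (\<lambda>j\<in>{..<k}. z (s j)) \<in> D'}"
  have wI: "(\<lambda>j\<in>{..<k}. ?w (s j)) = (\<lambda>j\<in>{..<k}. y (s j))" if "s \<in> {..<k} \<rightarrow> I" for s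
    using that I by (intro restrict_ext) (auto simp: merge_def Pi_iff)
  have wk: "(\<lambda>j\<in>{..<k}. ?w (s j)) = (\<lambda>j\<in>{..<k}. z (s j))" if "s \<in> {..<k} \<rightarrow> {..<k}" for s
    using that by (intro restrict_ext) (auto simp: merge_def Pi_iff)
  have "distinct_tuples_in k ({..<k} \<union> I) ?w D' = distinct_tuples_in k I y D' \<union> ?T"
  proof (intro equalityI subsetI)
    fix s assume s: "s \<in> distinct_tuples_in k ({..<k} \<union> I) ?w D'"
    have "s ` {..<k} \<subseteq> I \<or> s ` {..<k} \<subseteq> {..<k}"
      using mixed_tuple_exists[OF D' I(1) z s] no_mixed by blast
    then show "s \<in> distinct_tuples_in k I y D' \<union> ?T"
    proof
      assume "s ` {..<k} \<subseteq> I"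
      then have "s \<in> {..<k} \<rightarrow> I" by auto
      then show ?thesis using s wI[of s] by (auto simp: distinct_tuples_in_def PiE_iff)
    next
      assume "s ` {..<k} \<subseteq> {..<k}"
      then have "s \<in> {..<k} \<rightarrow> {..<k}" by auto
      then show ?thesis using s wk[of s] by (auto simp: distinct_tuples_in_eq injections_def PiE_iff)
    qed
  next
    fix s assume "s \<in> distinct_tuples_in k I y D' \<union> ?T"
    then show "s \<in> distinct_tuples_in k ({..<k} \<union> I) ?w D'"
    proof
      assume "s \<in> distinct_tuples_in k I y D'"
      then show ?thesis using wI[of s] by (auto simp: distinct_tuples_in_def PiE_iff)
    next
      assume "s \<in> ?T"
      then show ?thesis using wk[of s] by (auto simp: distinct_tuples_in_eq injections_def PiE_iff)
    qed
  qed
  \<comment> \<open>Positivity of \<open>k\<close> matters here: an empty tuple would belong to both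
    parts.\<close>
  moreover have "distinct_tuples_in k I y D' \<inter> ?T = {}"
  proof -
    have False if "s \<in> distinct_tuples_in k I y D'" "s \<in> ?T" for s
      using that k I(1) by (auto simp: distinct_tuples_in_def injections_def PiE_iff)
    then show ?thesis by auto
  qed
  ultimately have "card (distinct_tuples_in k ({..<k} \<union> I) ?w D') = card (distinct_tuples_in k I y D') + card ?T"
    using I by (simp add: card_Un_disjoint)
  moreover have "?T = (if z \<in> D' then injections {..<k} {..<k} else {})"
  proof -
    have "(\<lambda>j\<in>{..<k}. z (s j)) \<in> D' \<longleftrightarrow> z \<in> D'" if s: "s \<in> injections {..<k} {..<k}" for s
    proof -
      have "(\<lambda>j\<in>{..<k}. z (s j)) = z \<circ> (\<lambda>j. if j < k then s j else j)"
        using z by (auto simp: fun_eq_iff extensional_def)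
      then show ?thesis
        using symmetric_set_comp_iff[OF D' injection_self_permutes[OF s], of z] by simp
    qed
    then show ?thesis by auto
  qed
  moreover have "card (injections {..<k} {..<k} :: (nat \<Rightarrow> nat) set) = fact k"
    using card_injections[of "{..<k}" "{..<k}"] by simp
  ultimately show ?thesis by simp
qed

section \<open>Section masses and their bound by R\<close>

lemma measurable_merge_section:
  assumes "J \<subseteq> {..<k}"
  shows "merge J ({..<k} - J) \<in> measurable ((\<Pi>\<^sub>M j\<in>J. \<mu>) \<Otimes>\<^sub>M (\<Pi>\<^sub>M j\<in>{..<k} - J. \<mu>)) (\<Pi>\<^sub>M j\<in>{..<k}. \<mu>)"
proof -
  have "J \<union> ({..<k} - J) = {..<k}" using assms by auto
  then show ?thesis using measurable_merge[of J "{..<k} - J" "\<lambda>_. \<mu>"] by simp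
qed

lemma borel_measurable_section_mass:
  assumes \<mu>: "finite_measure \<mu>" and D: "D \<in> sets (\<Pi>\<^sub>M j\<in>{..<k}. \<mu>)" and J: "J \<subseteq> {..<k}"
  shows "section_mass k \<mu> D J \<in> borel_measurable (\<Pi>\<^sub>M j\<in>J. \<mu>)"
    and "section_mass k \<mu> D J \<in> borel_measurable (\<Pi>\<^sub>M j\<in>{..<k}. \<mu>)"
proof -
  interpret finite_measure \<mu> by fact
  interpret product_sigma_finite "\<lambda>_. \<mu>"
    by (simp add: product_sigma_finite_def sigma_finite_measure_axioms)
  interpret K: sigma_finite_measure "\<Pi>\<^sub>M j\<in>{..<k} - J. \<mu>" by (rule sigma_finite) simp
  note [measurable] = measurable_merge_section[OF J] D
  show 1: "section_mass k \<mu> D J \<in> borel_measurable (\<Pi>\<^sub>M j\<in>J. \<mu>)"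
    unfolding section_mass_def by measurable
  have "(\<lambda>z. section_mass k \<mu> D J (restrict z J)) \<in> borel_measurable (\<Pi>\<^sub>M j\<in>{..<k}. \<mu>)"
    by (rule measurable_compose[OF measurable_restrict_subset[OF J] 1])
  then show "section_mass k \<mu> D J \<in> borel_measurable (\<Pi>\<^sub>M j\<in>{..<k}. \<mu>)"
    unfolding section_mass_def merge_restrict_fst .
qed

text \<open>\<open>R_bound\<close> involves only the initial segments \<open>{..<i}\<close>; a
  permutation carrying such a segment to \<open>J\<close> maps the sections of the symmetric set
  \<open>D\<close> onto each other.\<close>

lemma section_mass_reindex:
  assumes \<mu>: "finite_measure \<mu>" and D: "D \<in> sets (\<Pi>\<^sub>M j\<in>{..<k}. \<mu>)" and sym: "symmetric_set k D"
    and p: "p permutes {..<k}" and i: "i \<le> k" and J: "p ` {..<i} = J" and a: "a \<in> space (\<Pi>\<^sub>M j\<in>J. \<mu>)"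
  shows "section_mass k \<mu> D {..<i} (\<lambda>j\<in>{..<i}. a (p j)) = section_mass k \<mu> D J a"
proof -
  let ?K = "{..<k} - {..<i}"
  have Jk: "J \<subseteq> {..<k}" using permutes_image[OF p] J i by (metis image_mono lessThan_subset_iff)
  have inj: "inj p" by (rule permutes_inj[OF p])
  have pK: "p ` ?K = {..<k} - J"
    using permutes_image[OF p] J unfolding image_set_diff[OF inj] by simp
  have bij: "bij_betw p ?K ({..<k} - J)"
    using inj pK by (simp add: bij_betw_def inj_on_subset[OF inj])
  let ?b = "\<lambda>j\<in>{..<i}. a (p j)"
  have meas: "(\<lambda>v. indicator D (merge {..<i} ?K (?b, v)) :: ennreal) \<in> borel_measurable (\<Pi>\<^sub>M j\<in>?K. \<mu>)"
  proof -
    have b: "?b \<in> space (\<Pi>\<^sub>M j\<in>{..<i}. \<mu>)" using a J by (auto simp: space_PiM PiE_iff)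
    have "(\<lambda>v. merge {..<i} ?K (?b, v)) \<in> measurable (\<Pi>\<^sub>M j\<in>?K. \<mu>) (\<Pi>\<^sub>M j\<in>{..<k}. \<mu>)"
      using i by (intro measurable_compose[OF measurable_Pair1'[OF b] measurable_merge_section]) auto
    then show ?thesis using D by measurable
  qed
  have eq: "merge {..<i} ?K (?b, \<lambda>j\<in>?K. u (p j)) = merge J ({..<k} - J) (a, u) \<circ> p" for u
  proof
    fix j
    have mem: "p j \<in> J \<longleftrightarrow> j < i" using J inj by (auto simp: inj_def image_iff)
    have memk: "p j < k \<longleftrightarrow> j < k" using permutes_in_image[OF p, of j] by simp
    show "merge {..<i} ?K (?b, \<lambda>j\<in>?K. u (p j)) j = (merge J ({..<k} - J) (a, u) \<circ> p) j"
      using mem memk by (auto simp: merge_def)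
  qed
  have "section_mass k \<mu> D {..<i} ?b =
      (\<integral>\<^sup>+u. indicator D (merge {..<i} ?K (?b, \<lambda>j\<in>?K. u (p j))) \<partial>(\<Pi>\<^sub>M j\<in>{..<k} - J. \<mu>))"
    unfolding section_mass_def by (rule nn_integral_PiM_reindex[OF \<mu> _ bij meas, symmetric]) simp
  also have "\<dots> = section_mass k \<mu> D J a"
    unfolding section_mass_def eq
    by (intro nn_integral_cong) (simp add: indicator_def symmetric_set_comp_iff[OF sym p])
  finally show ?thesis .
qed

text \<open>Source of the square in \<open>R_bound\<close>: the section mass depends on the
  coordinates in \<open>J\<close> alone, and integrating the indicator of \<open>D\<close> over the
  other coordinates produces the same section mass a second time.\<close>

lemma nn_integral_section_mass_le_R_bound:
  assumes \<mu>: "finite_measure \<mu>" and D: "D \<in> sets (\<Pi>\<^sub>M j\<in>{..<k}. \<mu>)" and sym: "symmetric_set k D"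
    and J: "J \<in> proper_parts k"
  shows "(\<integral>\<^sup>+z. indicator D z * section_mass k \<mu> D J z \<partial>(\<Pi>\<^sub>M j\<in>{..<k}. \<mu>)) \<le> R_bound k \<mu> D"
proof -
  interpret finite_measure \<mu> by fact
  interpret product_sigma_finite "\<lambda>_. \<mu>"
    by (simp add: product_sigma_finite_def sigma_finite_measure_axioms)
  have Jk: "J \<subseteq> {..<k}" "J \<noteq> {}" "J \<noteq> {..<k}" using J by (auto simp: proper_parts_def)
  have fin: "finite J" by (rule finite_subset[OF Jk(1)]) simp
  define i where "i = card J"
  have i1: "1 \<le> i" using Jk(2) fin by (simp add: i_def Suc_le_eq card_gt_0_iff)
  have ik: "i < k" using psubset_card_mono[of "{..<k}" J] Jk by (simp add: i_def psubset_eq)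
  have split: "J \<union> ({..<k} - J) = {..<k}" using Jk by auto
  note [measurable] = borel_measurable_section_mass[OF \<mu> D Jk(1)] D measurable_merge_section[OF Jk(1)]
  have "(\<integral>\<^sup>+z. indicator D z * section_mass k \<mu> D J z \<partial>(\<Pi>\<^sub>M j\<in>{..<k}. \<mu>)) =
      (\<integral>\<^sup>+a. \<integral>\<^sup>+b. indicator D (merge J ({..<k} - J) (a, b)) * section_mass k \<mu> D J (merge J ({..<k} - J) (a, b))
        \<partial>(\<Pi>\<^sub>M j\<in>{..<k} - J. \<mu>) \<partial>(\<Pi>\<^sub>M j\<in>J. \<mu>))"
    using product_nn_integral_fold[of J "{..<k} - J" "\<lambda>z. indicator D z * section_mass k \<mu> D J z"] fin
    unfolding split by simp
  also have "\<dots> = (\<integral>\<^sup>+a. (section_mass k \<mu> D J a)\<^sup>2 \<partial>(\<Pi>\<^sub>M j\<in>J. \<mu>))"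
  proof (rule nn_integral_cong)
    fix a assume a: "a \<in> space (\<Pi>\<^sub>M j\<in>J. \<mu>)"
    have "(\<lambda>b. merge J ({..<k} - J) (a, b)) \<in> measurable (\<Pi>\<^sub>M j\<in>{..<k} - J. \<mu>) (\<Pi>\<^sub>M j\<in>{..<k}. \<mu>)"
      by (intro measurable_compose[OF measurable_Pair1'[OF a] measurable_merge_section] Jk)
    then have [measurable]: "(\<lambda>b. indicator D (merge J ({..<k} - J) (a, b)) :: ennreal) \<in> borel_measurable (\<Pi>\<^sub>M j\<in>{..<k} - J. \<mu>)"
      by measurable
    have m: "section_mass k \<mu> D J (merge J ({..<k} - J) (a, b)) = section_mass k \<mu> D J a" for b
      unfolding section_mass_def merge_merge_fst ..
    show "(\<integral>\<^sup>+b. indicator D (merge J ({..<k} - J) (a, b)) * section_mass k \<mu> D J (merge J ({..<k} - J) (a, b))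
        \<partial>(\<Pi>\<^sub>M j\<in>{..<k} - J. \<mu>)) = (section_mass k \<mu> D J a)\<^sup>2"
      unfolding m by (subst nn_integral_multc) (simp_all add: section_mass_def power2_eq_square)
  qed
  also have "\<dots> = (\<integral>\<^sup>+x. (section_mass k \<mu> D {..<i} x)\<^sup>2 \<partial>(\<Pi>\<^sub>M j\<in>{..<i}. \<mu>))"
  proof -
    obtain t where t: "bij_betw t {..<i} J"
      using finite_same_card_bij[of "{..<i}" J] fin by (auto simp: i_def)
    then obtain p where p: "p permutes {..<k}" "\<forall>j\<in>{..<i}. p j = t j"
      using permutation_extending_injection[of t "{..<i}" k] Jk(1) ik by (auto simp: bij_betw_def)
    have pJ: "p ` {..<i} = J" using p(2) t by (auto simp: bij_betw_def)
    have bij: "bij_betw p {..<i} J"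
      using pJ permutes_inj_on[OF p(1)] by (simp add: bij_betw_def)
    have i': "{..<i} \<subseteq> {..<k}" using ik by auto
    have "(\<integral>\<^sup>+a. (section_mass k \<mu> D J a)\<^sup>2 \<partial>(\<Pi>\<^sub>M j\<in>J. \<mu>)) =
        (\<integral>\<^sup>+a. (section_mass k \<mu> D {..<i} (\<lambda>j\<in>{..<i}. a (p j)))\<^sup>2 \<partial>(\<Pi>\<^sub>M j\<in>J. \<mu>))"
      using ik by (intro nn_integral_cong) (simp add: section_mass_reindex[OF \<mu> D sym p(1) _ pJ])
    also have "\<dots> = (\<integral>\<^sup>+x. (section_mass k \<mu> D {..<i} x)\<^sup>2 \<partial>(\<Pi>\<^sub>M j\<in>{..<i}. \<mu>))"
      using borel_measurable_section_mass(1)[OF \<mu> D i']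
      by (intro nn_integral_PiM_reindex[OF \<mu> _ bij, of "\<lambda>x. (section_mass k \<mu> D {..<i} x)\<^sup>2"]) auto
    finally show ?thesis .
  qed
  also have "\<dots> \<le> R_bound k \<mu> D"
  proof -
    have "{..<k} - {..<i} = {i..<k}" by auto
    then have "(\<integral>\<^sup>+x. (section_mass k \<mu> D {..<i} x)\<^sup>2 \<partial>(\<Pi>\<^sub>M j\<in>{..<i}. \<mu>)) \<in>
      (\<lambda>i. \<integral>\<^sup>+x. (\<integral>\<^sup>+y. indicator D (merge {..<i} {i..<k} (x, y))
        \<partial>(\<Pi>\<^sub>M j\<in>{i..<k}. \<mu>))\<^sup>2 \<partial>(\<Pi>\<^sub>M j\<in>{..<i}. \<mu>)) ` {1..k - 1}"
      unfolding section_mass_def using i1 ik by (intro image_eqI[of _ _ i]) auto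
    then show ?thesis
      unfolding R_bound_def using i1 ik by (auto intro: Max_ge)
  qed
  finally show ?thesis .
qed

text \<open>The Mecke formula for the constant functional 1: the points placed at the positions
  outside \<open>J\<close> are integrated against the product measure.\<close>

lemma poisson_expectation_mixed_count:
  assumes \<mu>: "finite_measure \<mu>" and D: "D \<in> sets (\<Pi>\<^sub>M j\<in>{..<k}. \<mu>)" and J: "J \<subseteq> {..<k}"
    and z: "z \<in> space (\<Pi>\<^sub>M j\<in>{..<k}. \<mu>)"
  shows "poisson_expectation k \<mu> (mixed_count k D J z) = section_mass k \<mu> D J z"
    and "configuration_functional \<mu> (mixed_count k D J z)"
proof -
  let ?F = "\<lambda>u. indicator D (merge J ({..<k} - J) (z, u)) :: ennreal"
  have zJ: "restrict z J \<in> space (\<Pi>\<^sub>M j\<in>J. \<mu>)" using z J by (auto simp: space_PiM PiE_iff)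
  have "(\<lambda>u. merge J ({..<k} - J) (restrict z J, u)) \<in> measurable (\<Pi>\<^sub>M j\<in>{..<k} - J. \<mu>) (\<Pi>\<^sub>M j\<in>{..<k}. \<mu>)"
    by (intro measurable_compose[OF measurable_Pair1'[OF zJ] measurable_merge_section] J)
  then have F: "?F \<in> borel_measurable (\<Pi>\<^sub>M j\<in>{..<k} - J. \<mu>)"
    using D unfolding merge_restrict_fst by measurable
  show conf: "configuration_functional \<mu> (mixed_count k D J z)"
    unfolding mixed_count_def by (rule configuration_functional_sum_injections[OF _ F]) simp
  have one: "configuration_functional \<mu> (\<lambda>_ _. 1)" by (simp add: configuration_functional_def)
  have "poisson_expectation k \<mu> (mixed_count k D J z) = poisson_expectation 0 \<mu> (mixed_count k D J z)"
    by (rule poisson_expectation_shift[OF \<mu> conf])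
  also have "\<dots> = poisson_expectation 0 \<mu> (\<lambda>I x. (\<Sum>t\<in>injections ({..<k} - J) I. ?F (\<lambda>j\<in>{..<k} - J. x (t j))) * 1)"
    by (rule arg_cong[where f = "poisson_expectation 0 \<mu>"]) (simp add: mixed_count_def fun_eq_iff)
  also have "\<dots> = section_mass k \<mu> D J z"
    by (subst poisson_mecke[OF \<mu> one _ F, of k])
      (auto simp: poisson_expectation_1[OF \<mu>] section_mass_def)
  finally show "poisson_expectation k \<mu> (mixed_count k D J z) = section_mass k \<mu> D J z" .
qed

section \<open>Point processes and their intensity measures\<close>

lemma borel_measurable_emeasure_counting_measure_algebra:
  assumes "B \<in> sets Y"
  shows "(\<lambda>\<nu>. emeasure \<nu> B) \<in> borel_measurable (counting_measure_algebra Y)"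
  unfolding counting_measure_algebra_def using assms
  by (intro measurable_SUP1[where i = B] measurable_vimage_algebra1) auto

lemma space_counting_measure_algebra: "space (counting_measure_algebra Y) = counting_measures Y"
  unfolding counting_measure_algebra_def space_Sup_eq_UN by auto

lemma point_process_counting_measures:
  assumes "point_process M Y \<xi>" "\<omega> \<in> space M"
  shows "\<xi> \<omega> \<in> counting_measures Y"
  using assms measurable_space[of \<xi> M "counting_measure_algebra Y" \<omega>]
  by (simp add: point_process_def space_counting_measure_algebra)

lemma point_process_measurable:
  assumes "point_process M Y \<xi>" "B \<in> sets Y"
  shows "(\<lambda>\<omega>. emeasure (\<xi> \<omega>) B) \<in> borel_measurable M"
  using assms by (auto simp: point_process_def
      intro: measurable_compose[OF _ borel_measurable_emeasure_counting_measure_algebra])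

text \<open>\<open>measure_of\<close> returns the prescribed values once the set function is
  countably additive, which here is the interchange of sum and expectation.\<close>

lemma emeasure_intensity_measure:
  assumes \<xi>: "point_process M Y \<xi>" and B: "B \<in> sets Y"
  shows "emeasure (intensity_measure M Y \<xi>) B = (\<integral>\<^sup>+\<omega>. emeasure (\<xi> \<omega>) B \<partial>M)"
  unfolding intensity_measure_def
proof (rule emeasure_measure_of_sigma[OF sets.sigma_algebra_axioms _ _ B])
  show "positive (sets Y) (\<lambda>B. \<integral>\<^sup>+\<omega>. emeasure (\<xi> \<omega>) B \<partial>M)"
    by (simp add: positive_def)
  show "countably_additive (sets Y) (\<lambda>B. \<integral>\<^sup>+\<omega>. emeasure (\<xi> \<omega>) B \<partial>M)"
  proof (rule countably_additiveI)
    fix C :: "nat \<Rightarrow> _" assume C: "range C \<subseteq> sets Y" "disjoint_family C"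
    have "(\<Sum>n. \<integral>\<^sup>+\<omega>. emeasure (\<xi> \<omega>) (C n) \<partial>M) = (\<integral>\<^sup>+\<omega>. (\<Sum>n. emeasure (\<xi> \<omega>) (C n)) \<partial>M)"
      using C by (intro nn_integral_suminf[symmetric] point_process_measurable[OF \<xi>]) auto
    also have "\<dots> = (\<integral>\<^sup>+\<omega>. emeasure (\<xi> \<omega>) (\<Union>n. C n) \<partial>M)"
    proof (rule nn_integral_cong)
      fix \<omega> assume "\<omega> \<in> space M"
      then have "sets (\<xi> \<omega>) = sets Y"
        using point_process_counting_measures[OF \<xi>] by (auto simp: counting_measures_def)
      then show "(\<Sum>n. emeasure (\<xi> \<omega>) (C n)) = emeasure (\<xi> \<omega>) (\<Union>n. C n)"
        using C by (intro suminf_emeasure) auto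
    qed
    finally show "(\<Sum>n. \<integral>\<^sup>+\<omega>. emeasure (\<xi> \<omega>) (C n) \<partial>M) = (\<integral>\<^sup>+\<omega>. emeasure (\<xi> \<omega>) (\<Union>n. C n) \<partial>M)" .
  qed
qed

section \<open>Poisson approximation of the U-statistic\<close>

lemma distinct_tuples_in_restrict:
  "distinct_tuples_in k I (restrict x I) D = distinct_tuples_in k I x D"
proof -
  have "(\<lambda>j\<in>{..<k}. restrict x I (s j)) = (\<lambda>j\<in>{..<k}. x (s j))" if "s \<in> {..<k} \<rightarrow>\<^sub>E I" for s
    using that by (intro restrict_ext) auto
  then show ?thesis by (auto simp: distinct_tuples_in_def)
qed

lemma configuration_functional_times:
  assumes "configuration_functional \<mu> \<Phi>" "configuration_functional \<mu> \<Psi>"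
  shows "configuration_functional \<mu> (\<lambda>I x. \<Phi> I x * \<Psi> I x)"
  using assms unfolding configuration_functional_def by (auto intro!: borel_measurable_times_ennreal)

lemma configuration_functional_const: "configuration_functional \<mu> (\<lambda>_ _. c)"
  by (simp add: configuration_functional_def)

lemma emeasure_tuple_image_measure:
  assumes g: "\<And>x. x \<in> D \<Longrightarrow> g x \<in> space Y" and A: "A \<in> sets Y" and I: "finite I"
  shows "emeasure (tuple_image_measure k D g Y I x) A =
    ennreal (1 / fact k) * of_nat (card (distinct_tuples_in k I x {x \<in> D. g x \<in> A}))"
proof -
  let ?T = "distinct_tuples_in k I x D" and ?h = "\<lambda>s. g (\<lambda>j\<in>{..<k}. x (s j))"
  have h: "?h \<in> measurable (count_space ?T) Y"
    using g by (auto simp: distinct_tuples_in_def)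
  have "?h -` A \<inter> ?T = distinct_tuples_in k I x {x \<in> D. g x \<in> A}"
    by (auto simp: distinct_tuples_in_def)
  moreover have "distinct_tuples_in k I x {x \<in> D. g x \<in> A} \<subseteq> ?T"
    by (auto simp: distinct_tuples_in_def)
  ultimately have "emeasure (distr (count_space ?T) Y ?h) A = of_nat (card (distinct_tuples_in k I x {x \<in> D. g x \<in> A}))"
    using I by (simp add: emeasure_distr[OF h A] emeasure_count_space finite_subset)
  moreover have "(1 / fact k :: ennreal) = ennreal (1 / fact k)"
    by (metis divide_ennreal ennreal_1 ennreal_of_nat_eq_real_of_nat fact_gt_zero of_nat_fact zero_le_one)
  ultimately show ?thesis
    by (simp add: tuple_image_measure_def dirac_sum_def)
qed

text \<open>One family \<open>A\<close> of \<open>d\<close> disjoint sets is fixed throughout. The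
  suprema over \<open>d\<close> and \<open>A\<close> come last, so the final bound must involve
  neither.\<close>

locale poisson_u_statistic = proper_poisson_process M S \<mu> \<eta> X \<tau>
  for M :: "'w measure" and S :: "'a measure" and \<mu> :: "'a measure"
    and \<eta> :: "'w \<Rightarrow> 'a measure" and X :: "nat \<Rightarrow> 'w \<Rightarrow> 'a" and \<tau> :: "'w \<Rightarrow> enat" +
  fixes k d :: nat and D :: "(nat \<Rightarrow> 'a) set" and g :: "(nat \<Rightarrow> 'a) \<Rightarrow> 'b"
    and Y :: "'b measure" and \<xi> :: "'w \<Rightarrow> 'b measure" and A :: "nat \<Rightarrow> 'b set"
  assumes k: "1 \<le> k"
    and D: "D \<in> sets (\<Pi>\<^sub>M j\<in>{..<k}. \<mu>)"
    and D_sym: "symmetric_set k D"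
    and g: "g \<in> restrict_space (\<Pi>\<^sub>M j\<in>{..<k}. \<mu>) D \<rightarrow>\<^sub>M Y"
    and g_sym: "symmetric_fun k D g"
    and \<xi>: "point_process M Y \<xi>"
    and \<xi>_eq: "AE \<omega> in M. \<xi> \<omega> = tuple_image_measure k D g Y (index_set (\<tau> \<omega>)) (\<lambda>n. X n \<omega>)"
    and A: "A \<in> disjoint_tuples d Y"
begin

definition "fibre i = {x \<in> D. g x \<in> A i}"

text \<open>\<open>div\<close> yields a natural number for every configuration without a
  divisibility argument; along the process the division is shown to be exact almost surely.\<close>

definition "counts I x = (\<lambda>i\<in>{..<d}. card (distinct_tuples_in k I x (fibre i)) div fact k)"

abbreviation "Z \<omega> \<equiv> count_vector d A (\<xi> \<omega>)"

abbreviation "ktuples \<equiv> (\<Pi>\<^sub>M j\<in>{..<k}. \<mu>)"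

definition "mean_count i = ennreal (1 / fact k) * emeasure ktuples (fibre i)"

text \<open>The 2 bounds the test functions, \<open>1 / fact k\<close> comes from passing to ordered
  tuples, and the sum of section masses is the expected total of the mixed counts for a given
  \<open>z\<close>.\<close>

definition "count_error i = ennreal (2 / fact k) *
  (\<integral>\<^sup>+z. indicator (fibre i) z * (\<Sum>J\<in>proper_parts k. section_mass k \<mu> D J z) \<partial>ktuples)"

lemma finite_mu: "finite_measure \<mu>" by (rule finite_measure_axioms)

lemma A_sets: "i < d \<Longrightarrow> A i \<in> sets Y"
  using A by (auto simp: disjoint_tuples_def)

lemma A_disjoint: "i < d \<Longrightarrow> j < d \<Longrightarrow> i \<noteq> j \<Longrightarrow> A i \<inter> A j = {}"
  using A by (auto simp: disjoint_tuples_def disjoint_family_on_def)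

lemma D_space: "D \<subseteq> space ktuples"
  using D by (rule sets.sets_into_space)

lemma g_space: "x \<in> D \<Longrightarrow> g x \<in> space Y"
  using measurable_space[OF g, of x] D_space by (auto simp: space_restrict_space)

lemma fibre_sets [measurable]:
  assumes "i < d"
  shows "fibre i \<in> sets ktuples"
proof -
  have "g -` A i \<inter> space (restrict_space ktuples D) \<in> sets (restrict_space ktuples D)"
    by (rule measurable_sets[OF g A_sets[OF assms]])
  moreover have "g -` A i \<inter> space (restrict_space ktuples D) = fibre i"
    using D_space by (auto simp: fibre_def space_restrict_space)
  moreover have "D \<inter> space ktuples \<in> sets ktuples" using D by auto
  ultimately show ?thesis by (simp add: sets_restrict_space_iff)
qed

lemma fibre_symmetric: "symmetric_set k (fibre i)"
  using D_sym g_sym by (auto simp: symmetric_set_def symmetric_fun_def fibre_def)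

lemma section_mass_measurable:
  "J \<in> proper_parts k \<Longrightarrow> section_mass k \<mu> D J \<in> borel_measurable ktuples"
  by (rule borel_measurable_section_mass(2)[OF finite_mu D]) (auto simp: proper_parts_def)

lemma configuration_functional_counts: "configuration_functional \<mu> (\<lambda>I x. G (counts I x))"
  unfolding counts_def by (rule configuration_functional_count_vector) (rule fibre_sets)

lemma \<xi>_measurable: "i < d \<Longrightarrow> (\<lambda>\<omega>. emeasure (\<xi> \<omega>) (A i)) \<in> borel_measurable M"
  by (rule point_process_measurable[OF \<xi> A_sets])

text \<open>A tuple count is divisible by \<open>fact k\<close> because \<open>\<xi> \<omega>\<close> is a counting measure.\<close>

lemma AE_tuple_counts:
  "AE \<omega> in M. finite (index_set (\<tau> \<omega>)) \<and> (\<forall>i<d. \<exists>n. emeasure (\<xi> \<omega>) (A i) = of_nat n \<and>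
    card (distinct_tuples_in k (index_set (\<tau> \<omega>)) (\<lambda>i\<in>index_set (\<tau> \<omega>). X i \<omega>) (fibre i)) = n * fact k)"
  using AE_tau_finite \<xi>_eq AE_space
proof eventually_elim
  case (elim \<omega>)
  let ?I = "index_set (\<tau> \<omega>)"
  have fin: "finite ?I" using elim(1) by (cases "\<tau> \<omega>") (auto simp: index_set_def lessThan_def[symmetric])
  have "\<exists>n. emeasure (\<xi> \<omega>) (A i) = of_nat n \<and>
      card (distinct_tuples_in k ?I (\<lambda>i\<in>?I. X i \<omega>) (fibre i)) = n * fact k" if i: "i < d" for i
  proof -
    let ?c = "card (distinct_tuples_in k ?I (\<lambda>i\<in>?I. X i \<omega>) (fibre i))"
    have "emeasure (\<xi> \<omega>) (A i) = ennreal (1 / fact k) * of_nat ?c"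
      unfolding elim(2) fibre_def distinct_tuples_in_restrict
      by (rule emeasure_tuple_image_measure[OF g_space A_sets[OF i] fin])
    also have "\<dots> = ennreal (real ?c / fact k)"
      by (simp add: ennreal_mult[symmetric] ennreal_of_nat_eq_real_of_nat)
    finally have eq: "emeasure (\<xi> \<omega>) (A i) = ennreal (real ?c / fact k)" .
    have "emeasure (\<xi> \<omega>) (A i) \<in> range of_nat \<union> {\<infinity>}"
      using point_process_counting_measures[OF \<xi> elim(3)] A_sets[OF i] by (auto simp: counting_measures_def)
    with eq obtain n where n: "emeasure (\<xi> \<omega>) (A i) = of_nat n" by auto
    then have "real ?c / fact k = real n"
      using eq by (simp add: ennreal_of_nat_eq_real_of_nat)
    then have "real ?c = real (n * fact k)" by (simp add: field_simps)
    then have "?c = n * fact k" by (simp only: of_nat_eq_iff)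
    then show ?thesis using n by blast
  qed
  then show ?case using fin by blast
qed

text \<open>Three readings of the counts: a functional of the configuration, for expectations; a
  normalized sum over ordered tuples, for the Mecke formula; the values of \<open>\<xi>\<close>, for
  the intensity.\<close>

lemma AE_count_vector:
  "AE \<omega> in M. Z \<omega> = counts (index_set (\<tau> \<omega>)) (\<lambda>i\<in>index_set (\<tau> \<omega>). X i \<omega>) \<and>
    (\<forall>i<d. ennreal (real (Z \<omega> i)) = ennreal (1 / fact k) * (\<Sum>s\<in>injections {..<k} (index_set (\<tau> \<omega>)).
      indicator (fibre i) (\<lambda>j\<in>{..<k}. (\<lambda>i\<in>index_set (\<tau> \<omega>). X i \<omega>) (s j))) \<and>
      ennreal (real (Z \<omega> i)) = emeasure (\<xi> \<omega>) (A i))"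
  using AE_tuple_counts
proof eventually_elim
  case (elim \<omega>)
  let ?I = "index_set (\<tau> \<omega>)" and ?x = "\<lambda>i\<in>index_set (\<tau> \<omega>). X i \<omega>"
  have fin: "finite ?I" using elim by blast
  have *: "Z \<omega> i = card (distinct_tuples_in k ?I ?x (fibre i)) div fact k \<and>
      ennreal (real (Z \<omega> i)) = ennreal (1 / fact k) * of_nat (card (distinct_tuples_in k ?I ?x (fibre i))) \<and>
      ennreal (real (Z \<omega> i)) = emeasure (\<xi> \<omega>) (A i)" if i: "i < d" for i
  proof -
    obtain n where n: "emeasure (\<xi> \<omega>) (A i) = of_nat n" "card (distinct_tuples_in k ?I ?x (fibre i)) = n * fact k"
      using elim i by blast
    have Zn: "Z \<omega> i = n"
      using n(1) i by (simp add: count_vector_def measure_def)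
    have "ennreal (1 / fact k) * of_nat (n * fact k) = ennreal (1 / fact k * real (n * fact k))"
      by (subst ennreal_mult) (simp_all only: ennreal_of_nat_eq_real_of_nat of_nat_0_le_iff, simp)
    also have "1 / fact k * real (n * fact k) = real n" by simp
    finally show ?thesis
      unfolding Zn n by (simp add: ennreal_of_nat_eq_real_of_nat)
  qed
  have Z_eq: "Z \<omega> = counts ?I ?x"
  proof
    fix i show "Z \<omega> i = counts ?I ?x i"
      using * by (cases "i < d") (auto simp: counts_def count_vector_def)
  qed
  show ?case
    unfolding card_distinct_tuples_in[OF fin, symmetric] using * Z_eq by blast
qed

lemma nn_integral_count_vector:
  "(\<integral>\<^sup>+\<omega>. G (Z \<omega>) \<partial>M) = poisson_expectation k \<mu> (\<lambda>I y. G (counts I y))"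
proof -
  have "(\<integral>\<^sup>+\<omega>. G (Z \<omega>) \<partial>M) =
      (\<integral>\<^sup>+\<omega>. G (counts (index_set (\<tau> \<omega>)) (\<lambda>i\<in>index_set (\<tau> \<omega>). X i \<omega>)) \<partial>M)"
    by (rule nn_integral_cong_AE, rule eventually_mono[OF AE_count_vector]) simp
  also have "\<dots> = poisson_expectation 0 \<mu> (\<lambda>I y. G (counts I y))"
    by (rule nn_integral_configuration_functional[OF configuration_functional_counts])
  also have "\<dots> = poisson_expectation k \<mu> (\<lambda>I y. G (counts I y))"
    by (rule poisson_expectation_shift[OF finite_mu configuration_functional_counts, symmetric])
  finally show ?thesis .
qed

text \<open>The factor \<open>Z \<omega> i\<close> is a normalized sum over ordered tuples, so the
  Mecke formula with \<open>L = {..<k}\<close> adds the \<open>k\<close> points of \<open>z\<close>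
  to the configuration seen by \<open>G\<close>.\<close>

lemma nn_integral_count_times:
  assumes i: "i < d"
  shows "(\<integral>\<^sup>+\<omega>. ennreal (real (Z \<omega> i)) * G (Z \<omega>) \<partial>M) = ennreal (1 / fact k) *
    (\<integral>\<^sup>+z. indicator (fibre i) z *
      poisson_expectation k \<mu> (\<lambda>I y. G (counts ({..<k} \<union> I) (merge {..<k} I (z, y)))) \<partial>ktuples)"
proof -
  let ?\<Phi> = "\<lambda>I x. (\<Sum>s\<in>injections {..<k} I. indicator (fibre i) (\<lambda>j\<in>{..<k}. x (s j))) * G (counts I x)"
  have conf: "configuration_functional \<mu> ?\<Phi>"
    by (rule configuration_functional_times[OF configuration_functional_tuple_count[OF fibre_sets[OF i]]
          configuration_functional_counts])
  have "(\<integral>\<^sup>+\<omega>. ennreal (real (Z \<omega> i)) * G (Z \<omega>) \<partial>M) =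
      (\<integral>\<^sup>+\<omega>. ennreal (1 / fact k) * ?\<Phi> (index_set (\<tau> \<omega>)) (\<lambda>i\<in>index_set (\<tau> \<omega>). X i \<omega>) \<partial>M)"
  proof (rule nn_integral_cong_AE)
    show "AE \<omega> in M. ennreal (real (Z \<omega> i)) * G (Z \<omega>) =
        ennreal (1 / fact k) * ?\<Phi> (index_set (\<tau> \<omega>)) (\<lambda>i\<in>index_set (\<tau> \<omega>). X i \<omega>)"
      using AE_count_vector
    proof eventually_elim
      case (elim \<omega>)
      then have "ennreal (real (Z \<omega> i)) = ennreal (1 / fact k) * (\<Sum>s\<in>injections {..<k} (index_set (\<tau> \<omega>)).
          indicator (fibre i) (\<lambda>j\<in>{..<k}. (\<lambda>i\<in>index_set (\<tau> \<omega>). X i \<omega>) (s j)))"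
        using i by blast
      moreover have "G (Z \<omega>) = G (counts (index_set (\<tau> \<omega>)) (\<lambda>i\<in>index_set (\<tau> \<omega>). X i \<omega>))"
        using elim by simp
      ultimately show ?case by (simp only: mult.assoc)
    qed
  qed
  also have "\<dots> = poisson_expectation 0 \<mu> (\<lambda>I x. ennreal (1 / fact k) * ?\<Phi> I x)"
    by (rule nn_integral_configuration_functional[OF configuration_functional_times[OF configuration_functional_const conf]])
  also have "\<dots> = ennreal (1 / fact k) * poisson_expectation 0 \<mu> ?\<Phi>"
    by (rule poisson_expectation_cmult) (rule configuration_functionalD(1)[OF conf], simp)
  also have "poisson_expectation 0 \<mu> ?\<Phi> = (\<integral>\<^sup>+z. indicator (fibre i) z *
      poisson_expectation k \<mu> (\<lambda>I y. G (counts ({..<k} \<union> I) (merge {..<k} I (z, y)))) \<partial>ktuples)"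
    using fibre_sets[OF i] by (intro poisson_mecke[OF finite_mu configuration_functional_counts]) auto
  finally show ?thesis .
qed

lemma nn_integral_count:
  assumes "i < d"
  shows "(\<integral>\<^sup>+\<omega>. ennreal (real (Z \<omega> i)) \<partial>M) = mean_count i"
  using nn_integral_count_times[OF assms, of "\<lambda>_. 1"] fibre_sets[OF assms]
  by (simp add: poisson_expectation_1[OF finite_mu] mean_count_def)

lemma emeasure_intensity:
  assumes "i < d"
  shows "emeasure (intensity_measure M Y \<xi>) (A i) = mean_count i"
proof -
  have "(\<integral>\<^sup>+\<omega>. ennreal (real (Z \<omega> i)) \<partial>M) = (\<integral>\<^sup>+\<omega>. emeasure (\<xi> \<omega>) (A i) \<partial>M)"
    by (rule nn_integral_cong_AE, rule eventually_mono[OF AE_count_vector]) (use assms in blast)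
  then show ?thesis
    unfolding emeasure_intensity_measure[OF \<xi> A_sets[OF assms]] nn_integral_count[OF assms] by (rule sym)
qed

lemma mean_count_finite: "mean_count i < \<infinity>"
proof -
  interpret product_sigma_finite "\<lambda>_. \<mu>" by (rule product_sigma_finite)
  have "emeasure ktuples (fibre i) \<le> emeasure ktuples (space ktuples)"
    by (rule emeasure_space)
  also have "\<dots> = (\<Prod>j<k. emeasure \<mu> (space \<mu>))"
    unfolding space_PiM by (rule emeasure_PiM) auto
  also have "\<dots> < \<infinity>"
    using emeasure_real[of "space \<mu>"] by (auto simp: ennreal_power)
  finally show ?thesis by (simp add: mean_count_def ennreal_mult_less_top)
qed

section \<open>Effect of an added tuple on the counts\<close>

lemma counts_merge:
  assumes i: "i < d" and z: "z \<in> fibre i" and I: "finite I" "I \<inter> {..<k} = {}"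
    and no_mixed: "\<And>J. J \<in> proper_parts k \<Longrightarrow> mixed_count k D J z I y = 0"
  shows "counts ({..<k} \<union> I) (merge {..<k} I (z, y)) = (counts I y)(i := Suc (counts I y i))"
proof
  fix j
  have zD: "z \<in> D" using z by (simp add: fibre_def)
  have z_ext: "z \<in> extensional {..<k}"
    using D_space zD by (auto simp: space_PiM PiE_iff)
  have no: "merge J ({..<k} - J) (z, \<lambda>j\<in>{..<k} - J. y (t j)) \<notin> D"
    if J: "J \<in> proper_parts k" and t: "t \<in> injections ({..<k} - J) I" for J t
  proof
    assume m: "merge J ({..<k} - J) (z, \<lambda>j\<in>{..<k} - J. y (t j)) \<in> D"
    have "(indicator D (merge J ({..<k} - J) (z, \<lambda>j\<in>{..<k} - J. y (t j))) :: ennreal) \<le> mixed_count k D J z I y"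
      unfolding mixed_count_def by (rule member_le_sum) (use t I in auto)
    also have "\<dots> = 0" by (rule no_mixed[OF J])
    finally show False using m by (simp del: merge_restrict)
  qed
  show "counts ({..<k} \<union> I) (merge {..<k} I (z, y)) j = ((counts I y)(i := Suc (counts I y i))) j"
  proof (cases "j < d")
    case j: True
    have "card (distinct_tuples_in k ({..<k} \<union> I) (merge {..<k} I (z, y)) (fibre j)) =
        card (distinct_tuples_in k I y (fibre j)) + (if z \<in> fibre j then fact k else 0)"
    proof (rule card_distinct_tuples_in_merge[OF fibre_symmetric I(2,1) _ z_ext])
      fix J t assume "J \<in> proper_parts k" "t \<in> injections ({..<k} - J) I"
      then show "merge J ({..<k} - J) (z, \<lambda>j\<in>{..<k} - J. y (t j)) \<notin> fibre j"
        using no unfolding fibre_def by blast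
    qed (use k in simp)
    \<comment> \<open>Disjointness of the \<open>A j\<close> confines the change to coordinate
      \<open>i\<close>, where adding \<open>fact k\<close> to the tuple count raises the quotient by
      exactly one.\<close>
    moreover have "z \<in> fibre j \<longleftrightarrow> j = i"
      using z A_disjoint[OF i j] by (auto simp: fibre_def)
    ultimately show ?thesis using j by (simp add: counts_def)
  qed (use i in \<open>auto simp: counts_def\<close>)
qed

text \<open>Without mixed tuples the two arguments of \<open>G\<close> agree. Otherwise some mixed
  count is at least 1, hence \<open>r\<close> is at least 2 and dominates every value of
  \<open>G\<close>.\<close>

lemma counts_merge_bound:
  fixes G :: "(nat \<Rightarrow> nat) \<Rightarrow> ennreal" and y :: "nat \<Rightarrow> 'a"
  assumes i: "i < d" and z: "z \<in> fibre i" and I: "finite I" "I \<inter> {..<k} = {}" and G: "\<And>v. G v \<le> 2"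
  defines "p \<equiv> G (counts ({..<k} \<union> I) (merge {..<k} I (z, y)))"
    and "q \<equiv> G ((counts I y)(i := Suc (counts I y i)))"
    and "r \<equiv> 2 * (\<Sum>J\<in>proper_parts k. mixed_count k D J z I y)"
  shows "p \<le> q + r" and "q \<le> p + r"
proof -
  have cases: "p = q \<or> 2 \<le> r"
  proof (cases "\<forall>J\<in>proper_parts k. mixed_count k D J z I y = 0")
    case True
    then show ?thesis unfolding p_def q_def using counts_merge[OF i z I] by simp
  next
    case False
    then obtain J where J: "J \<in> proper_parts k" "mixed_count k D J z I y \<noteq> 0" by blast
    have "\<exists>t\<in>injections ({..<k} - J) I. (indicator D (merge J ({..<k} - J) (z, \<lambda>j\<in>{..<k} - J. y (t j))) :: ennreal) \<noteq> 0"
      using J(2) unfolding mixed_count_def by (meson sum.neutral)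
    then obtain t where t: "t \<in> injections ({..<k} - J) I"
      "(indicator D (merge J ({..<k} - J) (z, \<lambda>j\<in>{..<k} - J. y (t j))) :: ennreal) = 1"
      by (auto simp: indicator_def simp del: merge_restrict split: if_splits)
    have "1 \<le> mixed_count k D J z I y"
      unfolding mixed_count_def t(2)[symmetric] by (rule member_le_sum) (use t(1) I in auto)
    also have "\<dots> \<le> (\<Sum>J\<in>proper_parts k. mixed_count k D J z I y)"
      by (rule member_le_sum) (use J in auto)
    finally have "2 * 1 \<le> r" unfolding r_def by (intro mult_left_mono) auto
    then show ?thesis by simp
  qed
  have p2: "p \<le> 2" and q2: "q \<le> 2" unfolding p_def q_def by (rule G)+
  have add: "u \<le> u + r" "r \<le> u + r" for u
    by (rule add_increasing2[OF zero_le order_refl], rule add_increasing[OF zero_le order_refl])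
  from cases show "p \<le> q + r"
  proof
    assume "2 \<le> r"
    from p2 this add(2) show ?thesis by (rule order_trans[OF order_trans])
  qed (simp only: add)
  from cases show "q \<le> p + r"
  proof
    assume "2 \<le> r"
    from q2 this add(2) show ?thesis by (rule order_trans[OF order_trans])
  qed (simp only: add)
qed

text \<open>Taking expectations in the pointwise bound replaces each mixed count by its section
  mass.\<close>

lemma poisson_expectation_merge_bound:
  fixes G :: "(nat \<Rightarrow> nat) \<Rightarrow> ennreal"
  assumes i: "i < d" and z: "z \<in> fibre i" and G: "\<And>v. G v \<le> 2"
  defines "P \<equiv> poisson_expectation k \<mu> (\<lambda>I y. G (counts ({..<k} \<union> I) (merge {..<k} I (z, y))))"
    and "Q \<equiv> poisson_expectation k \<mu> (\<lambda>I y. G ((counts I y)(i := Suc (counts I y i))))"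
    and "R \<equiv> 2 * (\<Sum>J\<in>proper_parts k. section_mass k \<mu> D J z)"
  shows "P \<le> Q + R" and "Q \<le> P + R"
proof -
  let ?p = "\<lambda>I y. G (counts ({..<k} \<union> I) (merge {..<k} I (z, y)))"
  let ?q = "\<lambda>I y. G ((counts I y)(i := Suc (counts I y i)))"
  let ?r = "\<lambda>I y. 2 * (\<Sum>J\<in>proper_parts k. mixed_count k D J z I y)"
  have z_space: "z \<in> space ktuples" using z D_space by (auto simp: fibre_def)
  have J: "J \<subseteq> {..<k}" if "J \<in> proper_parts k" for J using that by (simp add: proper_parts_def)
  note mix = poisson_expectation_mixed_count[OF finite_mu D J z_space]
  have mp: "?p {k..<k + n} \<in> borel_measurable (\<Pi>\<^sub>M j\<in>{k..<k + n}. \<mu>)" for n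
  proof -
    have "(\<lambda>y. merge {..<k} {k..<k + n} (z, y)) \<in> measurable (\<Pi>\<^sub>M j\<in>{k..<k + n}. \<mu>) (\<Pi>\<^sub>M j\<in>{..<k} \<union> {k..<k + n}. \<mu>)"
      by (intro measurable_compose[OF measurable_Pair1'[OF z_space] measurable_merge])
    then show ?thesis
      by (rule measurable_compose) (rule configuration_functionalD(1)[OF configuration_functional_counts], simp)
  qed
  have mq: "?q {k..<k + n} \<in> borel_measurable (\<Pi>\<^sub>M j\<in>{k..<k + n}. \<mu>)" for n
    by (rule configuration_functionalD(1)[OF configuration_functional_counts[of "\<lambda>v. G (v(i := Suc (v i)))"]]) simp
  have mm: "mixed_count k D J z {k..<k + n} \<in> borel_measurable (\<Pi>\<^sub>M j\<in>{k..<k + n}. \<mu>)"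
    if "J \<in> proper_parts k" for J n
    using configuration_functionalD(1)[OF mix(2)[OF that]] by simp
  have ms: "(\<lambda>y. \<Sum>J\<in>proper_parts k. mixed_count k D J z {k..<k + n} y) \<in> borel_measurable (\<Pi>\<^sub>M j\<in>{k..<k + n}. \<mu>)" for n
    by (intro borel_measurable_sum mm)
  then have mr: "?r {k..<k + n} \<in> borel_measurable (\<Pi>\<^sub>M j\<in>{k..<k + n}. \<mu>)" for n
    by (intro borel_measurable_times_ennreal) auto
  have "poisson_expectation k \<mu> ?r = 2 * poisson_expectation k \<mu> (\<lambda>I y. \<Sum>J\<in>proper_parts k. mixed_count k D J z I y)"
    by (rule poisson_expectation_cmult[OF ms])
  also have "\<dots> = R"
    unfolding R_def by (subst poisson_expectation_sum[OF finite_proper_parts mm]) (simp_all add: mix(1))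
  finally have r: "poisson_expectation k \<mu> ?r = R" .
  have "P \<le> poisson_expectation k \<mu> (\<lambda>I y. ?q I y + ?r I y)"
    unfolding P_def by (intro poisson_expectation_mono counts_merge_bound(1)[OF i z _ _ G]) auto
  also have "\<dots> = Q + R"
    unfolding Q_def r[symmetric] by (rule poisson_expectation_add[OF mq mr])
  finally show "P \<le> Q + R" .
  have "Q \<le> poisson_expectation k \<mu> (\<lambda>I y. ?p I y + ?r I y)"
    unfolding Q_def by (intro poisson_expectation_mono counts_merge_bound(2)[OF i z _ _ G]) auto
  also have "\<dots> = P + R"
    unfolding P_def r[symmetric] by (rule poisson_expectation_add[OF mp mr])
  finally show "Q \<le> P + R" .
qed

text \<open>Provides \<open>up\<close> and \<open>lo\<close> of \<open>stein_step\<close>. Both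
  sides become integrals over the fibre with factor \<open>1 / fact k\<close>: \<open>a\<close> by
  the Mecke formula, \<open>b\<close> because \<open>mean_count i\<close> is the normalized mass of
  the fibre.\<close>

lemma count_vector_identity_bound:
  fixes G :: "(nat \<Rightarrow> nat) \<Rightarrow> ennreal"
  assumes i: "i < d" and G: "\<And>v. G v \<le> 2"
  defines "a \<equiv> (\<integral>\<^sup>+\<omega>. ennreal (real (Z \<omega> i)) * G (Z \<omega>) \<partial>M)"
    and "b \<equiv> mean_count i * (\<integral>\<^sup>+\<omega>. G ((Z \<omega>)(i := Suc (Z \<omega> i))) \<partial>M)"
  shows "a \<le> b + count_error i" and "b \<le> a + count_error i"
proof -
  let ?c = "ennreal (1 / fact k)" and ?one = "indicator (fibre i) :: _ \<Rightarrow> ennreal"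
  define P where "P z = poisson_expectation k \<mu> (\<lambda>I y. G (counts ({..<k} \<union> I) (merge {..<k} I (z, y))))" for z
  define Q where "Q = poisson_expectation k \<mu> (\<lambda>I y. G ((counts I y)(i := Suc (counts I y i))))"
  define R where "R z = (\<Sum>J\<in>proper_parts k. section_mass k \<mu> D J z)" for z
  have [measurable]: "fibre i \<in> sets ktuples" by (rule fibre_sets[OF i])
  have [measurable]: "R \<in> borel_measurable ktuples"
    unfolding R_def by (intro borel_measurable_sum section_mass_measurable)
  have [measurable]: "P \<in> borel_measurable ktuples"
    unfolding P_def by (rule borel_measurable_poisson_expectation_merge[OF finite_mu configuration_functional_counts]) simp
  have a: "a = ?c * (\<integral>\<^sup>+z. ?one z * P z \<partial>ktuples)"
    unfolding a_def P_def by (rule nn_integral_count_times[OF i])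
  have "b = mean_count i * Q"
    unfolding b_def Q_def by (subst nn_integral_count_vector[of "\<lambda>v. G (v(i := Suc (v i)))"]) simp
  also have "\<dots> = ?c * (\<integral>\<^sup>+z. ?one z * Q \<partial>ktuples)"
    by (simp add: mean_count_def nn_integral_multc mult.assoc)
  finally have b: "b = ?c * (\<integral>\<^sup>+z. ?one z * Q \<partial>ktuples)" .
  have "ennreal (2 / fact k) = ?c * 2"
    by (metis ennreal_mult ennreal_numeral divide_nonneg_nonneg fact_ge_zero mult.commute
        times_divide_eq_right mult.right_neutral zero_le_numeral zero_le_one)
  then have e: "count_error i = ?c * (\<integral>\<^sup>+z. ?one z * (2 * R z) \<partial>ktuples)"
    unfolding count_error_def R_def[symmetric]
    by (subst mult.left_commute[of "indicator _ _"], subst nn_integral_cmult) (simp_all add: mult.assoc)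
  have le: "?one z * P z \<le> ?one z * Q + ?one z * (2 * R z)" "?one z * Q \<le> ?one z * P z + ?one z * (2 * R z)" for z
    using poisson_expectation_merge_bound[OF i _ G, of z]
    by (auto simp: P_def Q_def R_def split: split_indicator)
  have "a \<le> ?c * (\<integral>\<^sup>+z. ?one z * Q + ?one z * (2 * R z) \<partial>ktuples)"
    unfolding a by (intro mult_left_mono nn_integral_mono le) auto
  also have "\<dots> = b + count_error i"
    unfolding b e by (subst nn_integral_add) (simp_all add: distrib_left)
  finally show "a \<le> b + count_error i" .
  have "b \<le> ?c * (\<integral>\<^sup>+z. ?one z * P z + ?one z * (2 * R z) \<partial>ktuples)"
    unfolding b by (intro mult_left_mono nn_integral_mono le) auto
  also have "\<dots> = a + count_error i"
    unfolding a e by (subst nn_integral_add) (simp_all add: distrib_left)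
  finally show "b \<le> a + count_error i" .
qed

lemma sum_error_le: "(\<Sum>i<d. count_error i) \<le> ennreal (2 ^ (k + 1) / fact k) * R_bound k \<mu> D"
proof -
  define R where "R z = (\<Sum>J\<in>proper_parts k. section_mass k \<mu> D J z)" for z
  have [measurable]: "R \<in> borel_measurable ktuples"
    unfolding R_def by (intro borel_measurable_sum section_mass_measurable)
  note [measurable] = D
  \<comment> \<open>Disjoint sets \<open>A i\<close> have disjoint fibres inside \<open>D\<close>;
    this is what keeps the bound independent of \<open>d\<close>.\<close>
  have ind: "(\<Sum>i<d. indicator (fibre i) z) \<le> (indicator D z :: ennreal)" for z
  proof (cases "\<exists>i<d. z \<in> fibre i")
    case True
    then obtain i where i: "i < d" "z \<in> fibre i" by blast
    have "z \<notin> fibre j" if "j < d" "j \<noteq> i" for j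
      using A_disjoint[OF i(1) that(1)] that(2) i(2) by (auto simp: fibre_def)
    then have "(\<Sum>j<d. indicator (fibre j) z) = (\<Sum>j<d. if j = i then 1 else 0 :: ennreal)"
      using i(2) by (intro sum.cong) (auto simp: indicator_def)
    also have "\<dots> = 1" using i(1) by simp
    also have "1 = (indicator D z :: ennreal)" using i(2) by (simp add: fibre_def)
    finally show ?thesis by simp
  qed (auto simp: indicator_def)
  have "(\<Sum>i<d. count_error i) = ennreal (2 / fact k) * (\<Sum>i<d. \<integral>\<^sup>+z. indicator (fibre i) z * R z \<partial>ktuples)"
    unfolding count_error_def R_def by (rule sum_distrib_left[symmetric])
  also have "(\<Sum>i<d. \<integral>\<^sup>+z. indicator (fibre i) z * R z \<partial>ktuples) = (\<integral>\<^sup>+z. (\<Sum>i<d. indicator (fibre i) z) * R z \<partial>ktuples)"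
    unfolding sum_distrib_right by (rule nn_integral_sum[symmetric]) simp
  also have "\<dots> \<le> (\<integral>\<^sup>+z. indicator D z * R z \<partial>ktuples)"
    by (intro nn_integral_mono mult_right_mono ind) simp
  also have "\<dots> = (\<Sum>J\<in>proper_parts k. \<integral>\<^sup>+z. indicator D z * section_mass k \<mu> D J z \<partial>ktuples)"
    unfolding R_def sum_distrib_left using section_mass_measurable
    by (intro nn_integral_sum borel_measurable_times_ennreal) auto
  also have "\<dots> \<le> (\<Sum>J\<in>proper_parts k. R_bound k \<mu> D)"
    by (intro sum_mono nn_integral_section_mass_le_R_bound finite_mu D D_sym)
  also have "\<dots> = of_nat (card (proper_parts k)) * R_bound k \<mu> D" by simp
  also have "\<dots> \<le> of_nat (2 ^ k) * R_bound k \<mu> D"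
    using card_proper_parts_le[of k] by (intro mult_right_mono) (simp_all only: of_nat_le_iff zero_le)
  also have "ennreal (2 / fact k) * (of_nat (2 ^ k) * R_bound k \<mu> D) = ennreal (2 ^ (k + 1) / fact k) * R_bound k \<mu> D"
  proof -
    have "ennreal (2 / fact k) * of_nat (2 ^ k) = ennreal (2 / fact k * real (2 ^ k))"
      by (subst ennreal_mult) (simp_all only: ennreal_of_nat_eq_real_of_nat of_nat_0_le_iff, simp)
    then show ?thesis by (simp add: mult.assoc[symmetric])
  qed
  finally show ?thesis by (simp add: mult_left_mono)
qed

lemma wasserstein_dist_le:
  assumes \<gamma>: "poisson_process N Y (intensity_measure M Y \<xi>) \<gamma>"
  shows "wasserstein_dist d M Z N (\<lambda>\<omega>. count_vector d A (\<gamma> \<omega>)) \<le> ennreal (2 ^ (k + 1) / fact k) * R_bound k \<mu> D"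
  unfolding wasserstein_dist_def
proof (rule SUP_least)
  fix h assume h: "h \<in> lipschitz_test_functions d"
  let ?B = "ennreal (2 ^ (k + 1) / fact k) * R_bound k \<mu> D"
  let ?V = "\<lambda>\<omega>. count_vector d A (\<gamma> \<omega>)"
  show "ennreal \<bar>(\<integral>\<omega>. h (Z \<omega>) \<partial>M) - (\<integral>\<omega>. h (?V \<omega>) \<partial>N)\<bar> \<le> ?B"
  \<comment> \<open>The Stein bound works with real errors. If their sum is infinite,
    \<open>sum_error_le\<close> makes the right side infinite as well.\<close>
  proof (cases "(\<Sum>i<d. count_error i) = \<infinity>")
    case True
    have "?B = \<infinity>" using sum_error_le unfolding True infinity_ennreal_def by (simp only: top_unique)
    then show ?thesis by (simp only: infinity_ennreal_def top_greatest)
  next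
    case False
    then have e_fin: "count_error i < \<infinity>" if "i < d" for i
      using that by (auto simp: less_top[symmetric])
    define l where "l i = enn2real (mean_count i)" for i
    define e where "e i = enn2real (count_error i)" for i
    have l: "ennreal (l i) = mean_count i" for i using mean_count_finite[of i] by (simp add: l_def)
    have e: "ennreal (e i) = count_error i" if "i < d" for i using e_fin[OF that] by (simp add: e_def)
    have "\<bar>(\<integral>\<omega>. h (Z \<omega>) \<partial>M) - poisson_smooths l h d (\<lambda>i\<in>{..<d}. 0)\<bar> \<le> (\<Sum>i<d. e i)"
    proof (rule P.stein_bound[OF _ _ _ _ _ _ _ h])
      show "Z \<in> measurable M (count_space UNIV)"
        by (rule measurable_count_vector(2)[OF \<xi>_measurable])
      show "\<And>i. i < d \<Longrightarrow> (\<integral>\<^sup>+\<omega>. ennreal (real (Z \<omega> i)) \<partial>M) = ennreal (l i)"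
        by (simp add: l nn_integral_count)
    qed (simp_all add: l e count_vector_in_nat_vectors count_vector_identity_bound, simp_all add: l_def e_def)
    \<comment> \<open>The reference number is the same, since \<open>\<gamma>\<close> has the means
      \<open>l i\<close> too; its Stein identity is exact, so every error is 0.\<close>
    moreover have "\<bar>(\<integral>\<omega>. h (?V \<omega>) \<partial>N) - poisson_smooths l h d (\<lambda>i\<in>{..<d}. 0)\<bar> \<le> (\<Sum>i<d. 0)"
    proof -
      interpret N: prob_space N using \<gamma> by (simp add: poisson_process_def point_process_def)
      have pp: "point_process N Y \<gamma>" using \<gamma> by (simp add: poisson_process_def)
      have fin: "emeasure (intensity_measure M Y \<xi>) (A i) < \<infinity>" if "i < d" for i
        using mean_count_finite[of i] that by (simp add: emeasure_intensity)
      have meas: "measure (intensity_measure M Y \<xi>) (A i) = l i" if "i < d" for i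
        using that by (simp add: measure_def emeasure_intensity l_def)
      have id: "(\<integral>\<^sup>+\<omega>. ennreal (real (?V \<omega> i)) * G (?V \<omega>) \<partial>N) =
          ennreal (l i) * (\<integral>\<^sup>+\<omega>. G ((?V \<omega>)(i := Suc (?V \<omega> i))) \<partial>N)" if "i < d" for i G
        using N.poisson_count_vector_identity[OF \<gamma> A fin that] that by (simp add: meas)
      show ?thesis
      proof (rule N.stein_bound[OF _ _ _ _ _ _ _ h])
        show "?V \<in> measurable N (count_space UNIV)"
          by (rule measurable_count_vector(2)[OF point_process_measurable[OF pp A_sets]])
        show "(\<integral>\<^sup>+\<omega>. ennreal (real (?V \<omega> i)) \<partial>N) = ennreal (l i)" if "i < d" for i
          using id[OF that, of "\<lambda>_. 1"] by (simp add: N.emeasure_space_1)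
      qed (simp_all add: id count_vector_in_nat_vectors, simp_all add: l_def)
    qed
    ultimately have "\<bar>(\<integral>\<omega>. h (Z \<omega>) \<partial>M) - (\<integral>\<omega>. h (?V \<omega>) \<partial>N)\<bar> \<le> (\<Sum>i<d. e i)" by simp
    then have "ennreal \<bar>(\<integral>\<omega>. h (Z \<omega>) \<partial>M) - (\<integral>\<omega>. h (?V \<omega>) \<partial>N)\<bar> \<le> ennreal (\<Sum>i<d. e i)"
      by (rule ennreal_leI)
    also have "\<dots> = (\<Sum>i<d. ennreal (e i))"
      by (rule sum_ennreal[symmetric]) (simp add: e_def)
    also have "\<dots> = (\<Sum>i<d. count_error i)" by (intro sum.cong) (simp_all add: e)
    also have "\<dots> \<le> ?B" by (rule sum_error_le)
    finally show ?thesis .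
  qed
qed

end

theorem theorem3p4:
  fixes \<X> :: "'a measure" and \<Y> :: "'b measure"
    and M :: "'w measure" and N :: "'v measure"
    and \<mu> :: "'a measure" and k :: nat
    and D :: "(nat \<Rightarrow> 'a) set" and g :: "(nat \<Rightarrow> 'a) \<Rightarrow> 'b"
    and \<eta> :: "'w \<Rightarrow> 'a measure" and X :: "nat \<Rightarrow> 'w \<Rightarrow> 'a" and \<tau> :: "'w \<Rightarrow> enat"
    and \<xi> :: "'w \<Rightarrow> 'b measure" and \<gamma> :: "'v \<Rightarrow> 'b measure"
  assumes "k \<ge> 1"
    and "D \<in> sets (\<Pi>\<^sub>M j\<in>{..<k}. \<X>)"
    and "symmetric_set k D"
    and "g \<in> restrict_space (\<Pi>\<^sub>M j\<in>{..<k}. \<X>) D \<rightarrow>\<^sub>M \<Y>"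
    and "symmetric_fun k D g"
    and "finite_measure \<mu>"
    and "poisson_process M \<X> \<mu> \<eta>"
    and "proper_representation M \<X> \<eta> X \<tau>"
    and "point_process M \<Y> \<xi>"
    and "AE \<omega> in M. \<xi> \<omega> = tuple_image_measure k D g \<Y> (index_set (\<tau> \<omega>)) (\<lambda>n. X n \<omega>)"
    and "poisson_process N \<Y> (intensity_measure M \<Y> \<xi>) \<gamma>"
  shows "d_pi \<Y> M \<xi> N \<gamma> \<le> ennreal (2 ^ (k + 1) / fact k) * R_bound k \<mu> D"
  unfolding d_pi_def
proof (intro SUP_least)
  fix d A assume A: "A \<in> disjoint_tuples d \<Y>"
  have "sets \<mu> = sets \<X>" using assms(7) by (simp add: poisson_process_def)
  then have sets_eq: "sets (\<Pi>\<^sub>M j\<in>{..<k}. \<mu>) = sets (\<Pi>\<^sub>M j\<in>{..<k}. \<X>)" by (intro sets_PiM_cong) auto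
  have g: "g \<in> restrict_space (\<Pi>\<^sub>M j\<in>{..<k}. \<mu>) D \<rightarrow>\<^sub>M \<Y>"
    using assms(4) measurable_cong_sets[OF sets_restrict_space_cong[OF sets_eq] refl] by blast
  have M: "prob_space M" using assms(9) by (simp add: point_process_def)
  interpret poisson_u_statistic M \<X> \<mu> \<eta> X \<tau> k d D g \<Y> \<xi> A
    by (intro poisson_u_statistic.intro proper_poisson_process.intro proper_poisson_process_axioms.intro
        poisson_u_statistic_axioms.intro assms M g A) (simp add: sets_eq assms(2))
  show "wasserstein_dist d M (\<lambda>\<omega>. count_vector d A (\<xi> \<omega>)) N (\<lambda>\<omega>. count_vector d A (\<gamma> \<omega>))
      \<le> ennreal (2 ^ (k + 1) / fact k) * R_bound k \<mu> D"
    by (rule wasserstein_dist_le[OF assms(11)])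
qed

end
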